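(* Let $\mathcal L(x,y)=f(x)+\Phi(x,y)-h(y)$ satisfy the standing assumptions given in the context. Let $\delta\in[0,1)$, $c_\alpha>0$, $c_\beta\ge0$ be chosen as stated in Parts I and II below, and define $$\Psi_1=\frac{c_\alpha L_{xx}}{2\gamma_0L_{yx}^2}\,\zeta,\qquad\Psi_2=\frac{\sqrt{c_\beta(1-(c_\alpha+c_\beta+\delta))}}{\gamma_0L_{yy}},\qquad\zeta=-1+\sqrt{1+\frac{4(1-\delta)\gamma_0}{c_\alpha}\frac{L_{yx}^2}{L_{xx}^2}}$$ (for $L_{xx}=0$, $\Psi_1$ is understood as the limit of this expression as $L_{xx}\downarrow0$; $\Psi_2$ is used only when $L_{yy}>0$). For any given $(x_0,y_0)\in\mathrm{dom} f\times\mathrm{dom} h$, $\bar\tau,\gamma_0>0$ and $\eta\in(0,1)$, the algorithm APDB (described in the context) is well defined, i.e., the number of inner iterations in each outer iteration $k$ is finite and bounded by $1+\log_{1/\eta}(\bar\tau/\Psi)$ uniformly for $k\ge0$ for some $\Psi>0$, specified below. Let $\{x_k,y_k\}_{k\ge0}$ be the iterates generated by APDB using the test function $E_k$ given in the context, let $\tau_k,\sigma_k$ denote the accepted step sizes, and put $t_k=\sigma_k/\sigma_0$, $T_K=\sum_{k=0}^{K-1}t_k$, $\bar x_K=\frac1{T_K}\sum_{k=0}^{K-1}t_kx_{k+1}$, $\bar y_K=\frac1{T_K}\sum_{k=0}^{K-1}t_ky_{k+1}$, and $\Delta(x,y)=\frac1{\tau_0}\mathbf D_{\mathcal X}(x,x_0)+\frac1{\sigma_0}\mathbf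 D_{\mathcal Y}(y,y_0)$. Then for any $(x,y)\in\mathcal X\times\mathcal Y$ and all $K\ge1$, $$\mathcal L(\bar x_K,y)-\mathcal L(x,\bar y_K)\le\frac1{T_K}\Delta(x,y).\qquad(\ast)$$ (Part I) Suppose $\mu=0$. Let $c_\alpha,c_\beta>0$ and $c_\alpha+c_\beta+\delta\in(0,1)$ if $L_{yy}>0$; and let $c_\beta=0$, $c_\alpha+\delta\in(0,1]$ otherwise. Then $\Psi=\Psi_1$ if $L_{yy}=0$ and $\Psi=\min\{\Psi_1,\Psi_2\}$ if $L_{yy}>0$; moreover $T_K=\Omega(K)$, implying an $\mathcal O(1/K)$ sublinear rate in $(\ast)$. Moreover, if a saddle point of $\mathcal L$ exists and $\delta>0$ is chosen, then $\{(x_k,y_k)\}_{k\ge0}$ converges to a saddle point $(x^*,y^* )$ such that $$\gamma_0\mathbf D_{\mathcal X}(x^*,x_K)+[1-(c_\alpha+c_\beta)]\,\mathbf D_{\mathcal Y}(y^*,y_K)\le\sigma_0\Delta(x^*,y^* ).$$ (Part II) Suppose $\mu>0$ and $L_{yy}=0$; let $\|x\|_{\mathcal X}=\sqrt{\langle x,x\rangle}$ and $\mathbf D_{\mathcal X}(x,\bar x)=\frac12\|x-\bar x\|_{\mathcal X}^2$. Assume $c_\alpha+\delta\in(0,1]$ and $c_\beta=0$. Then $\Psi=\Psi_1$ and $T_K=\Omega(K^2)$, implying an $\mathcal O(1/K^2)$ sublinear rate in $(\ast)$. If a saddle point of $\mathcal L$ exists (since $\mu>0$, all saddle points share the same unique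 $x$-coordinate, say $x^*$), then $\{x_k\}$ converges to $x^*$ and $\{y_k\}$ has a limit point. Moreover, if $\delta>0$, then any limit point $(x^*,y^* )$ of $\{(x_k,y_k)\}$ is a saddle point satisfying $0\le\mathcal L(\bar x_K,y^* )-\mathcal L(x^*,\bar y_K)\le\mathcal O(1/K^2)$ for $K\ge1$, and $$\gamma_K\mathbf D_{\mathcal X}(x^*,x_K)+(1-c_\alpha)\mathbf D_{\mathcal Y}(y^*,y_K)\le\sigma_0\Delta(x^*,y^* )$$ holds with $\gamma_K=\Omega(K^2)$.
   Context: Setting. $(\mathcal X,\|\cdot\|_{\mathcal X})$ and $(\mathcal Y,\|\cdot\|_{\mathcal Y})$ are finite-dimensional real normed spaces, with dual norms $\|\cdot\|_{\mathcal X^*},\|\cdot\|_{\mathcal Y^*}$. $\mathcal L(x,y)=f(x)+\Phi(x,y)-h(y)$ with $f:\mathcal X\to\mathbb R\cup\{+\infty\}$, $h:\mathcal Y\to\mathbb R\cup\{+\infty\}$, $\Phi:\mathcal X\times\mathcal Y\to\mathbb R$. A saddle point is $(x^*,y^* )$ with $\mathcal L(x^*,y)\le\mathcal L(x^*,y^* )\le\mathcal L(x,y^* )$ for all $(x,y)\in\mathcal X\times\mathcal Y$. Bregman distances. $\varphi_{\mathcal X}:\mathcal X\to\mathbb R$ and $\varphi_{\mathcal Y}:\mathcal Y\to\mathbb R$ are differentiable on open sets containing $\mathrm{dom} f$ and $\mathrm{dom} h$, have closed domains, and are $1$-strongly convex with respect to $\|\cdot\|_{\mathcal X}$, $\|\cdot\|_{\mathcal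 Y}$. $\mathbf D_{\mathcal X}(x,\bar x)=\varphi_{\mathcal X}(x)-\varphi_{\mathcal X}(\bar x)-\langle\nabla\varphi_{\mathcal X}(\bar x),x-\bar x\rangle$, and $\mathbf D_{\mathcal Y}$ is defined likewise from $\varphi_{\mathcal Y}$. Standing assumptions. $f$ and $h$ are closed convex; $f$ has convexity modulus $\mu\ge0$: $f(x)\ge f(\bar x)+\langle g,x-\bar x\rangle+\frac\mu2\|x-\bar x\|_{\mathcal X}^2$ for all $x,\bar x\in\mathrm{dom} f$, $g\in\partial f(\bar x)$. If $\mu>0$, one fixes $\|x\|_{\mathcal X}=\sqrt{\langle x,x\rangle}$ and $\mathbf D_{\mathcal X}(x,\bar x)=\frac12\|x-\bar x\|_{\mathcal X}^2$. $\Phi$ is continuous and: (i) for any $y\in\mathrm{dom} h$, $\Phi(\cdot,y)$ is convex and differentiable, and for some $L_{xx}\ge0$, $\|\nabla_x\Phi(x,y)-\nabla_x\Phi(\bar x,y)\|_{\mathcal X^*}\le L_{xx}\|x-\bar x\|_{\mathcal X}$ for all $x,\bar x\in\mathrm{dom} f$; (ii) for any $x\in\mathrm{dom} f$, $\Phi(x,\cdot)$ is concave and differentiable, and there exist $L_{yx}>0$, $L_{yy}\ge0$ with $\|\nabla_y\Phi(x,y)-\nabla_y\Phi(\bar x,\bar y)\|_{\mathcal Y^*}\le L_{yy}\|y-\bar y\|_{\mathcal Y}+L_{yx}\|x-\bar x\|_{\mathcal X}$ for all $x,\bar x\in\mathrm{dom} f$, $y,\bar y\in\mathrm{dom} h$.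 Algorithm APDB (accelerated primal-dual algorithm with backtracking). Input $(x_0,y_0)$, $\mu\ge0$, $c_\alpha,c_\beta,\delta\ge0$, $\eta\in(0,1)$, $\bar\tau,\gamma_0>0$. Set $(x_{-1},y_{-1})=(x_0,y_0)$, $\tau_0=\bar\tau$, $\sigma_{-1}=\gamma_0\bar\tau$, $\alpha_0=c_\alpha/\sigma_{-1}$, $\beta_0=c_\beta/\sigma_{-1}$. For outer iterations $k=0,1,2,\dots$: (a) (inner backtracking loop) set $\sigma_k=\gamma_k\tau_k$, $\theta_k=\sigma_{k-1}/\sigma_k$, $\alpha_{k+1}=c_\alpha/\sigma_k$, $\beta_{k+1}=c_\beta/\sigma_k$, and compute $s_k=(1+\theta_k)\nabla_y\Phi(x_k,y_k)-\theta_k\nabla_y\Phi(x_{k-1},y_{k-1})$, $y_{k+1}=\arg\min_{y}\,h(y)-\langle s_k,y\rangle+\frac1{\sigma_k}\mathbf D_{\mathcal Y}(y,y_k)$, $x_{k+1}=\arg\min_{x}\,f(x)+\langle\nabla_x\Phi(x_k,y_{k+1}),x\rangle+\frac1{\tau_k}\mathbf D_{\mathcal X}(x,x_k)$. If $E_k(x_{k+1},y_{k+1})\le-\frac\delta{\tau_k}\mathbf D_{\mathcal X}(x_{k+1},x_k)-\frac\delta{\sigma_k}\mathbf D_{\mathcal Y}(y_{k+1},y_k)$, accept and go to (b); otherwise replace $\tau_k$ by $\eta\tau_k$ and repeat (a). (b) Set $\gamma_{k+1}=\gamma_k(1+\mu\tau_k)$, $\tau_{k+1}=\tau_k\sqrt{\gamma_k/\gamma_{k+1}}$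 (the initial trial value for iteration $k+1$). Here $$\begin{aligned}E_k(x,y)=\;&\Phi(x,y)-\Phi(x_k,y)-\langle\nabla_x\Phi(x_k,y),x-x_k\rangle-\tfrac1{\tau_k}\mathbf D_{\mathcal X}(x,x_k)\\&+\tfrac1{2\alpha_{k+1}}\|\nabla_y\Phi(x,y)-\nabla_y\Phi(x_k,y)\|_{\mathcal Y^*}^2+\tfrac1{2\beta_{k+1}}\|\nabla_y\Phi(x_k,y)-\nabla_y\Phi(x_k,y_k)\|_{\mathcal Y^*}^2\\&-\Big(\tfrac1{\sigma_k}-\theta_k(\alpha_k+\beta_k)\Big)\mathbf D_{\mathcal Y}(y,y_k),\end{aligned}$$ with the convention $0^2/0=0$ (relevant when $L_{yy}=0$ and $\beta_{k+1}=0$). Asymptotic notation is as $K\to\infty$, with constants independent of $K$.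
   Formalization: The bound 1+log_{1/η}(τ̄/Ψ) on inner iterations, negative (so false) if τ̄<ηΨ, is corrected: the number of step-size reductions is at most max(0, 1+log_{1/η}(τ̄/Ψ)), and the number of inner passes at most 1+max(0, ⌈log_{1/η}(τ̄/Ψ)⌉). *)

theory Defs
  imports "HOL-Analysis.Analysis" "HOL-Library.Landau_Symbols"
begin

section \<open>Convex analysis on normed spaces\<close>

definition finite_dimensional :: "'a::real_vector set \<Rightarrow> bool" where
  "finite_dimensional V \<longleftrightarrow> (\<exists>B. finite B \<and> span B = V)"

text \<open>The dual space is the type of bounded linear functionals \<^typ>\<open>'a \<Rightarrow>\<^sub>L real\<close>; its
  norm is the operator norm, that is, the dual norm, and the pairing of \<open>g\<close> with \<open>x\<close> is
  \<open>blinfun_apply g x\<close>. Gradients are elements of the dual space.\<close>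

definition grad :: "('a::real_normed_vector \<Rightarrow> real) \<Rightarrow> 'a \<Rightarrow> 'a \<Rightarrow>\<^sub>L real" where
  "grad F x = Blinfun (frechet_derivative F (at x))"

definition norm_from_inner_product :: "'a::real_normed_vector itself \<Rightarrow> bool" where
  "norm_from_inner_product _ \<longleftrightarrow>
     (\<exists>ip :: 'a \<Rightarrow> 'a \<Rightarrow> real. bilinear ip \<and> (\<forall>x y. ip x y = ip y x) \<and>
        (\<forall>x. norm x = sqrt (ip x x)))"

definition edom :: "('a \<Rightarrow> ereal) \<Rightarrow> 'a set" where
  "edom f = {x. f x < \<infinity>}"

definition epigraph :: "('a \<Rightarrow> ereal) \<Rightarrow> ('a \<times> real) set" where
  "epigraph f = {(x, r). f x \<le> ereal r}"

definition closed_convex_fun :: "('a::real_normed_vector \<Rightarrow> ereal) \<Rightarrow> bool" where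
  "closed_convex_fun f \<longleftrightarrow> (\<forall>x. f x \<noteq> -\<infinity>) \<and> closed (epigraph f) \<and> convex (epigraph f)"

definition subdifferential :: "('a::real_normed_vector \<Rightarrow> ereal) \<Rightarrow> 'a \<Rightarrow> ('a \<Rightarrow>\<^sub>L real) set" where
  "subdifferential f xb = {g. \<forall>x. f x \<ge> f xb + ereal (blinfun_apply g (x - xb))}"

definition convexity_modulus :: "('a::real_normed_vector \<Rightarrow> ereal) \<Rightarrow> real \<Rightarrow> bool" where
  "convexity_modulus f \<mu> \<longleftrightarrow> \<mu> \<ge> 0 \<and>
     (\<forall>x\<in>edom f. \<forall>xb\<in>edom f. \<forall>g\<in>subdifferential f xb.
        f x \<ge> f xb + ereal (blinfun_apply g (x - xb) + \<mu> / 2 * (norm (x - xb))\<^sup>2))"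

definition strongly_convex_on :: "real \<Rightarrow> 'a::real_normed_vector set \<Rightarrow> ('a \<Rightarrow> real) \<Rightarrow> bool" where
  "strongly_convex_on m S \<phi> \<longleftrightarrow> convex S \<and>
     (\<forall>x\<in>S. \<forall>y\<in>S. \<forall>t\<in>{0..1}.
        \<phi> ((1 - t) *\<^sub>R x + t *\<^sub>R y)
          \<le> (1 - t) * \<phi> x + t * \<phi> y - m / 2 * t * (1 - t) * (norm (x - y))\<^sup>2)"

text \<open>A distance-generating function \<open>\<phi>\<close> is a real function together with its domain \<open>C\<close>;
  its values outside \<open>C\<close> are irrelevant. An everywhere finite \<open>\<phi>\<close> is the case \<open>C = UNIV\<close>.
  The set \<open>S\<close> stands for the domain of \<open>f\<close> (or \<open>h\<close>).\<close>

definition distance_generating ::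
  "('a::real_normed_vector \<Rightarrow> real) \<Rightarrow> 'a set \<Rightarrow> 'a set \<Rightarrow> bool" where
  "distance_generating \<phi> C S \<longleftrightarrow> closed C \<and> strongly_convex_on 1 C \<phi> \<and>
     (\<exists>U. open U \<and> S \<subseteq> U \<and> U \<subseteq> C \<and> (\<forall>x\<in>U. \<phi> differentiable (at x)))"

definition bregman :: "('a::real_normed_vector \<Rightarrow> real) \<Rightarrow> 'a \<Rightarrow> 'a \<Rightarrow> real" where
  "bregman \<phi> x xb = \<phi> x - \<phi> xb - blinfun_apply (grad \<phi> xb) (x - xb)"

definition is_limit_point :: "(nat \<Rightarrow> 'a::topological_space) \<Rightarrow> 'a \<Rightarrow> bool" where
  "is_limit_point u l \<longleftrightarrow> (\<exists>r. strict_mono r \<and> (u \<circ> r) \<longlonglongrightarrow> l)"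


section \<open>The saddle point problem\<close>

record ('a, 'b) spp =
  fun_f :: "'a \<Rightarrow> ereal"
  fun_h :: "'b \<Rightarrow> ereal"
  Phi :: "'a \<Rightarrow> 'b \<Rightarrow> real"
  phiX :: "'a \<Rightarrow> real"
  domX :: "'a set"
  phiY :: "'b \<Rightarrow> real"
  domY :: "'b set"

definition gradx :: "('a::real_normed_vector, 'b) spp \<Rightarrow> 'a \<Rightarrow> 'b \<Rightarrow> 'a \<Rightarrow>\<^sub>L real" where
  "gradx P x y = grad (\<lambda>u. Phi P u y) x"

definition grady :: "('a, 'b::real_normed_vector) spp \<Rightarrow> 'a \<Rightarrow> 'b \<Rightarrow> 'b \<Rightarrow>\<^sub>L real" where
  "grady P x y = grad (\<lambda>v. Phi P x v) y"

abbreviation DX :: "('a::real_normed_vector, 'b) spp \<Rightarrow> 'a \<Rightarrow> 'a \<Rightarrow> real" where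
  "DX P \<equiv> bregman (phiX P)"

abbreviation DY :: "('a, 'b::real_normed_vector) spp \<Rightarrow> 'b \<Rightarrow> 'b \<Rightarrow> real" where
  "DY P \<equiv> bregman (phiY P)"

text \<open>The sum is unambiguous if \<open>x\<close> is in the domain of \<open>f\<close> or \<open>y\<close> in that of \<open>h\<close>.
  Otherwise the \<^typ>\<open>ereal\<close> convention \<open>\<infinity> - \<infinity> = \<infinity>\<close> applies; if both domains are nonempty,
  no such point is a saddle point.\<close>

definition Lag :: "('a, 'b) spp \<Rightarrow> 'a \<Rightarrow> 'b \<Rightarrow> ereal" where
  "Lag P x y = fun_f P x + ereal (Phi P x y) - fun_h P y"

definition saddle_point :: "('a, 'b) spp \<Rightarrow> 'a \<Rightarrow> 'b \<Rightarrow> bool" where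
  "saddle_point P xs ys \<longleftrightarrow>
     (\<forall>x y. Lag P xs y \<le> Lag P xs ys \<and> Lag P xs ys \<le> Lag P x ys)"

locale standing_assumptions =
  fixes P :: "('a::real_normed_vector, 'b::real_normed_vector) spp"
    and \<mu> Lxx Lyx Lyy :: real
  assumes finite_dim_X: "finite_dimensional (UNIV :: 'a set)"
    and finite_dim_Y: "finite_dimensional (UNIV :: 'b set)"
    and f_closed_convex: "closed_convex_fun (fun_f P)"
    and h_closed_convex: "closed_convex_fun (fun_h P)"
    and dgf_X: "distance_generating (phiX P) (domX P) (edom (fun_f P))"
    and dgf_Y: "distance_generating (phiY P) (domY P) (edom (fun_h P))"
    and f_modulus: "convexity_modulus (fun_f P) \<mu>"
    and hilbert_X: "\<mu> > 0 \<Longrightarrow> norm_from_inner_product TYPE('a)"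
    and bregman_X: "\<And>x xb. \<mu> > 0 \<Longrightarrow> DX P x xb = 1 / 2 * (norm (x - xb))\<^sup>2"
    and Phi_continuous: "continuous_on UNIV (\<lambda>(x, y). Phi P x y)"
    and Lxx_nonneg: "Lxx \<ge> 0"
    and Phi_convex: "\<And>y. y \<in> edom (fun_h P) \<Longrightarrow> convex_on UNIV (\<lambda>x. Phi P x y)"
    and Phi_differentiable_x:
      "\<And>x y. y \<in> edom (fun_h P) \<Longrightarrow> (\<lambda>u. Phi P u y) differentiable (at x)"
    and gradx_Lipschitz:
      "\<And>x xb y. x \<in> edom (fun_f P) \<Longrightarrow> xb \<in> edom (fun_f P) \<Longrightarrow> y \<in> edom (fun_h P) \<Longrightarrow>
         norm (gradx P x y - gradx P xb y) \<le> Lxx * norm (x - xb)"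
    and Lyx_pos: "Lyx > 0"
    and Lyy_nonneg: "Lyy \<ge> 0"
    and Phi_concave: "\<And>x. x \<in> edom (fun_f P) \<Longrightarrow> concave_on UNIV (\<lambda>y. Phi P x y)"
    and Phi_differentiable_y:
      "\<And>x y. x \<in> edom (fun_f P) \<Longrightarrow> (\<lambda>v. Phi P x v) differentiable (at y)"
    and grady_Lipschitz:
      "\<And>x xb y yb. x \<in> edom (fun_f P) \<Longrightarrow> xb \<in> edom (fun_f P) \<Longrightarrow>
         y \<in> edom (fun_h P) \<Longrightarrow> yb \<in> edom (fun_h P) \<Longrightarrow>
         norm (grady P x y - grady P xb yb) \<le> Lyy * norm (y - yb) + Lyx * norm (x - xb)"


section \<open>The algorithm APDB\<close>

record ('a, 'b) apdb_input =
  x_init :: 'a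
  y_init :: 'b
  mu :: real
  c_alpha :: real
  c_beta :: real
  delta :: real
  eta :: real
  tau_bar :: real
  gamma0 :: real

text \<open>The state at the start of outer iteration \<open>k\<close> holds \<open>x\<^sub>k\<^sub>-\<^sub>1, y\<^sub>k\<^sub>-\<^sub>1, x\<^sub>k, y\<^sub>k, \<sigma>\<^sub>k\<^sub>-\<^sub>1, \<gamma>\<^sub>k\<close> and the
  initial trial value of \<open>\<tau>\<^sub>k\<close>. The functions below take this state and a trial step
  size \<open>\<tau>\<close>.\<close>

record ('a, 'b) apdb_state =
  x_prev :: 'a
  y_prev :: 'b
  x_cur :: 'a
  y_cur :: 'b
  sigma_prev :: real
  gamma_cur :: real
  tau_trial :: real

definition sigma_of :: "('a, 'b) apdb_state \<Rightarrow> real \<Rightarrow> real" where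
  "sigma_of s \<tau> = gamma_cur s * \<tau>"

definition theta_of :: "('a, 'b) apdb_state \<Rightarrow> real \<Rightarrow> real" where
  "theta_of s \<tau> = sigma_prev s / sigma_of s \<tau>"

definition s_vec ::
  "('a, 'b::real_normed_vector) spp \<Rightarrow> ('a, 'b) apdb_state \<Rightarrow> real \<Rightarrow> 'b \<Rightarrow>\<^sub>L real" where
  "s_vec P s \<tau> = (1 + theta_of s \<tau>) *\<^sub>R grady P (x_cur s) (y_cur s)
                 - theta_of s \<tau> *\<^sub>R grady P (x_prev s) (y_prev s)"

definition y_objective ::
  "('a, 'b::real_normed_vector) spp \<Rightarrow> ('a, 'b) apdb_state \<Rightarrow> real \<Rightarrow> 'b \<Rightarrow> ereal" where
  "y_objective P s \<tau> y =
     fun_h P y - ereal (blinfun_apply (s_vec P s \<tau>) y) + ereal (1 / sigma_of s \<tau> * DY P y (y_cur s))"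

definition next_y ::
  "('a, 'b::real_normed_vector) spp \<Rightarrow> ('a, 'b) apdb_state \<Rightarrow> real \<Rightarrow> 'b" where
  "next_y P s \<tau> = arg_min (y_objective P s \<tau>) (\<lambda>_. True)"

definition x_objective ::
  "('a::real_normed_vector, 'b::real_normed_vector) spp \<Rightarrow> ('a, 'b) apdb_state \<Rightarrow> real \<Rightarrow> 'a \<Rightarrow> ereal"
  where
  "x_objective P s \<tau> x =
     fun_f P x + ereal (blinfun_apply (gradx P (x_cur s) (next_y P s \<tau>)) x)
       + ereal (1 / \<tau> * DX P x (x_cur s))"

definition next_x ::
  "('a::real_normed_vector, 'b::real_normed_vector) spp \<Rightarrow> ('a, 'b) apdb_state \<Rightarrow> real \<Rightarrow> 'a" where
  "next_x P s \<tau> = arg_min (x_objective P s \<tau>) (\<lambda>_. True)"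

text \<open>The test function \<open>E\<^sub>k\<close>. If \<open>\<beta>\<^sub>k\<^sub>+\<^sub>1 = 0\<close> then \<open>0\<^sup>2 / 0 = 0\<close> holds by the convention
  \<open>x / 0 = 0\<close>; with \<open>L\<^sub>y\<^sub>y = 0\<close> the numerator does vanish.\<close>

definition test_E ::
  "('a::real_normed_vector, 'b::real_normed_vector) spp \<Rightarrow> ('a, 'b) apdb_input \<Rightarrow>
   ('a, 'b) apdb_state \<Rightarrow> real \<Rightarrow> 'a \<Rightarrow> 'b \<Rightarrow> real" where
  "test_E P inp s \<tau> x y =
     (let xk = x_cur s; yk = y_cur s; \<sigma> = sigma_of s \<tau>; \<theta> = theta_of s \<tau>;
          \<alpha> = c_alpha inp / sigma_prev s; \<beta> = c_beta inp / sigma_prev s;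
          \<alpha>' = c_alpha inp / \<sigma>; \<beta>' = c_beta inp / \<sigma>
      in Phi P x y - Phi P xk y - blinfun_apply (gradx P xk y) (x - xk) - 1 / \<tau> * DX P x xk
         + (norm (grady P x y - grady P xk y))\<^sup>2 / (2 * \<alpha>')
         + (norm (grady P xk y - grady P xk yk))\<^sup>2 / (2 * \<beta>')
         - (1 / \<sigma> - \<theta> * (\<alpha> + \<beta>)) * DY P y yk)"

definition accepts ::
  "('a::real_normed_vector, 'b::real_normed_vector) spp \<Rightarrow> ('a, 'b) apdb_input \<Rightarrow>
   ('a, 'b) apdb_state \<Rightarrow> real \<Rightarrow> bool" where
  "accepts P inp s \<tau> \<longleftrightarrow>
     test_E P inp s \<tau> (next_x P s \<tau>) (next_y P s \<tau>)
       \<le> - (delta inp / \<tau>) * DX P (next_x P s \<tau>) (x_cur s)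
         - delta inp / sigma_of s \<tau> * DY P (next_y P s \<tau>) (y_cur s)"

definition trial_step :: "('a, 'b) apdb_input \<Rightarrow> ('a, 'b) apdb_state \<Rightarrow> nat \<Rightarrow> real" where
  "trial_step inp s j = eta inp ^ j * tau_trial s"

text \<open>The number of times the inner loop shrinks the trial step. It is meaningful only if some
  trial step is accepted.\<close>

definition shrinks ::
  "('a::real_normed_vector, 'b::real_normed_vector) spp \<Rightarrow> ('a, 'b) apdb_input \<Rightarrow>
   ('a, 'b) apdb_state \<Rightarrow> nat" where
  "shrinks P inp s = (LEAST j. accepts P inp s (trial_step inp s j))"

definition accepted_tau ::
  "('a::real_normed_vector, 'b::real_normed_vector) spp \<Rightarrow> ('a, 'b) apdb_input \<Rightarrow>
   ('a, 'b) apdb_state \<Rightarrow> real" where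
  "accepted_tau P inp s = trial_step inp s (shrinks P inp s)"

definition apdb_step ::
  "('a::real_normed_vector, 'b::real_normed_vector) spp \<Rightarrow> ('a, 'b) apdb_input \<Rightarrow>
   ('a, 'b) apdb_state \<Rightarrow> ('a, 'b) apdb_state" where
  "apdb_step P inp s =
     (let \<tau> = accepted_tau P inp s; \<gamma> = gamma_cur s; \<gamma>' = \<gamma> * (1 + mu inp * \<tau>)
      in \<lparr> x_prev = x_cur s, y_prev = y_cur s,
           x_cur = next_x P s \<tau>, y_cur = next_y P s \<tau>,
           sigma_prev = sigma_of s \<tau>, gamma_cur = \<gamma>', tau_trial = \<tau> * sqrt (\<gamma> / \<gamma>') \<rparr>)"

definition apdb_start :: "('a, 'b) apdb_input \<Rightarrow> ('a, 'b) apdb_state" where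
  "apdb_start inp =
     \<lparr> x_prev = x_init inp, y_prev = y_init inp, x_cur = x_init inp, y_cur = y_init inp,
       sigma_prev = gamma0 inp * tau_bar inp, gamma_cur = gamma0 inp, tau_trial = tau_bar inp \<rparr>"

primrec apdb ::
  "('a::real_normed_vector, 'b::real_normed_vector) spp \<Rightarrow> ('a, 'b) apdb_input \<Rightarrow>
   nat \<Rightarrow> ('a, 'b) apdb_state" where
  "apdb P inp 0 = apdb_start inp"
| "apdb P inp (Suc k) = apdb_step P inp (apdb P inp k)"

context
  fixes P :: "('a::real_normed_vector, 'b::real_normed_vector) spp"
    and inp :: "('a, 'b) apdb_input"
begin

definition iter_x :: "nat \<Rightarrow> 'a" where "iter_x k = x_cur (apdb P inp k)"
definition iter_y :: "nat \<Rightarrow> 'b" where "iter_y k = y_cur (apdb P inp k)"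
definition step_gamma :: "nat \<Rightarrow> real" where "step_gamma k = gamma_cur (apdb P inp k)"
definition step_tau :: "nat \<Rightarrow> real" where "step_tau k = accepted_tau P inp (apdb P inp k)"
definition step_sigma :: "nat \<Rightarrow> real" where "step_sigma k = step_gamma k * step_tau k"

definition weight :: "nat \<Rightarrow> real" where
  "weight k = step_sigma k / step_sigma 0"

definition total_weight :: "nat \<Rightarrow> real" where
  "total_weight K = (\<Sum>k<K. weight k)"

definition avg_x :: "nat \<Rightarrow> 'a" where
  "avg_x K = (1 / total_weight K) *\<^sub>R (\<Sum>k<K. weight k *\<^sub>R iter_x (Suc k))"

definition avg_y :: "nat \<Rightarrow> 'b" where
  "avg_y K = (1 / total_weight K) *\<^sub>R (\<Sum>k<K. weight k *\<^sub>R iter_y (Suc k))"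

definition Delta :: "'a \<Rightarrow> 'b \<Rightarrow> real" where
  "Delta x y = 1 / step_tau 0 * DX P x (x_init inp) + 1 / step_sigma 0 * DY P y (y_init inp)"

text \<open>The subtraction never meets \<open>\<infinity> - \<infinity>\<close>: the averages lie in the domains of \<open>f\<close> and \<open>h\<close>, so
  the first term is not \<open>\<infinity>\<close> and the second is not \<open>-\<infinity>\<close>.\<close>

definition gap :: "nat \<Rightarrow> 'a \<Rightarrow> 'b \<Rightarrow> ereal" where
  "gap K x y = Lag P (avg_x K) y - Lag P x (avg_y K)"

end


section \<open>Parameter choices and step size thresholds\<close>

definition psi1_expr :: "('a, 'b) apdb_input \<Rightarrow> real \<Rightarrow> real \<Rightarrow> real" where
  "psi1_expr inp Lyx Lxx =
     (let \<zeta> = -1 + sqrt (1 + 4 * (1 - delta inp) * gamma0 inp / c_alpha inp * (Lyx\<^sup>2 / Lxx\<^sup>2))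
      in c_alpha inp * Lxx / (2 * gamma0 inp * Lyx\<^sup>2) * \<zeta>)"

definition Psi1 :: "('a, 'b) apdb_input \<Rightarrow> real \<Rightarrow> real \<Rightarrow> real" where
  "Psi1 inp Lyx Lxx =
     (if Lxx = 0 then Lim (at_right 0) (psi1_expr inp Lyx) else psi1_expr inp Lyx Lxx)"

definition Psi2 :: "('a, 'b) apdb_input \<Rightarrow> real \<Rightarrow> real" where
  "Psi2 inp Lyy =
     sqrt (c_beta inp * (1 - (c_alpha inp + c_beta inp + delta inp))) / (gamma0 inp * Lyy)"

definition params_I :: "('a, 'b) apdb_input \<Rightarrow> real \<Rightarrow> bool" where
  "params_I inp Lyy \<longleftrightarrow> mu inp = 0 \<and>
     (if Lyy > 0
      then c_alpha inp > 0 \<and> c_beta inp > 0 \<and> c_alpha inp + c_beta inp + delta inp \<in> {0<..<1}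
      else c_beta inp = 0 \<and> c_alpha inp + delta inp \<in> {0<..1})"

definition params_II :: "('a, 'b) apdb_input \<Rightarrow> real \<Rightarrow> bool" where
  "params_II inp Lyy \<longleftrightarrow> mu inp > 0 \<and> Lyy = 0 \<and>
     c_alpha inp + delta inp \<in> {0<..1} \<and> c_beta inp = 0"

end

theory Submission
  imports Defs
begin

text \<open>Write \<open>z\<^sub>k = (x\<^sub>k, y\<^sub>k)\<close>, \<open>q\<^sub>k = \<nabla>\<^sub>y\<Phi>(z\<^sub>k) - \<nabla>\<^sub>y\<Phi>(z\<^sub>k\<^sub>-\<^sub>1)\<close>, and let the gap of \<open>z'\<close> at \<open>z = (x, y)\<close> be
  \<open>L(x', y) - L(x, y')\<close>. Everything rests on one potential,
  \<open>V\<^sub>k(z) = \<gamma>\<^sub>k D\<^sub>X(x, x\<^sub>k) + D\<^sub>Y(y, y\<^sub>k) - \<sigma>\<^sub>k\<^sub>-\<^sub>1 \<langle>q\<^sub>k, y - y\<^sub>k\<rangle> + \<sigma>\<^sub>k\<^sub>-\<^sub>1\<^sup>2 c\<^sub>k\<close>,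
  where \<open>c\<^sub>k\<close> is the weighted sum of the squares of the two parts of \<open>q\<^sub>k\<close> (the change of \<open>x\<close>, the change
  of \<open>y\<close>). Adding the optimality conditions of the two proximal steps to the gradient inequalities of
  \<open>\<Phi>\<close>, and splitting the momentum term by Young's inequality, leaves precisely the test
  function \<open>E\<^sub>k\<close> as error. An accepted step therefore satisfies (\<open>one_iteration\<close>)
  \<open>\<sigma>\<^sub>k gap(z\<^sub>k\<^sub>+\<^sub>1; z) \<le> V\<^sub>k(z) - V\<^sub>k\<^sub>+\<^sub>1(z) - \<delta> (\<gamma>\<^sub>k D\<^sub>X(x\<^sub>k\<^sub>+\<^sub>1, x\<^sub>k) + D\<^sub>Y(y\<^sub>k\<^sub>+\<^sub>1, y\<^sub>k))\<close>;
  the update of \<open>\<gamma>\<close> is the one for which the strong convexity of \<open>f\<close> turns \<open>\<gamma>\<^sub>k\<close> into \<open>\<gamma>\<^sub>k\<^sub>+\<^sub>1\<close>. Again by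
  Young, \<open>V\<^sub>k(z) \<ge> \<gamma>\<^sub>k D\<^sub>X(x, x\<^sub>k) + (1 - c\<^sub>\<alpha> - c\<^sub>\<beta>) D\<^sub>Y(y, y\<^sub>k) \<ge> 0\<close>. Summation and Jensen's inequality give
  the ergodic bound (\<open>gap_bound\<close>).

  The step sizes are governed by \<open>\<tau>\<^sup>2 \<gamma>\<close>, which the update of the trial step preserves. The test
  succeeds as soon as \<open>\<tau>\<^sup>2 \<gamma> \<le> \<Psi>\<^sup>2 \<gamma>\<^sub>0\<close>, because \<open>\<Psi>\<^sub>1\<close> is the root of the quadratic that the descent
  lemma produces, and \<open>\<Psi>\<^sub>2\<close> plays this part for the dual step (\<open>below_threshold_accepted\<close>). This bounds the number of shrinkings, and it makes
  \<open>\<tau>\<^sub>k\<close> and \<open>1 / \<surd>\<gamma>\<^sub>k\<close>, and so \<open>\<sigma>\<^sub>k\<close> and \<open>\<surd>\<gamma>\<^sub>k\<close>, comparable. Hence \<open>T\<^sub>K\<close> grows linearly if \<open>\<mu> = 0\<close>; if \<open>\<mu> > 0\<close>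
  then \<open>\<surd>\<gamma>\<^sub>k\<close> grows at least linearly and \<open>T\<^sub>K\<close> at least quadratically.

  At a saddle point the gap is nonnegative, so \<open>V\<^sub>k\<close> decreases there. This gives the distance bounds, and
  for \<open>\<delta> > 0\<close> it makes \<open>\<surd>\<gamma>\<^sub>k (x\<^sub>k\<^sub>+\<^sub>1 - x\<^sub>k)\<close> and \<open>y\<^sub>k\<^sub>+\<^sub>1 - y\<^sub>k\<close> vanish. Along a convergent subsequence
  \<open>(V\<^sub>k(z) - V\<^sub>k\<^sub>+\<^sub>1(z)) / \<sigma>\<^sub>k\<close> then has a nonpositive limit superior for all \<open>z\<close> in the domains, and since the gap is lower
  semicontinuous the limit is a saddle point (\<open>limit_point_is_saddle\<close>). For \<open>\<mu> = 0\<close> the potential at this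
  limit tends to zero along the subsequence, hence along the whole sequence, which forces convergence.
  For \<open>\<mu> > 0\<close> the distance bound with \<open>\<gamma>\<^sub>K\<close> tending to infinity already yields the convergence of \<open>x\<^sub>K\<close>.\<close>

section \<open>Compactness in finite-dimensional normed spaces\<close>

text \<open>Induction on the spanning set. If the new vector \<open>b\<close> has distance \<open>d > 0\<close> from the old span, then a
  vector \<open>c b + w\<close> has norm at least \<open>\<bar>c\<bar> d\<close>; a bounded sequence thus has bounded coefficients of \<open>b\<close> and
  bounded components in the old span.\<close>

lemma finite_dimensional_bounded_seq:
  fixes u :: "nat \<Rightarrow> 'a::real_normed_vector"
  assumes B: "finite B" and u: "\<And>n. u n \<in> span B" and bd: "\<And>n. norm (u n) \<le> M"
  shows "\<exists>l\<in>span B. \<exists>r::nat \<Rightarrow> nat. strict_mono r \<and> (u \<circ> r) \<longlonglongrightarrow> l"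
  using assms
proof (induction B arbitrary: u M rule: finite_induct)
  case empty
  then have "u = (\<lambda>_. 0)" by auto
  then show ?case by (intro bexI[of _ 0] exI[of _ id]) (auto simp: strict_mono_def)
next
  case (insert b B)
  show ?case
  proof (cases "b \<in> span B")
    case True
    then have "span (insert b B) = span B" by (rule span_redundant)
    then show ?thesis using insert.IH[of u M] insert.prems by simp
  next
    case False
    \<comment> \<open>The induction hypothesis makes the old span closed, so its distance from \<open>b\<close> is positive.\<close>
    have clB: "closed (span B)"
      unfolding closed_sequential_limits
    proof (intro allI impI)
      fix v l assume v: "(\<forall>n. v n \<in> span B) \<and> v \<longlonglongrightarrow> l"
      then have "Bseq v" by (auto intro: convergent_imp_Bseq convergentI)
      then obtain K where K: "\<And>n. norm (v n) \<le> K" unfolding Bseq_def by blast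
      have "\<exists>l'\<in>span B. \<exists>r::nat \<Rightarrow> nat. strict_mono r \<and> (v \<circ> r) \<longlonglongrightarrow> l'"
        using v K by (intro insert.IH) auto
      then obtain l' r where
        l': "l' \<in> span B" "strict_mono r" "(v \<circ> r) \<longlonglongrightarrow> l'" by blast
      then have "l' = l" using v LIMSEQ_subseq_LIMSEQ LIMSEQ_unique by metis
      then show "l \<in> span B" using l'(1) by simp
    qed
    define d where "d = infdist b (span B)"
    have ne: "span B \<noteq> {}" using span_zero by blast
    have d: "d > 0"
      using infdist_pos_not_in_closed[OF clB ne False] unfolding d_def .
    have "\<forall>n. \<exists>k. u n - k *\<^sub>R b \<in> span B"
      using insert.prems(1) by (auto simp: span_insert)
    then obtain c where c: "\<And>n. u n - c n *\<^sub>R b \<in> span B" by metis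
    have cbd: "\<bar>c n\<bar> * d \<le> M" for n
    proof (cases "c n = 0")
      case True
      then show ?thesis using order_trans[OF norm_ge_zero insert.prems(2)[of n]] by simp
    next
      case False
      let ?w = "(- 1 / c n) *\<^sub>R (u n - c n *\<^sub>R b)"
      have "?w \<in> span B" using c by (intro span_scale)
      then have "d \<le> dist b ?w" unfolding d_def by (rule infdist_le)
      also have "dist b ?w = norm ((1 / c n) *\<^sub>R u n)"
        using False by (simp add: dist_norm scaleR_diff_right)
      finally have "d \<le> norm (u n) / \<bar>c n\<bar>" by (simp add: field_simps)
      then have "\<bar>c n\<bar> * d \<le> norm (u n)" using False by (simp add: field_simps)
      then show ?thesis using insert.prems(2)[of n] by linarith
    qed
    then have cbd': "\<bar>c n\<bar> \<le> M / d" for n using d by (simp add: field_simps)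
    then have "bounded (range c)" by (auto simp: bounded_iff)
    then obtain c0 r where r: "strict_mono r" "(c \<circ> r) \<longlonglongrightarrow> c0"
      using bounded_imp_convergent_subsequence by blast
    let ?v = "\<lambda>n. u (r n) - c (r n) *\<^sub>R b"
    have "norm (?v n) \<le> M + M / d * norm b" for n
      using norm_triangle_ineq4[of "u (r n)" "c (r n) *\<^sub>R b"] insert.prems(2)[of "r n"]
        mult_right_mono[OF cbd'[of "r n"] norm_ge_zero[of b]] by simp
    then have "\<exists>l\<in>span B. \<exists>r'::nat \<Rightarrow> nat. strict_mono r' \<and> (?v \<circ> r') \<longlonglongrightarrow> l"
      using c by (intro insert.IH) auto
    then obtain l r' where
      l: "l \<in> span B" "strict_mono r'" "(?v \<circ> r') \<longlonglongrightarrow> l" by blast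
    have "(\<lambda>n. (?v \<circ> r') n + ((c \<circ> r) \<circ> r') n *\<^sub>R b) \<longlonglongrightarrow> l + c0 *\<^sub>R b"
      by (intro tendsto_intros l(3) LIMSEQ_subseq_LIMSEQ[OF r(2) l(2)])
    then have "(u \<circ> (r \<circ> r')) \<longlonglongrightarrow> l + c0 *\<^sub>R b" by (simp add: o_def)
    moreover have "l + c0 *\<^sub>R b \<in> span (insert b B)"
      using l(1) by (auto simp: span_insert intro: exI[of _ c0])
    moreover have "strict_mono (r \<circ> r')" using r l by (simp add: strict_mono_o)
    ultimately show ?thesis by blast
  qed
qed

lemma finite_dimensional_convergent_subseq:
  fixes u :: "nat \<Rightarrow> 'a::real_normed_vector"
  assumes "finite_dimensional (UNIV :: 'a set)" and "\<And>n. norm (u n) \<le> M"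
  obtains l and r :: "nat \<Rightarrow> nat" where "strict_mono r" "(u \<circ> r) \<longlonglongrightarrow> l"
proof -
  obtain B :: "'a set" where "finite B" "span B = UNIV"
    using assms(1) unfolding finite_dimensional_def by auto
  then show thesis using finite_dimensional_bounded_seq[of B u M] assms(2) that by auto
qed

section \<open>Closed convex functions\<close>

text \<open>Lower semicontinuity, stated for real upper bounds so that it also shows that the limit lies in the
  domain.\<close>

lemma closed_convex_fun_lsc:
  assumes "closed_convex_fun F" and "u \<longlonglongrightarrow> x" and "c \<longlonglongrightarrow> c0" and "\<And>n. F (u n) \<le> ereal (c n)"
  shows "F x \<le> ereal c0"
proof -
  have "closed (epigraph F)" using assms(1) by (simp add: closed_convex_fun_def)
  moreover have "(\<lambda>n. (u n, c n)) \<longlonglongrightarrow> (x, c0)" using assms by (intro tendsto_intros)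
  moreover have "(u n, c n) \<in> epigraph F" for n using assms(4) by (simp add: epigraph_def)
  ultimately have "(x, c0) \<in> epigraph F"
    using closed_sequentially[where f = "\<lambda>n. (u n, c n)"] by blast
  then show ?thesis by (simp add: epigraph_def)
qed

text \<open>On its domain a closed convex function takes real values, and there it is handled as the
  real function \<open>real_of_ereal \<circ> F\<close>.\<close>

lemma edom_real:
  assumes "closed_convex_fun F" "x \<in> edom F"
  shows "F x = ereal (real_of_ereal (F x))"
  using assms by (cases "F x") (auto simp: closed_convex_fun_def edom_def)

lemma edomI: "F x \<le> ereal c \<Longrightarrow> x \<in> edom F"
  by (auto simp: edom_def)

lemma closed_convex_fun_convex_on:
  assumes F: "closed_convex_fun F"
  shows "convex_on (edom F) (\<lambda>x. real_of_ereal (F x))"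
proof -
  have cv: "convex (epigraph F)" using F by (simp add: closed_convex_fun_def)
  have key: "F ((1 - t) *\<^sub>R x + t *\<^sub>R y)
      \<le> ereal ((1 - t) * real_of_ereal (F x) + t * real_of_ereal (F y))"
    if "x \<in> edom F" "y \<in> edom F" "0 \<le> t" "t \<le> 1" for x y t
  proof -
    have "(x, real_of_ereal (F x)) \<in> epigraph F" "(y, real_of_ereal (F y)) \<in> epigraph F"
      using edom_real[OF F that(1)] edom_real[OF F that(2)] unfolding epigraph_def by auto
    from convexD_alt[OF cv this that(3,4)] show ?thesis
      by (simp add: epigraph_def)
  qed
  have cvd: "convex (edom F)"
    unfolding convex_alt by (intro ballI allI impI, rule edomI[where F=F], rule key) auto
  show ?thesis
  proof (rule convex_onI[OF _ cvd])
    fix t x y assume *: "0 < (t::real)" "t < 1" "x \<in> edom F" "y \<in> edom F"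
    then have d: "(1 - t) *\<^sub>R x + t *\<^sub>R y \<in> edom F" using key[of x y t] by (intro edomI[where F=F]) auto
    have "ereal (real_of_ereal (F ((1 - t) *\<^sub>R x + t *\<^sub>R y)))
        \<le> ereal ((1 - t) * real_of_ereal (F x) + t * real_of_ereal (F y))"
      using key[of x y t] * edom_real[OF F d] by simp
    then show "real_of_ereal (F ((1 - t) *\<^sub>R x + t *\<^sub>R y))
        \<le> (1 - t) * real_of_ereal (F x) + t * real_of_ereal (F y)" by simp
  qed
qed

text \<open>By compactness: values tending to \<open>-\<infinity>\<close> along a convergent sequence would give the value \<open>-\<infinity>\<close> at
  the limit.\<close>

lemma closed_convex_fun_bounded_below:
  fixes F :: "'a::real_normed_vector \<Rightarrow> ereal"
  assumes fd: "finite_dimensional (UNIV :: 'a set)" and F: "closed_convex_fun F"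
  shows "\<exists>m. \<forall>x. norm x \<le> M \<longrightarrow> ereal m \<le> F x"
proof (rule ccontr)
  assume "\<not> ?thesis"
  then have "\<forall>n::nat. \<exists>x. norm x \<le> M \<and> F x < ereal (- real n)" by (metis not_le)
  then obtain u where u: "\<And>n. norm (u n) \<le> M" "\<And>n. F (u n) < ereal (- real n)" by metis
  obtain l r where r: "strict_mono r" "(u \<circ> r) \<longlonglongrightarrow> l"
    using finite_dimensional_convergent_subseq[OF fd u(1)] .
  have "F l \<le> ereal (- real j)" for j :: nat
  proof (rule closed_convex_fun_lsc[OF F])
    show "(\<lambda>n. u (r (n + j))) \<longlonglongrightarrow> l" using LIMSEQ_ignore_initial_segment[OF r(2)] by (simp add: o_def)
    show "F (u (r (n + j))) \<le> ereal (- real j)" for n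
    proof -
      have "j \<le> r (n + j)" using seq_suble[OF r(1), of "n + j"] by linarith
      then have "ereal (- real (r (n + j))) \<le> ereal (- real j)" by simp
      then show ?thesis using u(2)[of "r (n + j)"] by (meson less_imp_le order_trans)
    qed
  qed auto
  note low = this
  have "l \<in> edom F" by (rule edomI[where F=F, OF low[of 0]])
  then obtain a where a: "F l = ereal a" using edom_real[OF F] by blast
  obtain j :: nat where "real j > - a" using reals_Archimedean2 by blast
  then show False using low[of j] a by simp
qed

text \<open>Along a ray from \<open>x0\<close> a convex function that is bounded below near \<open>x0\<close> can decrease at most
  linearly. Such a cone-shaped minorant gives coercivity just as an affine one does.\<close>

lemma closed_convex_fun_linear_minorant:
  fixes F :: "'a::real_normed_vector \<Rightarrow> ereal"
  assumes fd: "finite_dimensional (UNIV :: 'a set)" and F: "closed_convex_fun F"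
    and x0: "x0 \<in> edom F"
  shows "\<exists>A\<ge>0. \<forall>x\<in>edom F. real_of_ereal (F x) \<ge> - A * (1 + norm (x - x0))"
proof -
  let ?f = "\<lambda>x. real_of_ereal (F x)"
  obtain m where m: "\<And>x. norm x \<le> norm x0 + 1 \<Longrightarrow> ereal m \<le> F x"
    using closed_convex_fun_bounded_below[OF fd F, of "norm x0 + 1"] by blast
  define A where "A = \<bar>m\<bar> + \<bar>?f x0\<bar>"
  have A0: "A \<ge> 0" unfolding A_def by (intro add_nonneg_nonneg abs_ge_zero)
  have "?f x \<ge> - A * (1 + norm (x - x0))" if x: "x \<in> edom F" for x
  proof (cases "norm (x - x0) \<le> 1")
    case True
    then have "ereal m \<le> F x" using norm_triangle_sub[of x x0] by (intro m) linarith
    then have "m \<le> ?f x" using edom_real[OF F x] by (metis ereal_less_eq(3))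
    moreover have "A * (1 + norm (x - x0)) \<ge> A * 1"
      using A0 by (intro mult_left_mono) auto
    moreover have "- A \<le> m" unfolding A_def using abs_ge_zero[of "?f x0"] abs_ge_minus_self[of m] by linarith
    ultimately show ?thesis by linarith
  next
    case False
    define R where "R = norm (x - x0)"
    have R: "R > 1" using False R_def by simp
    let ?z = "(1 - 1 / R) *\<^sub>R x0 + (1 / R) *\<^sub>R x"
    have zx: "?z - x0 = (1 / R) *\<^sub>R (x - x0)" by (simp add: algebra_simps)
    have "x \<noteq> x0" using False by auto
    with zx have "norm (?z - x0) = 1" unfolding R_def by simp
    then have nz: "norm ?z \<le> norm x0 + 1" using norm_triangle_sub[of ?z x0] by simp
    have cv: "convex_on (edom F) ?f" by (rule closed_convex_fun_convex_on[OF F])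
    have fz: "?f ?z \<le> (1 - 1 / R) * ?f x0 + 1 / R * ?f x"
      using convex_onD[OF cv, of "1 / R" x0 x] R x0 x by simp
    have "?z \<in> edom F" using convex_on_imp_convex[OF cv] x0 x R
      by (simp add: convex_alt)
    then have "m \<le> ?f ?z" using m[OF nz] edom_real[OF F] by (metis ereal_less_eq(3))
    with fz have "m \<le> (1 - 1 / R) * ?f x0 + 1 / R * ?f x" by linarith
    then have "R * m \<le> R * ((1 - 1 / R) * ?f x0 + 1 / R * ?f x)" using R by (simp add: mult_left_mono)
    also have "\<dots> = (R - 1) * ?f x0 + ?f x" using R by (simp add: field_simps)
    finally have 1: "?f x \<ge> R * m - (R - 1) * ?f x0" by linarith
    have "R * - m \<le> R * \<bar>m\<bar>" using R by (intro mult_left_mono) auto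
    moreover have "(R - 1) * ?f x0 \<le> (R - 1) * \<bar>?f x0\<bar>" using R by (intro mult_left_mono abs_ge_self) simp
    moreover have "(R - 1) * \<bar>?f x0\<bar> \<le> R * \<bar>?f x0\<bar>" by (intro mult_right_mono abs_ge_zero) simp
    ultimately have "?f x \<ge> - (A * R)" using 1 unfolding A_def by (simp add: algebra_simps)
    with A0 show ?thesis unfolding R_def by (simp add: algebra_simps)
  qed
  with A0 show ?thesis by blast
qed

section \<open>Gradients of convex functions and Bregman distances\<close>

lemma grad_has_derivative:
  assumes "F differentiable (at x)"
  shows "(F has_derivative blinfun_apply (grad F x)) (at x)"
proof -
  have 1: "(F has_derivative frechet_derivative F (at x)) (at x)"
    using assms by (simp add: frechet_derivative_works)
  then have "bounded_linear (frechet_derivative F (at x))" by (rule has_derivative_bounded_linear)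
  then show ?thesis using 1 by (simp add: grad_def bounded_linear_Blinfun_apply)
qed

lemma grad_unique:
  assumes "(F has_derivative blinfun_apply G) (at x)"
  shows "grad F x = G"
proof -
  have "frechet_derivative F (at x) = blinfun_apply G"
    using frechet_derivative_at[OF assms] by simp
  then show ?thesis by (simp add: grad_def blinfun_apply_inverse)
qed

lemma grad_DERIV_line:
  fixes F :: "'a::real_normed_vector \<Rightarrow> real"
  assumes "F differentiable (at (x + t *\<^sub>R v))"
  shows "((\<lambda>s. F (x + s *\<^sub>R v)) has_real_derivative blinfun_apply (grad F (x + t *\<^sub>R v)) v) (at t)"
proof -
  have "((\<lambda>s. x + s *\<^sub>R v) has_derivative (\<lambda>s. s *\<^sub>R v)) (at t)"
    by (auto intro!: derivative_eq_intros)
  from has_derivative_compose[OF this grad_has_derivative[OF assms]]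
  have "((\<lambda>s. F (x + s *\<^sub>R v)) has_derivative
      (\<lambda>s. blinfun_apply (grad F (x + t *\<^sub>R v)) (s *\<^sub>R v))) (at t)" .
  then show ?thesis
    unfolding has_field_derivative_def by (simp add: blinfun.scaleR_right mult.commute[of _ "blinfun_apply _ _"])
qed

lemma grad_directional:
  fixes F :: "'a::real_normed_vector \<Rightarrow> real"
  assumes "F differentiable (at x)"
  shows "((\<lambda>t. (F (x + t *\<^sub>R v) - F x) / t) \<longlongrightarrow> blinfun_apply (grad F x) v) (at_right 0)"
proof -
  have "((\<lambda>s. F (x + s *\<^sub>R v)) has_real_derivative blinfun_apply (grad F x) v) (at 0)"
    using grad_DERIV_line[of F x 0 v] assms by simp
  then have "((\<lambda>t. (F (x + t *\<^sub>R v) - F x) / t) \<longlongrightarrow> blinfun_apply (grad F x) v) (at 0)"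
    by (simp add: DERIV_def)
  then show ?thesis by (simp add: filterlim_at_split)
qed

text \<open>Divide the convexity inequality on the segment from \<open>xb\<close> to \<open>x\<close> by \<open>t\<close> and let \<open>t \<down> 0\<close>.\<close>

lemma gradient_inequality:
  fixes F :: "'a::real_normed_vector \<Rightarrow> real"
  assumes diff: "F differentiable (at xb)"
    and cv: "\<And>t. 0 < t \<Longrightarrow> t < 1 \<Longrightarrow> F ((1 - t) *\<^sub>R xb + t *\<^sub>R x)
               \<le> (1 - t) * F xb + t * F x - m / 2 * t * (1 - t) * (norm (xb - x))\<^sup>2"
  shows "F xb + blinfun_apply (grad F xb) (x - xb) + m / 2 * (norm (x - xb))\<^sup>2 \<le> F x"
proof -
  let ?N = "(norm (x - xb))\<^sup>2"
  have "((\<lambda>t. F x - F xb - m / 2 * (1 - t) * ?N) \<longlongrightarrow> F x - F xb - m / 2 * (1 - 0) * ?N) (at_right 0)"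
    by (intro tendsto_intros)
  moreover have "\<forall>\<^sub>F t in at_right 0. (F (xb + t *\<^sub>R (x - xb)) - F xb) / t
      \<le> F x - F xb - m / 2 * (1 - t) * ?N"
    unfolding eventually_at_right_field
  proof (intro exI[of _ 1] conjI allI impI)
    fix t :: real assume t: "0 < t" "t < 1"
    have "xb + t *\<^sub>R (x - xb) = (1 - t) *\<^sub>R xb + t *\<^sub>R x" by (simp add: algebra_simps)
    then have "F (xb + t *\<^sub>R (x - xb)) - F xb \<le> t * (F x - F xb - m / 2 * (1 - t) * ?N)"
      using cv[OF t] by (simp add: algebra_simps norm_minus_commute)
    then show "(F (xb + t *\<^sub>R (x - xb)) - F xb) / t \<le> F x - F xb - m / 2 * (1 - t) * ?N"
      using t by (simp add: pos_divide_le_eq mult.commute)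
  qed simp
  ultimately have "blinfun_apply (grad F xb) (x - xb) \<le> F x - F xb - m / 2 * (1 - 0) * ?N"
    using tendsto_le[OF trivial_limit_at_right_real _ grad_directional[OF diff]] by blast
  then show ?thesis by simp
qed

lemma convex_gradient_inequality:
  fixes F :: "'a::real_normed_vector \<Rightarrow> real"
  assumes "convex_on UNIV F" "F differentiable (at xb)"
  shows "F xb + blinfun_apply (grad F xb) (x - xb) \<le> F x"
  using gradient_inequality[of F xb x 0] convex_onD[OF assms(1), of _ xb x] assms(2) by simp

lemma concave_gradient_inequality:
  fixes F :: "'a::real_normed_vector \<Rightarrow> real"
  assumes "concave_on UNIV F" "F differentiable (at xb)"
  shows "F x \<le> F xb + blinfun_apply (grad F xb) (x - xb)"
proof -
  have "convex_on UNIV (\<lambda>x. - F x)" using assms(1) by (simp add: concave_on_def)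
  moreover have d: "((\<lambda>x. - F x) has_derivative blinfun_apply (- grad F xb)) (at xb)"
    using has_derivative_minus[OF grad_has_derivative[OF assms(2)]]
    by (simp only: uminus_blinfun.rep_eq)
  moreover from d have "(\<lambda>x. - F x) differentiable (at xb)" by (auto simp: differentiable_def)
  ultimately have "- F xb + blinfun_apply (grad (\<lambda>x. - F x) xb) (x - xb) \<le> - F x"
    by (intro convex_gradient_inequality) auto
  then show ?thesis using grad_unique[OF d] by (simp add: blinfun.minus_left)
qed

lemma distance_generating_openE:
  assumes "distance_generating \<phi> C S"
  obtains U where "open U" "S \<subseteq> U" "U \<subseteq> C" "\<And>x. x \<in> U \<Longrightarrow> \<phi> differentiable (at x)"
  using assms unfolding distance_generating_def by blast

lemma bregman_lower_bound_on_domain: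
  fixes \<phi> :: "'a::real_normed_vector \<Rightarrow> real"
  assumes sc: "strongly_convex_on 1 C \<phi>" and "xb \<in> C" "x \<in> C" and d: "\<phi> differentiable (at xb)"
  shows "1 / 2 * (norm (x - xb))\<^sup>2 \<le> bregman \<phi> x xb"
proof -
  have "\<phi> xb + blinfun_apply (grad \<phi> xb) (x - xb) + 1 / 2 * (norm (x - xb))\<^sup>2 \<le> \<phi> x"
    using sc assms(2,3) unfolding strongly_convex_on_def by (intro gradient_inequality[OF d]) auto
  then show ?thesis by (simp add: bregman_def)
qed

lemma bregman_lower_bound:
  fixes \<phi> :: "'a::real_normed_vector \<Rightarrow> real"
  assumes dg: "distance_generating \<phi> C S" and "x \<in> S" "xb \<in> S"
  shows "1 / 2 * (norm (x - xb))\<^sup>2 \<le> bregman \<phi> x xb"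
proof -
  obtain U where "open U" "S \<subseteq> U" "U \<subseteq> C" "\<And>x. x \<in> U \<Longrightarrow> \<phi> differentiable (at x)"
    using distance_generating_openE[OF dg] by metis
  then show ?thesis using assms
    by (intro bregman_lower_bound_on_domain[where C = C]) (auto simp: distance_generating_def)
qed

lemma bregman_nonneg:
  fixes \<phi> :: "'a::real_normed_vector \<Rightarrow> real"
  assumes "distance_generating \<phi> C S" and "x \<in> S" "xb \<in> S"
  shows "0 \<le> bregman \<phi> x xb"
  using order_trans[OF _ bregman_lower_bound[OF assms], of 0] by simp

lemma distance_generating_isCont:
  assumes "distance_generating \<phi> C S" "x \<in> S"
  shows "isCont \<phi> x"
  using assms unfolding distance_generating_def by (metis differentiable_imp_continuous_within subsetD)

lemma distance_generating_differentiable: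
  assumes "distance_generating \<phi> C S" "x \<in> S"
  shows "\<phi> differentiable (at x)"
  using assms unfolding distance_generating_def by blast

lemma bregman_three_point:
  "bregman \<phi> x xb - bregman \<phi> x p - bregman \<phi> p xb
     = blinfun_apply (grad \<phi> p) (x - p) - blinfun_apply (grad \<phi> xb) (x - p)"
  by (simp add: bregman_def blinfun.diff_right)

lemma bregman_self [simp]: "bregman \<phi> x x = 0"
  by (simp add: bregman_def)

text \<open>Difference quotients of a convex function bound the directional derivative from above, and for a fixed
  \<open>t\<close> they are continuous in the base point and the direction. Applied to a direction and its negative, this
  makes the pairing of gradient and direction continuous.\<close>

lemma grad_upper_semicontinuous:
  fixes \<phi> :: "'a::real_normed_vector \<Rightarrow> real"
  assumes dg: "distance_generating \<phi> C S" and u: "u \<longlonglongrightarrow> x" "\<And>n. u n \<in> S" and x: "x \<in> S"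
    and v: "v \<longlonglongrightarrow> w" and a: "blinfun_apply (grad \<phi> x) w < a"
  shows "\<forall>\<^sub>F n in sequentially. blinfun_apply (grad \<phi> (u n)) (v n) < a"
proof -
  obtain U where U: "open U" "S \<subseteq> U" "U \<subseteq> C" "\<And>x. x \<in> U \<Longrightarrow> \<phi> differentiable (at x)"
    using distance_generating_openE[OF dg] by metis
  have sc: "strongly_convex_on 1 C \<phi>" using dg by (simp add: distance_generating_def)
  have xU: "x \<in> U" using x U by auto
  have cont: "isCont \<phi> z" if "z \<in> U" for z
    using U(4)[OF that] by (rule differentiable_imp_continuous_within)
  have "\<forall>\<^sub>F t in at_right 0. (\<phi> (x + t *\<^sub>R w) - \<phi> x) / t < a"
    using order_tendstoD(2)[OF grad_directional[OF U(4)[OF xU]] a] .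
  moreover have "\<forall>\<^sub>F t in at_right 0. x + t *\<^sub>R w \<in> U"
  proof -
    have "((\<lambda>t. x + t *\<^sub>R w) \<longlongrightarrow> x + 0 *\<^sub>R w) (at_right 0)" by (intro tendsto_intros)
    then show ?thesis using topological_tendstoD[OF _ U(1)] xU by simp
  qed
  moreover have "\<forall>\<^sub>F t in at_right 0. (0::real) < t" by (simp add: eventually_at_right_less)
  ultimately have "\<forall>\<^sub>F t in at_right 0. (\<phi> (x + t *\<^sub>R w) - \<phi> x) / t < a \<and> x + t *\<^sub>R w \<in> U \<and> 0 < t"
    by (intro eventually_conj)
  then obtain t where t: "(\<phi> (x + t *\<^sub>R w) - \<phi> x) / t < a" "x + t *\<^sub>R w \<in> U" "0 < t"
    using eventually_happens'[OF trivial_limit_at_right_real] by blast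
  have lim: "(\<lambda>n. u n + t *\<^sub>R v n) \<longlonglongrightarrow> x + t *\<^sub>R w" by (intro tendsto_intros u v)
  have "(\<lambda>n. (\<phi> (u n + t *\<^sub>R v n) - \<phi> (u n)) / t) \<longlonglongrightarrow> (\<phi> (x + t *\<^sub>R w) - \<phi> x) / t"
    using t by (intro tendsto_intros isCont_tendsto_compose[OF cont] lim u xU) auto
  then have "\<forall>\<^sub>F n in sequentially. (\<phi> (u n + t *\<^sub>R v n) - \<phi> (u n)) / t < a"
    using order_tendstoD(2) t(1) by blast
  moreover have "\<forall>\<^sub>F n in sequentially. u n + t *\<^sub>R v n \<in> U"
    using topological_tendstoD[OF lim U(1) t(2)] .
  ultimately show ?thesis
  proof eventually_elim
    case (elim n)
    have "u n \<in> U" using u U by auto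
    then have "1 / 2 * (norm (u n + t *\<^sub>R v n - u n))\<^sup>2 \<le> bregman \<phi> (u n + t *\<^sub>R v n) (u n)"
      using elim U by (intro bregman_lower_bound_on_domain[OF sc]) auto
    then have "0 \<le> bregman \<phi> (u n + t *\<^sub>R v n) (u n)" by (rule order_trans[rotated]) simp
    then have "t * blinfun_apply (grad \<phi> (u n)) (v n) \<le> \<phi> (u n + t *\<^sub>R v n) - \<phi> (u n)"
      by (simp add: bregman_def blinfun.scaleR_right)
    then have "blinfun_apply (grad \<phi> (u n)) (v n) \<le> (\<phi> (u n + t *\<^sub>R v n) - \<phi> (u n)) / t"
      using t by (simp add: pos_le_divide_eq mult.commute)
    then show ?case using elim(1) by linarith
  qed
qed

lemma grad_continuous:
  fixes \<phi> :: "'a::real_normed_vector \<Rightarrow> real"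
  assumes dg: "distance_generating \<phi> C S" and u: "u \<longlonglongrightarrow> x" "\<And>n. u n \<in> S" and x: "x \<in> S"
    and v: "v \<longlonglongrightarrow> w"
  shows "(\<lambda>n. blinfun_apply (grad \<phi> (u n)) (v n)) \<longlonglongrightarrow> blinfun_apply (grad \<phi> x) w"
proof (rule order_tendstoI)
  fix a assume "blinfun_apply (grad \<phi> x) w < a"
  then show "\<forall>\<^sub>F n in sequentially. blinfun_apply (grad \<phi> (u n)) (v n) < a"
    by (rule grad_upper_semicontinuous[OF dg u x v])
next
  fix a assume "a < blinfun_apply (grad \<phi> x) w"
  then have "blinfun_apply (grad \<phi> x) (- w) < - a" by (simp add: blinfun.minus_right)
  from grad_upper_semicontinuous[OF dg u x tendsto_minus[OF v] this]
  show "\<forall>\<^sub>F n in sequentially. a < blinfun_apply (grad \<phi> (u n)) (v n)"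
    by (simp add: blinfun.minus_right)
qed

lemma bregman_tendsto_second:
  fixes \<phi> :: "'a::real_normed_vector \<Rightarrow> real"
  assumes dg: "distance_generating \<phi> C S" and u: "u \<longlonglongrightarrow> x" "\<And>n. u n \<in> S" and x: "x \<in> S"
  shows "(\<lambda>n. bregman \<phi> z (u n)) \<longlonglongrightarrow> bregman \<phi> z x"
  unfolding bregman_def
  by (intro tendsto_intros isCont_tendsto_compose[OF distance_generating_isCont[OF dg x]]
      grad_continuous[OF dg u x] u)

section \<open>The proximal step\<close>

lemma divide_le_divide_cross:
  fixes a b s t :: real
  assumes "a * t \<le> b * s" "0 < t" "0 < s"
  shows "a / s \<le> b / t"
  using assms by (simp add: field_simps)

text \<open>Both subproblems of the algorithm have this form: \<open>c\<close> is the reciprocal of the step size, and \<open>g\<close>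
  is \<open>- s\<^sub>k\<close> in the dual step and \<open>\<nabla>\<^sub>x\<Phi>(x\<^sub>k, y\<^sub>k\<^sub>+\<^sub>1)\<close> in the primal step.\<close>

locale prox_problem =
  fixes F :: "'a::real_normed_vector \<Rightarrow> ereal" and \<phi> :: "'a \<Rightarrow> real" and C :: "'a set"
    and g :: "'a \<Rightarrow>\<^sub>L real" and c :: real and xb :: 'a
  assumes fd: "finite_dimensional (UNIV :: 'a set)" and F: "closed_convex_fun F"
    and dg: "distance_generating \<phi> C (edom F)" and xb: "xb \<in> edom F" and c: "c > 0"
begin

definition obj :: "'a \<Rightarrow> ereal" where
  "obj x = F x + ereal (blinfun_apply g x) + ereal (c * bregman \<phi> x xb)"

definition robj :: "'a \<Rightarrow> real" where
  "robj x = real_of_ereal (F x) + blinfun_apply g x + c * bregman \<phi> x xb"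

lemma obj_dom: "x \<in> edom F \<Longrightarrow> obj x = ereal (robj x)"
  unfolding obj_def robj_def using edom_real[OF F, of x] by (metis plus_ereal.simps(1))

lemma obj_outside: "x \<notin> edom F \<Longrightarrow> obj x = \<infinity>"
  unfolding obj_def edom_def by simp

lemma is_arg_min_obj_iff:
  "is_arg_min obj (\<lambda>_. True) p \<longleftrightarrow> p \<in> edom F \<and> (\<forall>x\<in>edom F. robj p \<le> robj x)"
proof
  assume p: "is_arg_min obj (\<lambda>_. True) p"
  then have le: "obj p \<le> obj x" for x by (simp add: is_arg_min_linorder)
  have "p \<in> edom F" using le[of xb] obj_dom[OF xb] obj_outside[of p] by force
  then show "p \<in> edom F \<and> (\<forall>x\<in>edom F. robj p \<le> robj x)" using le obj_dom by (metis ereal_less_eq(3))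
next
  assume p: "p \<in> edom F \<and> (\<forall>x\<in>edom F. robj p \<le> robj x)"
  have "obj p \<le> obj x" for x using p obj_dom obj_outside by (cases "x \<in> edom F") auto
  then show "is_arg_min obj (\<lambda>_. True) p" by (simp add: is_arg_min_linorder)
qed

text \<open>The quadratic growth of the Bregman distance beats the at most linear decrease of the rest.\<close>

lemma robj_coercive:
  "\<exists>B B0. B \<ge> 0 \<and> (\<forall>x\<in>edom F. c / 2 * (norm (x - xb))\<^sup>2 - B * norm (x - xb) - B0 \<le> robj x)"
proof -
  obtain A where A: "A \<ge> 0" "\<And>x. x \<in> edom F \<Longrightarrow> real_of_ereal (F x) \<ge> - A * (1 + norm (x - xb))"
    using closed_convex_fun_linear_minorant[OF fd F xb] by blast
  have "c / 2 * (norm (x - xb))\<^sup>2 - (A + norm g) * norm (x - xb) - (A + norm g * norm xb) \<le> robj x"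
    if x: "x \<in> edom F" for x
  proof -
    have "norm x \<le> norm xb + norm (x - xb)" using norm_triangle_sub[of x xb] by simp
    then have "norm g * norm x \<le> norm g * (norm xb + norm (x - xb))" by (intro mult_left_mono) auto
    then have "- blinfun_apply g x \<le> norm g * norm xb + norm g * norm (x - xb)"
      using norm_blinfun[of g x] by (simp add: algebra_simps abs_le_iff)
    moreover have "c * (1 / 2 * (norm (x - xb))\<^sup>2) \<le> c * bregman \<phi> x xb"
      using bregman_lower_bound[OF dg x xb] c by (intro mult_left_mono) auto
    ultimately show ?thesis using A(2)[OF x] unfolding robj_def by (simp add: algebra_simps)
  qed
  moreover have "A + norm g \<ge> 0" using A(1) by simp
  ultimately show ?thesis by blast
qed

text \<open>A minimizing sequence is bounded by coercivity. The objective is not assumed closed as a whole, as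
  \<open>\<phi>\<close> is continuous only near the domain of \<open>F\<close>; hence the limit is first placed in that domain by
  bounding \<open>F\<close> alone, and only then the values are compared.\<close>

lemma minimizer_exists: "\<exists>p\<in>edom F. \<forall>x\<in>edom F. robj p \<le> robj x"
proof -
  obtain B B0 where B: "B \<ge> 0"
    and lower: "\<And>x. x \<in> edom F \<Longrightarrow> c / 2 * (norm (x - xb))\<^sup>2 - B * norm (x - xb) - B0 \<le> robj x"
    using robj_coercive by blast
  \<comment> \<open>Completing the square.\<close>
  have quad: "- (B\<^sup>2 / (2 * c)) \<le> c / 2 * r\<^sup>2 - B * r" for r
  proof -
    have "0 \<le> (c * r - B)\<^sup>2 / (2 * c)" using c by simp
    also have "\<dots> = c / 2 * r\<^sup>2 - B * r + B\<^sup>2 / (2 * c)"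
      using c by (simp add: power2_eq_square field_simps)
    finally show ?thesis by linarith
  qed
  have bdd: "bdd_below (robj ` edom F)"
  proof (rule bdd_belowI2)
    fix x assume "x \<in> edom F"
    then show "- (B\<^sup>2 / (2 * c)) - B0 \<le> robj x" using lower[of x] quad[of "norm (x - xb)"] by linarith
  qed
  define m where "m = Inf (robj ` edom F)"
  have m: "m \<le> robj x" if "x \<in> edom F" for x
    unfolding m_def using that bdd by (intro cInf_lower) auto
  have "\<forall>n::nat. \<exists>x\<in>edom F. robj x < m + 1 / real (Suc n)"
  proof
    fix n :: nat
    have "Inf (robj ` edom F) < m + 1 / real (Suc n)" unfolding m_def by simp
    then show "\<exists>x\<in>edom F. robj x < m + 1 / real (Suc n)" using cInf_lessD[of "robj ` edom F"] xb by blast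
  qed
  then obtain u where u: "\<And>n. u n \<in> edom F" "\<And>n. robj (u n) < m + 1 / real (Suc n)" by metis
  have u1: "robj (u n) \<le> m + 1" for n
    using u(2)[of n] by (rule less_imp_le[OF less_le_trans]) simp
  define K where "K = \<bar>B0 + m + 1\<bar>"
  have r: "norm (u n - xb) \<le> max 1 (2 * (B + K) / c)" for n
  proof (cases "norm (u n - xb) \<le> 1")
    case False
    let ?r = "norm (u n - xb)"
    have "c / 2 * ?r\<^sup>2 \<le> B * ?r + K" using lower[OF u(1)[of n]] u1[of n] unfolding K_def by linarith
    also have "K \<le> K * ?r" using False unfolding K_def by (simp add: mult_le_cancel_left1)
    finally have "c / 2 * ?r * ?r \<le> (B + K) * ?r" by (simp add: power2_eq_square algebra_simps)
    then have "c / 2 * ?r \<le> B + K" using False by (smt (verit) mult_right_le_imp_le)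
    then have "?r \<le> 2 * (B + K) / c" using c by (simp add: field_simps)
    then show ?thesis by simp
  qed simp
  define M where "M = norm xb + max 1 (2 * (B + K) / c)"
  have M: "norm (u n) \<le> M" for n
    using r[of n] norm_triangle_sub[of "u n" xb] unfolding M_def by linarith
  obtain p s where s: "strict_mono s" "(u \<circ> s) \<longlonglongrightarrow> p"
    using finite_dimensional_convergent_subseq[OF fd M] .
  have fu: "F (u n) = ereal (robj (u n) - blinfun_apply g (u n) - c * bregman \<phi> (u n) xb)" for n
    using edom_real[OF F u(1)[of n]] unfolding robj_def by simp
  have "F ((u \<circ> s) n) \<le> ereal (m + 1 + norm g * M)" for n
  proof -
    have "- blinfun_apply g (u (s n)) \<le> norm g * norm (u (s n))"
      using norm_blinfun[of g "u (s n)"] by (simp add: abs_le_iff)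
    also have "\<dots> \<le> norm g * M" by (intro mult_left_mono M) auto
    finally show ?thesis
      using u1[of "s n"] fu[of "s n"] mult_nonneg_nonneg[OF less_imp_le[OF c] bregman_nonneg[OF dg u(1)[of "s n"] xb]]
      by simp
  qed
  from closed_convex_fun_lsc[OF F s(2) tendsto_const this]
  have p: "p \<in> edom F" by (rule edomI)
  have lim: "(\<lambda>n. (m + 1 / real (Suc (s n))) - blinfun_apply g ((u \<circ> s) n) - c * bregman \<phi> ((u \<circ> s) n) xb)
      \<longlonglongrightarrow> (m + 0) - blinfun_apply g p - c * bregman \<phi> p xb"
    unfolding bregman_def
    by (intro tendsto_intros s(2) isCont_tendsto_compose[OF distance_generating_isCont[OF dg p]]
        LIMSEQ_subseq_LIMSEQ[OF lim_inverse_n' s(1), unfolded o_def] 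
        LIMSEQ_subseq_LIMSEQ[OF LIMSEQ_Suc[OF lim_1_over_n] s(1), unfolded o_def])
  have "F p \<le> ereal ((m + 0) - blinfun_apply g p - c * bregman \<phi> p xb)"
  proof (rule closed_convex_fun_lsc[OF F s(2) lim])
    fix n show "F ((u \<circ> s) n) \<le> ereal ((m + 1 / real (Suc (s n))) - blinfun_apply g ((u \<circ> s) n)
        - c * bregman \<phi> ((u \<circ> s) n) xb)"
      using u(2)[of "s n"] fu[of "s n"] by simp
  qed
  then have "robj p \<le> m" using edom_real[OF F p] unfolding robj_def
    by (metis (no_types, lifting) add.commute add.right_neutral diff_diff_eq ereal_less_eq(3) le_diff_eq)
  then show ?thesis using p m by (meson order_trans)
qed

text \<open>Compare the minimizer with nearby points of the segment towards \<open>x\<close>: \<open>F\<close> is controlled by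
  convexity, the smooth part by its directional derivative.\<close>

lemma minimizer_optimality:
  assumes p: "p \<in> edom F" "\<And>x. x \<in> edom F \<Longrightarrow> robj p \<le> robj x" and x: "x \<in> edom F"
  shows "real_of_ereal (F p) + blinfun_apply (- g - c *\<^sub>R (grad \<phi> p - grad \<phi> xb)) (x - p)
          \<le> real_of_ereal (F x)"
proof -
  let ?f = "\<lambda>x. real_of_ereal (F x)"
  have cv: "convex_on (edom F) ?f" by (rule closed_convex_fun_convex_on[OF F])
  let ?L = "(?f x - ?f p) + blinfun_apply g (x - p) - c * blinfun_apply (grad \<phi> xb) (x - p)"
  have ev: "\<forall>\<^sub>F t in at_right 0. - ?L / c \<le> (\<phi> (p + t *\<^sub>R (x - p)) - \<phi> p) / t"
    unfolding eventually_at_right_field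
  proof (intro exI[of _ 1] conjI allI impI)
    fix t :: real assume t: "0 < t" "t < 1"
    let ?z = "p + t *\<^sub>R (x - p)"
    have z: "?z = (1 - t) *\<^sub>R p + t *\<^sub>R x" by (simp add: algebra_simps)
    have zd: "?z \<in> edom F" unfolding z using convex_on_imp_convex[OF cv] p(1) x t by (simp add: convex_alt)
    have 1: "robj p \<le> robj ?z" by (rule p(2)[OF zd])
    have 2: "?f ?z \<le> (1 - t) * ?f p + t * ?f x"
      unfolding z using convex_onD[OF cv, of t p x] p(1) x t by simp
    have 3: "bregman \<phi> ?z xb - bregman \<phi> p xb = \<phi> ?z - \<phi> p - t * blinfun_apply (grad \<phi> xb) (x - p)"
      by (simp add: bregman_def blinfun.diff_right blinfun.add_right blinfun.scaleR_right algebra_simps)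
    have 4: "blinfun_apply g ?z - blinfun_apply g p = t * blinfun_apply g (x - p)"
      by (simp add: blinfun.add_right blinfun.scaleR_right)
    have "0 \<le> (?f ?z - ?f p) + (blinfun_apply g ?z - blinfun_apply g p)
        + c * (bregman \<phi> ?z xb - bregman \<phi> p xb)"
      using 1 unfolding robj_def by (simp add: algebra_simps)
    also have "\<dots> \<le> t * ?L + c * (\<phi> ?z - \<phi> p)"
      unfolding 3 4 using 2 by (simp add: algebra_simps)
    finally have "- ?L * t \<le> (\<phi> ?z - \<phi> p) * c" by (simp add: algebra_simps)
    then show "- ?L / c \<le> (\<phi> ?z - \<phi> p) / t" by (rule divide_le_divide_cross[OF _ t(1) c])
  qed simp
  have "- ?L / c \<le> blinfun_apply (grad \<phi> p) (x - p)"
    by (rule tendsto_le[OF trivial_limit_at_right_real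
          grad_directional[OF distance_generating_differentiable[OF dg p(1)]] tendsto_const ev])
  then have "- ?L \<le> blinfun_apply (grad \<phi> p) (x - p) * c"
    using c by (simp only: pos_divide_le_eq)
  then show ?thesis
    by (simp add: blinfun.diff_left blinfun.minus_left blinfun.add_left blinfun.scaleR_left algebra_simps)
qed

text \<open>The optimality condition improves to \<open>robj p + c D(q, p) \<le> robj q\<close>.\<close>

lemma minimizer_unique:
  assumes p: "p \<in> edom F" "\<And>x. x \<in> edom F \<Longrightarrow> robj p \<le> robj x"
    and q: "q \<in> edom F" "\<And>x. x \<in> edom F \<Longrightarrow> robj q \<le> robj x"
  shows "q = p"
proof -
  have "real_of_ereal (F p) + blinfun_apply (- g - c *\<^sub>R (grad \<phi> p - grad \<phi> xb)) (q - p)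
          \<le> real_of_ereal (F q)"
    by (rule minimizer_optimality[OF p q(1)])
  then have "robj p + c * bregman \<phi> q p \<le> robj q"
    using arg_cong[OF bregman_three_point[of \<phi> q xb p], of "\<lambda>r. c * r"] unfolding robj_def
    by (simp add: blinfun.diff_left blinfun.minus_left blinfun.scaleR_left blinfun.diff_right blinfun.add_left algebra_simps)
  moreover have "robj q \<le> robj p" using q(2) p(1) .
  ultimately have "c * bregman \<phi> q p \<le> 0" by linarith
  then have "bregman \<phi> q p \<le> 0" using c by (simp add: mult_le_0_iff)
  then have "(norm (q - p))\<^sup>2 \<le> 0" using bregman_lower_bound[OF dg q(1) p(1)] by linarith
  then show ?thesis by simp
qed

lemma unique_arg_min: "\<exists>!p. is_arg_min obj (\<lambda>_. True) p"
  using minimizer_exists minimizer_unique unfolding is_arg_min_obj_iff by blast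

lemma
  shows arg_min_dom: "arg_min obj (\<lambda>_. True) \<in> edom F"
    and arg_min_subgradient:
      "- g - c *\<^sub>R (grad \<phi> (arg_min obj (\<lambda>_. True)) - grad \<phi> xb) \<in> subdifferential F (arg_min obj (\<lambda>_. True))"
proof -
  let ?p = "arg_min obj (\<lambda>_. True)"
  have "is_arg_min obj (\<lambda>_. True) ?p"
    unfolding arg_min_def using unique_arg_min by (intro someI_ex[of "is_arg_min obj (\<lambda>_. True)"]) blast
  then have p: "?p \<in> edom F" "\<And>x. x \<in> edom F \<Longrightarrow> robj ?p \<le> robj x" unfolding is_arg_min_obj_iff by auto
  then show "?p \<in> edom F" by simp
  have "F ?p + ereal (blinfun_apply (- g - c *\<^sub>R (grad \<phi> ?p - grad \<phi> xb)) (x - ?p)) \<le> F x" for x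
  proof (cases "x \<in> edom F")
    case True
    from minimizer_optimality[OF p True] edom_real[OF F p(1)] edom_real[OF F True]
    show ?thesis by (metis plus_ereal.simps(1) ereal_less_eq(3))
  qed (simp add: edom_def)
  then show "- g - c *\<^sub>R (grad \<phi> ?p - grad \<phi> xb) \<in> subdifferential F ?p"
    unfolding subdifferential_def by blast
qed

end

section \<open>One iteration of the algorithm\<close>

lemma young_blinfun:
  fixes a :: "'b::real_normed_vector \<Rightarrow>\<^sub>L real"
  assumes "c > 0"
  shows "r * blinfun_apply a v \<le> r\<^sup>2 * ((norm a)\<^sup>2 / (2 * c)) + c / 2 * (norm v)\<^sup>2"
proof -
  have "r * blinfun_apply a v \<le> \<bar>r\<bar> * \<bar>blinfun_apply a v\<bar>" by (metis abs_ge_self abs_mult)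
  also have "\<dots> \<le> \<bar>r\<bar> * (norm a * norm v)" using norm_blinfun[of a v] by (intro mult_left_mono) auto
  also have "\<dots> \<le> r\<^sup>2 * ((norm a)\<^sup>2 / (2 * c)) + c / 2 * (norm v)\<^sup>2"
  proof -
    have "0 \<le> (\<bar>r\<bar> * norm a - c * norm v)\<^sup>2 / (2 * c)" using assms by simp
    also have "\<dots> = r\<^sup>2 * ((norm a)\<^sup>2 / (2 * c)) + c / 2 * (norm v)\<^sup>2 - \<bar>r\<bar> * (norm a * norm v)"
      using assms by (simp add: power2_diff power_mult_distrib field_simps power2_eq_square[of c] power2_eq_square[of "norm v"])
    finally show ?thesis by linarith
  qed
  finally show ?thesis .
qed

locale apdb_setting = standing_assumptions P "mu inp" Lxx Lyx Lyy
  for P :: "('a::real_normed_vector, 'b::real_normed_vector) spp"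
    and inp :: "('a, 'b) apdb_input" and Lxx Lyx Lyy :: real +
  assumes start: "x_init inp \<in> edom (fun_f P)" "y_init inp \<in> edom (fun_h P)"
    and pos: "tau_bar inp > 0" "gamma0 inp > 0"
    and eta: "eta inp \<in> {0<..<1}"
    and coeffs: "delta inp \<in> {0..<1}" "c_alpha inp > 0" "c_beta inp \<ge> 0"
    and params: "params_I inp Lyy \<or> params_II inp Lyy"
begin

abbreviation "domf \<equiv> edom (fun_f P)"
abbreviation "domh \<equiv> edom (fun_h P)"
abbreviation fr :: "'a \<Rightarrow> real" where "fr x \<equiv> real_of_ereal (fun_f P x)"
abbreviation hr :: "'b \<Rightarrow> real" where "hr y \<equiv> real_of_ereal (fun_h P y)"
abbreviation "ca \<equiv> c_alpha inp"
abbreviation "cb \<equiv> c_beta inp"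

lemma coeff_sum_le: "ca + cb + delta inp \<le> 1"
  using params by (auto simp: params_I_def params_II_def split: if_splits)

lemma mu_nonneg: "mu inp \<ge> 0"
  using f_modulus by (simp add: convexity_modulus_def)

lemma Lyy_zero_if_cb_zero: "cb = 0 \<Longrightarrow> Lyy = 0"
  using params Lyy_nonneg by (auto simp: params_I_def params_II_def split: if_splits)

lemma mu_zero_if_Lyy_pos: "Lyy > 0 \<Longrightarrow> mu inp = 0"
  using params by (auto simp: params_I_def params_II_def)

lemma convex_domf: "convex domf" and convex_domh: "convex domh"
  using closed_convex_fun_convex_on[OF f_closed_convex] closed_convex_fun_convex_on[OF h_closed_convex]
    convex_on_imp_convex by blast+

text \<open>The conditions under which the proximal steps at a state are well posed. The last one serves the
  threshold \<open>\<Psi>\<^sub>2\<close>, which is meant for a constant \<open>\<gamma>\<close>.\<close>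

definition admissible :: "('a, 'b) apdb_state \<Rightarrow> bool" where
  "admissible s \<longleftrightarrow> x_cur s \<in> domf \<and> x_prev s \<in> domf \<and> y_cur s \<in> domh \<and> y_prev s \<in> domh \<and>
     sigma_prev s > 0 \<and> gamma_cur s \<ge> gamma0 inp \<and> tau_trial s > 0 \<and>
     (mu inp = 0 \<longrightarrow> gamma_cur s = gamma0 inp)"

lemma admissible_gamma_pos: "admissible s \<Longrightarrow> gamma_cur s > 0"
  using pos unfolding admissible_def by linarith

lemma sigma_of_pos: "admissible s \<Longrightarrow> \<tau> > 0 \<Longrightarrow> sigma_of s \<tau> > 0"
  using admissible_gamma_pos by (simp add: sigma_of_def)

lemma y_prox_problem:
  assumes "admissible s" "\<tau> > 0"
  shows "prox_problem (fun_h P) (phiY P) (domY P) (1 / sigma_of s \<tau>) (y_cur s)"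
  using assms finite_dim_Y h_closed_convex dgf_Y sigma_of_pos[OF assms]
  by unfold_locales (auto simp: admissible_def)

lemma x_prox_problem:
  assumes "admissible s" "\<tau> > 0"
  shows "prox_problem (fun_f P) (phiX P) (domX P) (1 / \<tau>) (x_cur s)"
  using assms finite_dim_X f_closed_convex dgf_X
  by unfold_locales (auto simp: admissible_def)

lemma y_objective_eq:
  assumes "admissible s" "\<tau> > 0"
  shows "y_objective P s \<tau>
    = prox_problem.obj (fun_h P) (phiY P) (- s_vec P s \<tau>) (1 / sigma_of s \<tau>) (y_cur s)"
  unfolding prox_problem.obj_def[OF y_prox_problem[OF assms]] y_objective_def
  by (simp add: fun_eq_iff minus_ereal_def blinfun.minus_left)

lemma x_objective_eq:
  assumes "admissible s" "\<tau> > 0"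
  shows "x_objective P s \<tau>
    = prox_problem.obj (fun_f P) (phiX P) (gradx P (x_cur s) (next_y P s \<tau>)) (1 / \<tau>) (x_cur s)"
  unfolding prox_problem.obj_def[OF x_prox_problem[OF assms]] x_objective_def
  by (simp add: fun_eq_iff)

lemma unique_argmins:
  assumes "admissible s" "\<tau> > 0"
  shows "\<exists>!y. is_arg_min (y_objective P s \<tau>) (\<lambda>_. True) y"
    and "\<exists>!x. is_arg_min (x_objective P s \<tau>) (\<lambda>_. True) x"
  unfolding y_objective_eq[OF assms] x_objective_eq[OF assms]
  by (rule prox_problem.unique_arg_min[OF y_prox_problem[OF assms]]
      prox_problem.unique_arg_min[OF x_prox_problem[OF assms]])+

lemma next_in_dom:
  assumes "admissible s" "\<tau> > 0"
  shows "next_x P s \<tau> \<in> domf" "next_y P s \<tau> \<in> domh"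
  unfolding next_x_def next_y_def y_objective_eq[OF assms] x_objective_eq[OF assms]
  by (rule prox_problem.arg_min_dom[OF y_prox_problem[OF assms]]
      prox_problem.arg_min_dom[OF x_prox_problem[OF assms]])+

text \<open>The subgradient inequalities at the new points, in the three-point form of Bregman distances and
  multiplied by \<open>\<sigma>\<^sub>k\<close>.\<close>

lemma next_y_inequality:
  assumes adm: "admissible s" "\<tau> > 0" and y: "y \<in> domh"
  defines "\<sigma> \<equiv> sigma_of s \<tau>" and "y' \<equiv> next_y P s \<tau>"
  shows "\<sigma> * hr y' + \<sigma> * blinfun_apply (s_vec P s \<tau>) (y - y')
     \<le> \<sigma> * hr y + (DY P y (y_cur s) - DY P y y' - DY P y' (y_cur s))"
proof -
  have \<sigma>: "\<sigma> > 0" using sigma_of_pos[OF adm] by (simp add: \<sigma>_def)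
  have y': "y' \<in> domh" using next_in_dom[OF adm] by (simp add: y'_def)
  have "- (- s_vec P s \<tau>) - (1 / \<sigma>) *\<^sub>R (grad (phiY P) y' - grad (phiY P) (y_cur s))
      \<in> subdifferential (fun_h P) y'"
    using prox_problem.arg_min_subgradient[OF y_prox_problem[OF adm], of "- s_vec P s \<tau>"]
    unfolding y'_def \<sigma>_def next_y_def y_objective_eq[OF adm] .
  then have "fun_h P y' + ereal (blinfun_apply (s_vec P s \<tau>
      - (1 / \<sigma>) *\<^sub>R (grad (phiY P) y' - grad (phiY P) (y_cur s))) (y - y')) \<le> fun_h P y"
    unfolding subdifferential_def by simp
  then have "hr y' + blinfun_apply (s_vec P s \<tau>
      - (1 / \<sigma>) *\<^sub>R (grad (phiY P) y' - grad (phiY P) (y_cur s))) (y - y') \<le> hr y"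
    using edom_real[OF h_closed_convex y] edom_real[OF h_closed_convex y']
    by (metis ereal_less_eq(3) plus_ereal.simps(1))
  then have "hr y' + blinfun_apply (s_vec P s \<tau>) (y - y')
      \<le> hr y + (DY P y (y_cur s) - DY P y y' - DY P y' (y_cur s)) / \<sigma>"
    unfolding bregman_three_point
    by (simp add: blinfun.diff_left blinfun.scaleR_left diff_divide_distrib right_diff_distrib)
  from mult_left_mono[OF this less_imp_le[OF \<sigma>]] show ?thesis using \<sigma>
    by (simp add: distrib_left)
qed

text \<open>The strong convexity of \<open>f\<close> may be expressed by \<open>D\<^sub>X\<close>: either \<open>\<mu> = 0\<close>, or \<open>D\<^sub>X\<close> is half
  the squared norm.\<close>

lemma mu_bregman: "mu inp / 2 * (norm (x - xb))\<^sup>2 = mu inp * DX P x xb"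
  using bregman_X[of x xb] mu_nonneg by (cases "mu inp = 0") auto

lemma next_x_inequality:
  assumes adm: "admissible s" "\<tau> > 0" and x: "x \<in> domf"
  defines "\<sigma> \<equiv> sigma_of s \<tau>" and "x' \<equiv> next_x P s \<tau>"
  shows "\<sigma> * fr x' - \<sigma> * blinfun_apply (gradx P (x_cur s) (next_y P s \<tau>)) (x - x')
     \<le> \<sigma> * fr x + gamma_cur s * DX P x (x_cur s)
       - gamma_cur s * (1 + mu inp * \<tau>) * DX P x x' - gamma_cur s * DX P x' (x_cur s)"
proof -
  let ?G = "gradx P (x_cur s) (next_y P s \<tau>)"
  let ?g = "- ?G - (1 / \<tau>) *\<^sub>R (grad (phiX P) x' - grad (phiX P) (x_cur s))"
  have \<sigma>: "\<sigma> > 0" using sigma_of_pos[OF adm] by (simp add: \<sigma>_def)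
  have x': "x' \<in> domf" using next_in_dom[OF adm] by (simp add: x'_def)
  have "?g \<in> subdifferential (fun_f P) x'"
    using prox_problem.arg_min_subgradient[OF x_prox_problem[OF adm], of ?G]
    unfolding x'_def \<sigma>_def next_x_def x_objective_eq[OF adm] .
  then have "fun_f P x' + ereal (blinfun_apply ?g (x - x') + mu inp / 2 * (norm (x - x'))\<^sup>2) \<le> fun_f P x"
    using f_modulus x x' unfolding convexity_modulus_def by blast
  then have "fr x' + (blinfun_apply ?g (x - x') + mu inp / 2 * (norm (x - x'))\<^sup>2) \<le> fr x"
    using edom_real[OF f_closed_convex x] edom_real[OF f_closed_convex x']
    by (metis ereal_less_eq(3) plus_ereal.simps(1))
  then have "fr x' - blinfun_apply ?G (x - x')
      \<le> fr x + (DX P x (x_cur s) - DX P x x' - DX P x' (x_cur s)) / \<tau> - mu inp * DX P x x'"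
    unfolding bregman_three_point mu_bregman
    by (simp add: blinfun.diff_left blinfun.minus_left blinfun.scaleR_left diff_divide_distrib right_diff_distrib)
  note mult_left_mono[OF this less_imp_le[OF \<sigma>]]
  moreover have "\<sigma> * (d / \<tau>) = gamma_cur s * d" for d
    using adm(2) by (simp add: \<sigma>_def sigma_of_def)
  moreover have "\<sigma> * (mu inp * d) = gamma_cur s * (mu inp * \<tau> * d)" for d
    by (simp add: \<sigma>_def sigma_of_def)
  ultimately show ?thesis
    by (simp only: right_diff_distrib distrib_left distrib_right mult_1_right mult.assoc)
qed

lemma descent_lemma:
  assumes x: "x \<in> domf" "xb \<in> domf" and y: "y \<in> domh"
  shows "Phi P x y \<le> Phi P xb y + blinfun_apply (gradx P xb y) (x - xb) + Lxx / 2 * (norm (x - xb))\<^sup>2"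
proof -
  let ?v = "x - xb"
  let ?p = "\<lambda>t. Phi P (xb + t *\<^sub>R ?v) y - t * blinfun_apply (gradx P xb y) ?v - Lxx / 2 * t\<^sup>2 * (norm ?v)\<^sup>2"
  have "?p 1 \<le> ?p 0"
  proof (rule DERIV_nonpos_imp_nonincreasing[of 0 1 ?p])
    fix t :: real assume t: "0 \<le> t" "t \<le> 1"
    let ?z = "xb + t *\<^sub>R ?v"
    have z: "?z = (1 - t) *\<^sub>R xb + t *\<^sub>R x" by (simp add: algebra_simps)
    have zd: "?z \<in> domf" unfolding z using convex_domf x t by (simp add: convex_alt)
    let ?d = "blinfun_apply (gradx P ?z y) ?v - blinfun_apply (gradx P xb y) ?v - Lxx * t * (norm ?v)\<^sup>2"
    have "(?p has_real_derivative ?d) (at t)"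
      unfolding gradx_def
      by (rule derivative_eq_intros grad_DERIV_line[where F = "\<lambda>u. Phi P u y"] Phi_differentiable_x[OF y] refl | simp)+
    moreover have "?d \<le> 0"
    proof -
      have "blinfun_apply (gradx P ?z y - gradx P xb y) ?v \<le> norm (gradx P ?z y - gradx P xb y) * norm ?v"
        using norm_blinfun[of "gradx P ?z y - gradx P xb y" ?v] by (simp add: abs_le_iff)
      also have "\<dots> \<le> (Lxx * norm (?z - xb)) * norm ?v"
        by (intro mult_right_mono gradx_Lipschitz zd x y) auto
      finally show ?thesis using t by (simp add: blinfun.diff_left power2_eq_square mult.assoc)
    qed
    ultimately show "\<exists>y. (?p has_real_derivative y) (at t) \<and> y \<le> 0" by blast
  qed simp
  then show ?thesis by simp
qed

subsection \<open>Acceptance of small trial steps\<close>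

text \<open>The product \<open>\<theta>\<^sub>k \<sigma>\<^sub>k = \<sigma>\<^sub>k\<^sub>-\<^sub>1\<close> cancels the previous step size from the coefficient of \<open>D\<^sub>Y\<close>.\<close>

lemma test_E_eq:
  assumes adm: "admissible s" "\<tau> > 0"
  defines "\<sigma> \<equiv> sigma_of s \<tau>"
  shows "test_E P inp s \<tau> x y
    = Phi P x y - Phi P (x_cur s) y - blinfun_apply (gradx P (x_cur s) y) (x - x_cur s)
      - DX P x (x_cur s) / \<tau>
      + \<sigma> * ((norm (grady P x y - grady P (x_cur s) y))\<^sup>2 / (2 * ca)
           + (norm (grady P (x_cur s) y - grady P (x_cur s) (y_cur s)))\<^sup>2 / (2 * cb))
      - (1 - (ca + cb)) / \<sigma> * DY P y (y_cur s)"
proof -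
  have \<sigma>: "\<sigma> > 0" using sigma_of_pos[OF adm] by (simp add: \<sigma>_def)
  have \<rho>: "sigma_prev s > 0" using adm by (simp add: admissible_def)
  have 1: "1 / \<sigma> - theta_of s \<tau> * (ca / sigma_prev s + cb / sigma_prev s) = (1 - (ca + cb)) / \<sigma>"
    using \<rho> \<sigma> unfolding theta_of_def \<sigma>_def[symmetric] by (simp add: field_simps)
  have 2: "r / (2 * (c / \<sigma>)) = \<sigma> * (r / (2 * c))" for r c by simp
  show ?thesis
    unfolding test_E_def Let_def \<sigma>_def[symmetric] 1 2 by (simp add: distrib_left)
qed

text \<open>The descent lemma and the Lipschitz bounds estimate the positive terms of the test by multiples of the
  squared steps; the two conditions say that these multiples are absorbed by the Bregman distances, with a
  share \<open>\<delta>\<close> to spare.\<close>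

lemma small_step_accepted:
  assumes adm: "admissible s" "\<tau> > 0"
    and x_cond: "Lxx * \<tau> + Lyx\<^sup>2 * (\<tau>\<^sup>2 * gamma_cur s) / ca \<le> 1 - delta inp"
    and y_cond: "Lyy\<^sup>2 * (sigma_of s \<tau>)\<^sup>2 \<le> cb * (1 - (ca + cb + delta inp))"
  shows "accepts P inp s \<tau>"
proof -
  let ?x = "next_x P s \<tau>" and ?y = "next_y P s \<tau>" and ?xk = "x_cur s" and ?yk = "y_cur s"
  define \<sigma> where "\<sigma> = sigma_of s \<tau>"
  define N where "N = (norm (?x - ?xk))\<^sup>2"
  define M where "M = (norm (?y - ?yk))\<^sup>2"
  have \<sigma>: "\<sigma> > 0" using sigma_of_pos[OF adm] by (simp add: \<sigma>_def)
  have k: "?xk \<in> domf" "?yk \<in> domh" using adm by (auto simp: admissible_def)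
  note d = next_in_dom[OF adm]
  have DXl: "N / 2 \<le> DX P ?x ?xk" using bregman_lower_bound[OF dgf_X d(1) k(1)] by (simp add: N_def)
  have DYl: "M / 2 \<le> DY P ?y ?yk" using bregman_lower_bound[OF dgf_Y d(2) k(2)] by (simp add: M_def)
  have a: "(norm (grady P ?x ?y - grady P ?xk ?y))\<^sup>2 \<le> Lyx\<^sup>2 * N"
    using power_mono[OF grady_Lipschitz[OF d(1) k(1) d(2) d(2)] norm_ge_zero, of 2]
    by (simp add: N_def power_mult_distrib)
  have b: "(norm (grady P ?xk ?y - grady P ?xk ?yk))\<^sup>2 \<le> Lyy\<^sup>2 * M"
    using power_mono[OF grady_Lipschitz[OF k(1) k(1) d(2) k(2)] norm_ge_zero, of 2]
    by (simp add: M_def power_mult_distrib)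
  let ?A = "(norm (grady P ?x ?y - grady P ?xk ?y))\<^sup>2" and ?B = "(norm (grady P ?xk ?y - grady P ?xk ?yk))\<^sup>2"
  have X: "Lxx / 2 * N + \<sigma> * (?A / (2 * ca)) \<le> (1 - delta inp) / \<tau> * DX P ?x ?xk"
  proof -
    have "\<sigma> * (?A / (2 * ca)) \<le> \<sigma> * (Lyx\<^sup>2 * N / (2 * ca))"
      using \<sigma> coeffs a by (intro mult_left_mono divide_right_mono) auto
    also have "\<dots> = Lyx\<^sup>2 * (\<tau>\<^sup>2 * gamma_cur s) / ca / \<tau> * (N / 2)"
      using adm(2) coeffs by (simp add: \<sigma>_def sigma_of_def power2_eq_square field_simps)
    finally have "Lxx / 2 * N + \<sigma> * (?A / (2 * ca))
        \<le> Lxx * \<tau> / \<tau> * (N / 2) + Lyx\<^sup>2 * (\<tau>\<^sup>2 * gamma_cur s) / ca / \<tau> * (N / 2)"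
      using adm(2) by simp
    also have "\<dots> = (Lxx * \<tau> + Lyx\<^sup>2 * (\<tau>\<^sup>2 * gamma_cur s) / ca) / \<tau> * (N / 2)"
      by (simp add: add_divide_distrib distrib_right)
    also have "\<dots> \<le> (1 - delta inp) / \<tau> * (N / 2)"
      using x_cond adm(2) by (intro mult_right_mono divide_right_mono) (auto simp: N_def)
    also have "\<dots> \<le> (1 - delta inp) / \<tau> * DX P ?x ?xk"
      using adm(2) coeffs DXl by (intro mult_left_mono) auto
    finally show ?thesis .
  qed
  have Y: "\<sigma> * (?B / (2 * cb)) \<le> (1 - (ca + cb + delta inp)) / \<sigma> * DY P ?y ?yk"
  proof -
    have "\<sigma> * (?B / (2 * cb)) \<le> (1 - (ca + cb + delta inp)) / \<sigma> * (M / 2)"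
    proof (cases "cb = 0")
      case True
      then show ?thesis using coeff_sum_le \<sigma> by (simp add: M_def)
    next
      case False
      then have cb: "cb > 0" using coeffs by simp
      have "\<sigma> * (?B / (2 * cb)) \<le> \<sigma> * (Lyy\<^sup>2 * M / (2 * cb))"
        using \<sigma> cb b by (intro mult_left_mono divide_right_mono) auto
      also have "\<dots> = Lyy\<^sup>2 * \<sigma>\<^sup>2 / cb / \<sigma> * (M / 2)"
        using \<sigma> cb by (simp add: power2_eq_square field_simps)
      also have "\<dots> \<le> (1 - (ca + cb + delta inp)) / \<sigma> * (M / 2)"
        using y_cond \<sigma> cb unfolding \<sigma>_def[symmetric]
        by (intro mult_right_mono divide_right_mono) (auto simp: M_def pos_divide_le_eq mult.commute)
      finally show ?thesis .
    qed
    also have "\<dots> \<le> (1 - (ca + cb + delta inp)) / \<sigma> * DY P ?y ?yk"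
      using \<sigma> coeff_sum_le DYl by (intro mult_left_mono) auto
    finally show ?thesis .
  qed
  have "Phi P ?x ?y - Phi P ?xk ?y - blinfun_apply (gradx P ?xk ?y) (?x - ?xk) \<le> Lxx / 2 * N"
    using descent_lemma[OF d(1) k(1) d(2)] by (simp add: N_def)
  then have "test_E P inp s \<tau> ?x ?y \<le> Lxx / 2 * N + \<sigma> * (?A / (2 * ca)) + \<sigma> * (?B / (2 * cb))
      - DX P ?x ?xk / \<tau> - (1 - (ca + cb)) / \<sigma> * DY P ?y ?yk"
    unfolding test_E_eq[OF adm] \<sigma>_def[symmetric] by (simp add: distrib_left)
  also have "\<dots> \<le> ((1 - delta inp) / \<tau> * DX P ?x ?xk - DX P ?x ?xk / \<tau>)
      + ((1 - (ca + cb + delta inp)) / \<sigma> * DY P ?y ?yk - (1 - (ca + cb)) / \<sigma> * DY P ?y ?yk)"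
    using X Y by linarith
  also have "\<dots> = - (delta inp / \<tau>) * DX P ?x ?xk - delta inp / \<sigma> * DY P ?y ?yk"
    using adm(2) \<sigma> by (simp add: field_simps)
  finally show ?thesis unfolding accepts_def \<sigma>_def[symmetric] .
qed

subsection \<open>The one-iteration estimate\<close>

definition grady_jump :: "('a, 'b) apdb_state \<Rightarrow> 'b \<Rightarrow>\<^sub>L real" where
  "grady_jump s = grady P (x_cur s) (y_cur s) - grady P (x_prev s) (y_prev s)"

text \<open>The jump is split at the mixed point, new in \<open>y\<close> and old in \<open>x\<close>, as in the test function: the two
  parts are governed by \<open>L\<^sub>y\<^sub>x\<close> and \<open>L\<^sub>y\<^sub>y\<close>, and have their own Young parameters.\<close>

definition jump_cost :: "('a, 'b) apdb_state \<Rightarrow> real" where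
  "jump_cost s = (norm (grady P (x_cur s) (y_cur s) - grady P (x_prev s) (y_cur s)))\<^sup>2 / (2 * ca)
     + (norm (grady P (x_prev s) (y_cur s) - grady P (x_prev s) (y_prev s)))\<^sup>2 / (2 * cb)"

definition potential :: "('a, 'b) apdb_state \<Rightarrow> 'a \<Rightarrow> 'b \<Rightarrow> real" where
  "potential s x y = gamma_cur s * DX P x (x_cur s) + DY P y (y_cur s)
     - sigma_prev s * blinfun_apply (grady_jump s) (y - y_cur s) + (sigma_prev s)\<^sup>2 * jump_cost s"

text \<open>For \<open>c\<^sub>\<beta> = 0\<close> the second part of the jump vanishes because \<open>L\<^sub>y\<^sub>y = 0\<close>; the quotient by zero in its
  cost then has the right value.\<close>

lemma momentum_bound:
  assumes adm: "admissible s"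
  shows "r * blinfun_apply (grady_jump s) v \<le> r\<^sup>2 * jump_cost s + (ca + cb) / 2 * (norm v)\<^sup>2"
proof -
  let ?a = "grady P (x_cur s) (y_cur s) - grady P (x_prev s) (y_cur s)"
  let ?b = "grady P (x_prev s) (y_cur s) - grady P (x_prev s) (y_prev s)"
  have "r * blinfun_apply ?b v \<le> r\<^sup>2 * ((norm ?b)\<^sup>2 / (2 * cb)) + cb / 2 * (norm v)\<^sup>2"
  proof (cases "cb = 0")
    case True
    have "norm ?b \<le> Lyy * norm (y_cur s - y_prev s) + Lyx * norm (x_prev s - x_prev s)"
      using adm by (intro grady_Lipschitz) (auto simp: admissible_def)
    then have "?b = 0" using Lyy_zero_if_cb_zero[OF True] by simp
    then show ?thesis using True by (simp only: blinfun.zero_left) simp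
  next
    case False
    then show ?thesis using coeffs by (intro young_blinfun) simp
  qed
  moreover have "r * blinfun_apply ?a v \<le> r\<^sup>2 * ((norm ?a)\<^sup>2 / (2 * ca)) + ca / 2 * (norm v)\<^sup>2"
    using coeffs by (intro young_blinfun)
  moreover have "grady_jump s = ?a + ?b" by (simp add: grady_jump_def)
  then have "r * blinfun_apply (grady_jump s) v = r * blinfun_apply ?a v + r * blinfun_apply ?b v"
    by (simp only: blinfun.add_left distrib_left)
  ultimately show ?thesis
    unfolding jump_cost_def by (simp add: distrib_left distrib_right add_divide_distrib)
qed

lemma potential_lower_bound:
  assumes adm: "admissible s" and y: "y \<in> domh"
  shows "gamma_cur s * DX P x (x_cur s) + (1 - (ca + cb)) * DY P y (y_cur s) \<le> potential s x y"
proof -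
  have "1 / 2 * (norm (y - y_cur s))\<^sup>2 \<le> DY P y (y_cur s)"
    using adm by (intro bregman_lower_bound[OF dgf_Y] y) (auto simp: admissible_def)
  then have "(ca + cb) * (1 / 2 * (norm (y - y_cur s))\<^sup>2) \<le> (ca + cb) * DY P y (y_cur s)"
    using coeffs by (intro mult_left_mono) auto
  then have "(ca + cb) / 2 * (norm (y - y_cur s))\<^sup>2 \<le> (ca + cb) * DY P y (y_cur s)" by simp
  then have "sigma_prev s * blinfun_apply (grady_jump s) (y - y_cur s)
      \<le> (sigma_prev s)\<^sup>2 * jump_cost s + (ca + cb) * DY P y (y_cur s)"
    using momentum_bound[OF adm, of "sigma_prev s" "y - y_cur s"] by linarith
  then show ?thesis unfolding potential_def left_diff_distrib mult_1 by linarith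
qed

text \<open>The gap \<open>L(x', y) - L(x, y')\<close> in real arithmetic. It agrees with the extended real gap as long as all
  four points lie in the domains.\<close>

definition rgap :: "'a \<Rightarrow> 'b \<Rightarrow> 'a \<Rightarrow> 'b \<Rightarrow> real" where
  "rgap x' y' x y = (fr x' + Phi P x' y - hr y) - (fr x + Phi P x y' - hr y')"

text \<open>The sum of five inequalities, each scaled by \<open>\<sigma>\<close>: the two proximal steps, convexity of \<open>\<Phi>\<close> in \<open>x\<close> at
  \<open>x\<^sub>k\<close>, concavity in \<open>y\<close> at the new point, and the acceptance test; the cross term
  \<open>\<langle>q\<^sub>k, y\<^sub>k\<^sub>+\<^sub>1 - y\<^sub>k\<rangle>\<close> is paid for by \<open>momentum_bound\<close>.\<close>

lemma one_iteration:
  fixes \<tau>' :: real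
  assumes adm: "admissible s" "\<tau> > 0" and acc: "accepts P inp s \<tau>"
    and x: "x \<in> domf" and y: "y \<in> domh"
  defines "x' \<equiv> next_x P s \<tau>" and "y' \<equiv> next_y P s \<tau>"
  defines "s' \<equiv> \<lparr> x_prev = x_cur s, y_prev = y_cur s, x_cur = x', y_cur = y',
      sigma_prev = sigma_of s \<tau>, gamma_cur = gamma_cur s * (1 + mu inp * \<tau>), tau_trial = \<tau>' \<rparr>"
  shows "sigma_of s \<tau> * rgap x' y' x y \<le> potential s x y - potential s' x y
     - delta inp * (gamma_cur s * DX P x' (x_cur s) + DY P y' (y_cur s))"
proof -
  let ?xk = "x_cur s" and ?yk = "y_cur s"
  let ?G = "gradx P ?xk y'" and ?q = "grady_jump s" and ?H = "grady P x' y'"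
  define \<sigma> where "\<sigma> = sigma_of s \<tau>"
  have \<sigma>: "\<sigma> > 0" using sigma_of_pos[OF adm] by (simp add: \<sigma>_def)
  have k: "?xk \<in> domf" "?yk \<in> domh" using adm by (auto simp: admissible_def)
  have d: "x' \<in> domf" "y' \<in> domh" using next_in_dom[OF adm] by (auto simp: x'_def y'_def)
  have \<gamma>: "\<sigma> * (1 / \<tau>) = gamma_cur s" using adm(2) by (simp add: \<sigma>_def sigma_of_def)
  have \<theta>: "\<sigma> * theta_of s \<tau> = sigma_prev s" using \<sigma> by (simp add: theta_of_def \<sigma>_def)
  have svec: "s_vec P s \<tau> = grady P ?xk ?yk + theta_of s \<tau> *\<^sub>R ?q"
    by (simp add: s_vec_def grady_jump_def algebra_simps)
  have "\<sigma> * blinfun_apply (s_vec P s \<tau>) (y - y') = \<sigma> * blinfun_apply (grady P ?xk ?yk) (y - y')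
      + \<sigma> * theta_of s \<tau> * blinfun_apply ?q (y - y')"
    unfolding svec by (simp add: blinfun.add_left blinfun.scaleR_left distrib_left)
  then have sv: "\<sigma> * blinfun_apply (s_vec P s \<tau>) (y - y') = \<sigma> * blinfun_apply (grady P ?xk ?yk) (y - y')
      + sigma_prev s * blinfun_apply ?q (y - ?yk) + sigma_prev s * blinfun_apply ?q (?yk - y')"
    unfolding \<theta> by (simp add: blinfun.diff_right algebra_simps)
  have Y: "\<sigma> * hr y' + \<sigma> * blinfun_apply (s_vec P s \<tau>) (y - y')
     \<le> \<sigma> * hr y + (DY P y ?yk - DY P y y' - DY P y' ?yk)"
    using next_y_inequality[OF adm y] by (simp add: \<sigma>_def y'_def)
  have X: "\<sigma> * fr x' - \<sigma> * blinfun_apply ?G (x - x')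
     \<le> \<sigma> * fr x + gamma_cur s * DX P x ?xk
       - gamma_cur s * (1 + mu inp * \<tau>) * DX P x x' - gamma_cur s * DX P x' ?xk"
    using next_x_inequality[OF adm x] by (simp add: \<sigma>_def x'_def y'_def)
  have "Phi P ?xk y' + blinfun_apply ?G (x - ?xk) \<le> Phi P x y'"
    using convex_gradient_inequality[OF Phi_convex[OF d(2)] Phi_differentiable_x[OF d(2)]]
    by (simp add: gradx_def)
  from mult_left_mono[OF this less_imp_le[OF \<sigma>]]
  have cvx: "\<sigma> * Phi P ?xk y' + \<sigma> * blinfun_apply ?G (x - ?xk) \<le> \<sigma> * Phi P x y'"
    by (simp add: distrib_left)
  have "Phi P x' y \<le> Phi P x' y' + blinfun_apply ?H (y - y')"
    using concave_gradient_inequality[OF Phi_concave[OF d(1)] Phi_differentiable_y[OF d(1)]]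
    by (simp add: grady_def)
  from mult_left_mono[OF this less_imp_le[OF \<sigma>]]
  have ccv: "\<sigma> * Phi P x' y \<le> \<sigma> * Phi P x' y' + \<sigma> * blinfun_apply ?H (y - y')"
    by (simp add: distrib_left)
  let ?J = "jump_cost s'"
  have J: "jump_cost s' = (norm (grady P x' y' - grady P ?xk y'))\<^sup>2 / (2 * ca)
      + (norm (grady P ?xk y' - grady P ?xk ?yk))\<^sup>2 / (2 * cb)"
    by (simp add: jump_cost_def s'_def)
  have "Phi P x' y' - Phi P ?xk y' - blinfun_apply ?G (x' - ?xk) - DX P x' ?xk / \<tau> + \<sigma> * ?J
      - (1 - (ca + cb)) / \<sigma> * DY P y' ?yk \<le> - (delta inp / \<tau>) * DX P x' ?xk - delta inp / \<sigma> * DY P y' ?yk"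
    using acc unfolding accepts_def test_E_eq[OF adm] \<sigma>_def[symmetric] x'_def[symmetric] y'_def[symmetric] J .
  from mult_left_mono[OF this less_imp_le[OF \<sigma>]]
  have E: "\<sigma> * Phi P x' y' - \<sigma> * Phi P ?xk y' - \<sigma> * blinfun_apply ?G (x' - ?xk)
      - \<sigma> * (1 / \<tau>) * DX P x' ?xk + \<sigma>\<^sup>2 * ?J
      - (1 - (ca + cb)) * DY P y' ?yk \<le> - delta inp * (\<sigma> * (1 / \<tau>)) * DX P x' ?xk - delta inp * DY P y' ?yk"
    using \<sigma> by (simp add: right_diff_distrib distrib_left power2_eq_square mult.commute[of "delta inp"] mult.assoc)
  have "1 / 2 * (norm (y' - ?yk))\<^sup>2 \<le> DY P y' ?yk" by (rule bregman_lower_bound[OF dgf_Y d(2) k(2)])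
  then have "(ca + cb) * (1 / 2 * (norm (y' - ?yk))\<^sup>2) \<le> (ca + cb) * DY P y' ?yk"
    using coeffs by (intro mult_left_mono) auto
  then have Q: "sigma_prev s * blinfun_apply ?q (y' - ?yk) \<le> (sigma_prev s)\<^sup>2 * jump_cost s + (ca + cb) * DY P y' ?yk"
    using momentum_bound[OF adm(1), of "sigma_prev s" "y' - ?yk"] by simp
  have q': "grady_jump s' = ?H - grady P ?xk ?yk" by (simp add: grady_jump_def s'_def)
  have V': "potential s' x y = gamma_cur s * (1 + mu inp * \<tau>) * DX P x x' + DY P y y'
      - (\<sigma> * blinfun_apply ?H (y - y') - \<sigma> * blinfun_apply (grady P ?xk ?yk) (y - y')) + \<sigma>\<^sup>2 * ?J"
    unfolding potential_def q' by (simp add: s'_def \<sigma>_def blinfun.diff_left right_diff_distrib)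
  have G: "\<sigma> * blinfun_apply ?G (x - x') = \<sigma> * blinfun_apply ?G (x - ?xk) - \<sigma> * blinfun_apply ?G (x' - ?xk)"
    by (simp add: blinfun.diff_right algebra_simps)
  have q: "sigma_prev s * blinfun_apply ?q (?yk - y') = - (sigma_prev s * blinfun_apply ?q (y' - ?yk))"
    by (simp add: blinfun.diff_right algebra_simps)
  have "\<sigma> * rgap x' y' x y = \<sigma> * fr x' + \<sigma> * Phi P x' y - \<sigma> * hr y - \<sigma> * fr x - \<sigma> * Phi P x y' + \<sigma> * hr y'"
    by (simp add: rgap_def algebra_simps)
  then show ?thesis
    unfolding \<sigma>_def[symmetric] V' potential_def[of s]
    using X Y cvx ccv E[unfolded \<gamma>] Q unfolding sv G q by (simp add: algebra_simps)
qed

end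

section \<open>The step size thresholds\<close>

text \<open>Clearing the denominator \<open>L\<^sub>x\<^sub>x\<close> yields an expression that is continuous at \<open>L\<^sub>x\<^sub>x = 0\<close>; it shows that \<open>\<Psi>\<^sub>1\<close> is the positive root of the quadratic
  \<open>k \<Psi>\<^sup>2 + L\<^sub>x\<^sub>x \<Psi> = 1 - \<delta>\<close>, also in the limit \<open>L\<^sub>x\<^sub>x \<down> 0\<close>.\<close>

lemma psi1_expr_eq:
  assumes "L > 0" "Ly > 0" "gamma0 inp > 0" "c_alpha inp > 0" "delta inp < 1"
  defines "k \<equiv> Ly\<^sup>2 * gamma0 inp / c_alpha inp"
  shows "psi1_expr inp Ly L = (sqrt (L\<^sup>2 + 4 * k * (1 - delta inp)) - L) / (2 * k)"
proof -
  let ?q = "1 + 4 * (1 - delta inp) * gamma0 inp / c_alpha inp * (Ly\<^sup>2 / L\<^sup>2)"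
  have "L * sqrt ?q = sqrt (L\<^sup>2) * sqrt ?q" using assms by simp
  also have "\<dots> = sqrt (L\<^sup>2 * ?q)" by (simp only: real_sqrt_mult)
  also have "L\<^sup>2 * ?q = L\<^sup>2 + 4 * k * (1 - delta inp)" using assms by (simp add: k_def field_simps)
  finally have "L * (- 1 + sqrt ?q) = sqrt (L\<^sup>2 + 4 * k * (1 - delta inp)) - L" by (simp add: algebra_simps)
  moreover have "psi1_expr inp Ly L = c_alpha inp / (2 * gamma0 inp * Ly\<^sup>2) * (L * (- 1 + sqrt ?q))"
    unfolding psi1_expr_def Let_def by simp
  moreover have "c_alpha inp / (2 * gamma0 inp * Ly\<^sup>2) = 1 / (2 * k)"
    using assms by (simp add: k_def field_simps)
  ultimately show ?thesis by simp
qed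

lemma Psi1_eq:
  assumes "L \<ge> 0" "Ly > 0" "gamma0 inp > 0" "c_alpha inp > 0" "delta inp < 1"
  defines "k \<equiv> Ly\<^sup>2 * gamma0 inp / c_alpha inp"
  shows "Psi1 inp Ly L = (sqrt (L\<^sup>2 + 4 * k * (1 - delta inp)) - L) / (2 * k)"
proof (cases "L = 0")
  case False
  then show ?thesis using assms psi1_expr_eq[of L Ly inp] by (simp add: Psi1_def)
next
  case True
  have k: "k > 0" using assms by (simp add: k_def)
  let ?g = "\<lambda>L. (sqrt (L\<^sup>2 + 4 * k * (1 - delta inp)) - L) / (2 * k)"
  have "(?g \<longlongrightarrow> ?g 0) (at_right 0)"
    using k by (intro tendsto_intros) auto
  moreover have "\<forall>\<^sub>F L in at_right 0. ?g L = psi1_expr inp Ly L"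
    unfolding eventually_at_right_field k_def
    by (intro exI[of _ 1] conjI allI impI psi1_expr_eq[symmetric] assms) auto
  ultimately have "(psi1_expr inp Ly \<longlongrightarrow> ?g 0) (at_right 0)" by (rule Lim_transform_eventually)
  then have "Lim (at_right 0) (psi1_expr inp Ly) = ?g 0"
    by (intro tendsto_Lim) auto
  then show ?thesis using True by (simp add: Psi1_def)
qed

lemma Psi1_root:
  assumes L: "L \<ge> 0" and "Ly > 0" "gamma0 inp > 0" "c_alpha inp > 0" "delta inp < 1"
  defines "k \<equiv> Ly\<^sup>2 * gamma0 inp / c_alpha inp"
  shows "Psi1 inp Ly L > 0" and "L * Psi1 inp Ly L + k * (Psi1 inp Ly L)\<^sup>2 = 1 - delta inp"
proof -
  let ?S = "sqrt (L\<^sup>2 + 4 * k * (1 - delta inp))"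
  have k: "k > 0" using assms by (simp add: k_def)
  have d: "4 * k * (1 - delta inp) > 0" using k assms by simp
  have \<psi>: "Psi1 inp Ly L = (?S - L) / (2 * k)" using Psi1_eq[of L Ly inp] assms by simp
  have "sqrt (L\<^sup>2) < ?S" using d by (intro real_sqrt_less_mono) simp
  then show "Psi1 inp Ly L > 0" unfolding \<psi> using L k by simp
  have S: "?S\<^sup>2 = L\<^sup>2 + 4 * k * (1 - delta inp)" using d by (intro real_sqrt_pow2) simp
  have "L * ((?S - L) / (2 * k)) + k * ((?S - L) / (2 * k))\<^sup>2 = (?S\<^sup>2 - L\<^sup>2) / (4 * k)"
    using k by (simp add: field_simps power2_eq_square)
  also have "\<dots> = 1 - delta inp" unfolding S using k by simp
  finally show "L * Psi1 inp Ly L + k * (Psi1 inp Ly L)\<^sup>2 = 1 - delta inp" unfolding \<psi> .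
qed

lemma bigomega_of_lower_bound:
  fixes f g :: "nat \<Rightarrow> real"
  assumes "c > 0" "\<And>K. K \<ge> 1 \<Longrightarrow> c * g K \<le> f K" "\<And>K. g K \<ge> 0"
  shows "f \<in> \<Omega>(g)"
proof (rule landau_omega.bigI[OF assms(1)])
  show "\<forall>\<^sub>F K in sequentially. c * norm (g K) \<le> norm (f K)"
    using eventually_ge_at_top[of 1]
  proof eventually_elim
    case (elim K)
    then show ?case using assms(2)[OF elim] assms(3)[of K] by simp
  qed
qed

context apdb_setting
begin

definition threshold :: real where
  "threshold = (if Lyy = 0 then Psi1 inp Lyx Lxx else min (Psi1 inp Lyx Lxx) (Psi2 inp Lyy))"

lemma cb_margin_pos: "Lyy > 0 \<Longrightarrow> cb * (1 - (ca + cb + delta inp)) > 0"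
  using params by (auto simp: params_I_def params_II_def)

lemma threshold_pos: "threshold > 0"
proof -
  have "Psi1 inp Lyx Lxx > 0" using Psi1_root(1)[of Lxx Lyx inp] Lxx_nonneg Lyx_pos pos coeffs by simp
  moreover have "Psi2 inp Lyy > 0" if "Lyy \<noteq> 0"
    using that Lyy_nonneg cb_margin_pos pos by (simp add: Psi2_def)
  ultimately show ?thesis by (simp add: threshold_def)
qed

text \<open>The quantity \<open>\<tau>\<^sup>2 \<gamma>\<close> is unchanged from one outer iteration to the next trial step; therefore
  all step size bounds are stated for it.\<close>

lemma below_threshold_accepted:
  assumes adm: "admissible s" "\<tau> > 0" and le: "\<tau>\<^sup>2 * gamma_cur s \<le> threshold\<^sup>2 * gamma0 inp"
  shows "accepts P inp s \<tau>"
proof (rule small_step_accepted[OF adm])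
  let ?\<psi> = "Psi1 inp Lyx Lxx"
  have g: "gamma0 inp \<le> gamma_cur s" using adm by (simp add: admissible_def)
  have \<psi>: "?\<psi> > 0" "Lxx * ?\<psi> + Lyx\<^sup>2 * gamma0 inp / ca * ?\<psi>\<^sup>2 = 1 - delta inp"
    using Psi1_root[of Lxx Lyx inp] Lxx_nonneg Lyx_pos pos coeffs by auto
  have t\<psi>: "threshold \<le> ?\<psi>" by (simp add: threshold_def)
  have "threshold\<^sup>2 * gamma0 inp \<le> ?\<psi>\<^sup>2 * gamma0 inp"
    using t\<psi> threshold_pos pos by (intro mult_right_mono power_mono) auto
  with le have le': "\<tau>\<^sup>2 * gamma_cur s \<le> ?\<psi>\<^sup>2 * gamma0 inp" by linarith
  have "\<tau>\<^sup>2 * gamma0 inp \<le> \<tau>\<^sup>2 * gamma_cur s" using g by (intro mult_left_mono) auto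
  with le have "\<tau>\<^sup>2 * gamma0 inp \<le> threshold\<^sup>2 * gamma0 inp" by linarith
  then have "\<tau>\<^sup>2 \<le> threshold\<^sup>2" using pos(2) by (rule mult_right_le_imp_le)
  then have \<tau>: "\<tau> \<le> threshold" by (rule power2_le_imp_le) (rule less_imp_le[OF threshold_pos])
  have "\<tau> \<le> ?\<psi>" using \<tau> t\<psi> by (rule order_trans)
  then have "Lxx * \<tau> \<le> Lxx * ?\<psi>" using Lxx_nonneg by (rule mult_left_mono)
  moreover have "Lyx\<^sup>2 * (\<tau>\<^sup>2 * gamma_cur s) / ca \<le> Lyx\<^sup>2 * (?\<psi>\<^sup>2 * gamma0 inp) / ca"
    by (rule divide_right_mono[OF mult_left_mono[OF le']]) (use coeffs in simp_all)
  moreover have "Lyx\<^sup>2 * (?\<psi>\<^sup>2 * gamma0 inp) / ca = Lyx\<^sup>2 * gamma0 inp / ca * ?\<psi>\<^sup>2" by simp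
  ultimately show "Lxx * \<tau> + Lyx\<^sup>2 * (\<tau>\<^sup>2 * gamma_cur s) / ca \<le> 1 - delta inp"
    using \<psi>(2) by linarith
  show "Lyy\<^sup>2 * (sigma_of s \<tau>)\<^sup>2 \<le> cb * (1 - (ca + cb + delta inp))"
  proof (cases "Lyy = 0")
    case True
    then show ?thesis using coeffs coeff_sum_le by simp
  next
    case False
    then have L: "Lyy > 0" using Lyy_nonneg by simp
    then have "gamma_cur s = gamma0 inp" using adm mu_zero_if_Lyy_pos by (simp add: admissible_def)
    then have "sigma_of s \<tau> \<le> gamma0 inp * Psi2 inp Lyy"
      using \<tau> False pos by (simp add: sigma_of_def threshold_def)
    then have "Lyy * sigma_of s \<tau> \<le> Lyy * (gamma0 inp * Psi2 inp Lyy)" using L by (intro mult_left_mono) auto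
    also have "\<dots> = sqrt (cb * (1 - (ca + cb + delta inp)))"
      using L pos by (simp add: Psi2_def)
    finally have "(Lyy * sigma_of s \<tau>)\<^sup>2 \<le> (sqrt (cb * (1 - (ca + cb + delta inp))))\<^sup>2"
      using L sigma_of_pos[OF adm] by (intro power_mono) auto
    then show ?thesis using cb_margin_pos[OF L] by (simp add: power_mult_distrib)
  qed
qed

subsection \<open>The backtracking loop\<close>

definition min_trial :: real where "min_trial = min (tau_bar inp) (eta inp * threshold)"

lemma min_trial_pos: "min_trial > 0"
  using pos eta threshold_pos by (simp add: min_trial_def)

definition invariant :: "('a, 'b) apdb_state \<Rightarrow> bool" where
  "invariant s \<longleftrightarrow> admissible s \<and> min_trial\<^sup>2 * gamma0 inp \<le> (tau_trial s)\<^sup>2 * gamma_cur s \<and>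
     (tau_trial s)\<^sup>2 * gamma_cur s \<le> (tau_bar inp)\<^sup>2 * gamma0 inp"

lemma trial_step_pos: "admissible s \<Longrightarrow> trial_step inp s j > 0"
  using eta by (simp add: trial_step_def admissible_def)

definition shrink_bound :: nat where
  "shrink_bound = nat \<lceil>log (1 / eta inp) (tau_bar inp / threshold)\<rceil>"

lemma power_shrink_bound: "eta inp ^ shrink_bound * tau_bar inp \<le> threshold"
proof -
  let ?b = "1 / eta inp" and ?r = "tau_bar inp / threshold"
  have b: "?b > 1" using eta by simp
  have r: "?r > 0" using pos threshold_pos by simp
  have "?r = ?b powr log ?b ?r" by (rule powr_log_cancel[symmetric]) (use b r in linarith)+
  also have "\<dots> \<le> ?b powr real shrink_bound"
    using b unfolding shrink_bound_def by (intro powr_mono) linarith+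
  also have "\<dots> = ?b ^ shrink_bound" by (rule powr_realpow) (use b in linarith)
  finally have "?r \<le> ?b ^ shrink_bound" .
  then show ?thesis using eta threshold_pos by (simp add: field_simps power_divide)
qed

lemma shrink_bound_accepted:
  assumes "invariant s"
  shows "accepts P inp s (trial_step inp s shrink_bound)"
proof (rule below_threshold_accepted)
  have "(trial_step inp s shrink_bound)\<^sup>2 * gamma_cur s
      = (eta inp ^ shrink_bound)\<^sup>2 * ((tau_trial s)\<^sup>2 * gamma_cur s)"
    by (simp add: trial_step_def power_mult_distrib)
  also have "\<dots> \<le> (eta inp ^ shrink_bound)\<^sup>2 * ((tau_bar inp)\<^sup>2 * gamma0 inp)"
    using assms by (intro mult_left_mono) (auto simp: invariant_def)
  also have "\<dots> = (eta inp ^ shrink_bound * tau_bar inp)\<^sup>2 * gamma0 inp" by (simp add: power_mult_distrib)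
  also have "\<dots> \<le> threshold\<^sup>2 * gamma0 inp"
    using pos eta power_shrink_bound by (intro mult_right_mono power_mono) auto
  finally show "(trial_step inp s shrink_bound)\<^sup>2 * gamma_cur s \<le> threshold\<^sup>2 * gamma0 inp" .
qed (use assms trial_step_pos in \<open>auto simp: invariant_def\<close>)

lemma shrinks_le: "invariant s \<Longrightarrow> shrinks P inp s \<le> shrink_bound"
  unfolding shrinks_def by (intro Least_le shrink_bound_accepted)

lemma accepted_tau_accepted: "invariant s \<Longrightarrow> accepts P inp s (accepted_tau P inp s)"
  unfolding accepted_tau_def shrinks_def 
  by (rule LeastI[where P = "\<lambda>j. accepts P inp s (trial_step inp s j)"], rule shrink_bound_accepted)

lemma accepted_tau_pos: "invariant s \<Longrightarrow> accepted_tau P inp s > 0"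
  unfolding accepted_tau_def by (simp add: trial_step_pos invariant_def)

lemma accepted_tau_upper:
  assumes "invariant s"
  shows "(accepted_tau P inp s)\<^sup>2 * gamma_cur s \<le> (tau_bar inp)\<^sup>2 * gamma0 inp"
proof -
  have t: "tau_trial s > 0" "gamma_cur s > 0"
    using assms admissible_gamma_pos by (auto simp: invariant_def admissible_def)
  have "eta inp ^ n * tau_trial s \<le> 1 * tau_trial s" for n
    using eta t by (intro mult_right_mono power_le_one) auto
  then have "(accepted_tau P inp s)\<^sup>2 * gamma_cur s \<le> (tau_trial s)\<^sup>2 * gamma_cur s"
    using eta t unfolding accepted_tau_def trial_step_def by (intro mult_right_mono power_mono) auto
  then show ?thesis using assms by (simp add: invariant_def)
qed

text \<open>If the trial step was shrunk at all, then its last rejected value was above the threshold.\<close>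

lemma accepted_tau_lower:
  assumes inv: "invariant s"
  shows "min_trial\<^sup>2 * gamma0 inp \<le> (accepted_tau P inp s)\<^sup>2 * gamma_cur s"
proof (cases "shrinks P inp s")
  case 0
  then show ?thesis using inv by (simp add: accepted_tau_def trial_step_def invariant_def)
next
  case (Suc n)
  let ?t = "trial_step inp s n"
  have adm: "admissible s" using inv by (simp add: invariant_def)
  have "\<not> accepts P inp s ?t" using Suc not_less_Least unfolding shrinks_def by (metis lessI)
  then have big: "threshold\<^sup>2 * gamma0 inp < ?t\<^sup>2 * gamma_cur s"
    using below_threshold_accepted[OF adm trial_step_pos[OF adm]] by force
  have "min_trial\<^sup>2 * gamma0 inp \<le> (eta inp * threshold)\<^sup>2 * gamma0 inp"
    using min_trial_pos pos by (intro mult_right_mono power_mono) (auto simp: min_trial_def)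
  also have "\<dots> = (eta inp)\<^sup>2 * (threshold\<^sup>2 * gamma0 inp)" by (simp add: power_mult_distrib)
  also have "\<dots> \<le> (eta inp)\<^sup>2 * (?t\<^sup>2 * gamma_cur s)" using big by (intro mult_left_mono) auto
  also have "\<dots> = (accepted_tau P inp s)\<^sup>2 * gamma_cur s"
    by (simp add: accepted_tau_def Suc trial_step_def power_mult_distrib)
  finally show ?thesis .
qed

lemma invariant_start: "invariant (apdb_start inp)"
proof -
  have "min_trial\<^sup>2 * gamma0 inp \<le> (tau_bar inp)\<^sup>2 * gamma0 inp"
    using min_trial_pos pos by (intro mult_right_mono power_mono) (auto simp: min_trial_def)
  then show ?thesis using start pos by (simp add: invariant_def admissible_def apdb_start_def)
qed

text \<open>The factor \<open>\<surd>(\<gamma>\<^sub>k / \<gamma>\<^sub>k\<^sub>+\<^sub>1)\<close> in the next trial step compensates the growth of \<open>\<gamma>\<close>.\<close>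

lemma invariant_step:
  assumes inv: "invariant s"
  shows "invariant (apdb_step P inp s)"
proof -
  let ?\<tau> = "accepted_tau P inp s" and ?s = "apdb_step P inp s"
  have adm: "admissible s" using inv by (simp add: invariant_def)
  note \<tau> = accepted_tau_pos[OF inv]
  have \<gamma>: "gamma_cur s > 0" by (rule admissible_gamma_pos[OF adm])
  have f: "1 + mu inp * ?\<tau> \<ge> 1" using mu_nonneg \<tau> by simp
  then have "gamma_cur s * 1 \<le> gamma_cur s * (1 + mu inp * ?\<tau>)" using \<gamma> by (intro mult_left_mono) auto
  then have "gamma0 inp \<le> gamma_cur s * (1 + mu inp * ?\<tau>)" using adm unfolding admissible_def by linarith
  moreover have "sqrt (gamma_cur s / (gamma_cur s * (1 + mu inp * ?\<tau>))) > 0" using \<gamma> f by simp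
  ultimately have "admissible ?s"
    using next_in_dom[OF adm \<tau>] sigma_of_pos[OF adm \<tau>] \<tau> adm
    unfolding admissible_def apdb_step_def Let_def by simp
  moreover have "(tau_trial ?s)\<^sup>2 * gamma_cur ?s = ?\<tau>\<^sup>2 * gamma_cur s"
    using \<gamma> f by (simp add: apdb_step_def Let_def power_mult_distrib)
  ultimately show ?thesis
    using accepted_tau_lower[OF inv] accepted_tau_upper[OF inv] by (simp add: invariant_def)
qed

lemma invariant_apdb: "invariant (apdb P inp k)"
  by (induction k) (auto simp: invariant_start invariant_step)

lemma admissible_apdb: "admissible (apdb P inp k)"
  using invariant_apdb[of k] by (simp add: invariant_def)

lemma backtracking_well_defined:
  "let s = apdb P inp k; \<tau> = trial_step inp s; n = shrinks P inp s in
     (\<exists>j. accepts P inp s (\<tau> j)) \<and>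
     (\<forall>j\<le>n. (\<exists>!y. is_arg_min (y_objective P s (\<tau> j)) (\<lambda>_. True) y) \<and>
             (\<exists>!x. is_arg_min (x_objective P s (\<tau> j)) (\<lambda>_. True) x)) \<and>
     real n \<le> max 0 (1 + log (1 / eta inp) (tau_bar inp / threshold)) \<and>
     1 + n \<le> 1 + nat \<lceil>log (1 / eta inp) (tau_bar inp / threshold)\<rceil>"
proof -
  let ?s = "apdb P inp k"
  have le: "shrinks P inp ?s \<le> shrink_bound" by (rule shrinks_le[OF invariant_apdb])
  have "real shrink_bound \<le> max 0 (1 + log (1 / eta inp) (tau_bar inp / threshold))"
    unfolding shrink_bound_def by linarith
  with le have "real (shrinks P inp ?s) \<le> max 0 (1 + log (1 / eta inp) (tau_bar inp / threshold))"
    using of_nat_mono[OF le, where 'a = real] by linarith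
  then show ?thesis
    using shrink_bound_accepted[OF invariant_apdb[of k]] le
      unique_argmins[OF admissible_apdb[of k] trial_step_pos[OF admissible_apdb[of k]]]
    unfolding Let_def by (auto simp: shrink_bound_def)
qed

section \<open>The ergodic rate\<close>

abbreviation "xs \<equiv> iter_x P inp"
abbreviation "ys \<equiv> iter_y P inp"
abbreviation "\<gamma> \<equiv> step_gamma P inp"
abbreviation "\<tau> \<equiv> step_tau P inp"
abbreviation "\<sigma> \<equiv> step_sigma P inp"
abbreviation "T \<equiv> total_weight P inp"

lemma iter_dom: "xs k \<in> domf" "ys k \<in> domh"
  using admissible_apdb[of k] by (auto simp: admissible_def iter_x_def iter_y_def)

lemma tau_pos: "\<tau> k > 0"
  by (simp add: step_tau_def accepted_tau_pos invariant_apdb)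

lemma gamma_ge: "\<gamma> k \<ge> gamma0 inp"
  using admissible_apdb[of k] by (auto simp: admissible_def step_gamma_def)

lemma gamma_pos: "\<gamma> k > 0"
  using gamma_ge[of k] pos by linarith

lemma sigma_pos: "\<sigma> k > 0"
  by (simp add: step_sigma_def gamma_pos tau_pos)

lemma gamma_Suc: "\<gamma> (Suc k) = \<gamma> k * (1 + mu inp * \<tau> k)"
  by (simp add: step_gamma_def step_tau_def apdb_step_def Let_def)

lemma gamma_const: "mu inp = 0 \<Longrightarrow> \<gamma> k = gamma0 inp"
  using admissible_apdb[of k] by (auto simp: admissible_def step_gamma_def)

definition V :: "nat \<Rightarrow> 'a \<Rightarrow> 'b \<Rightarrow> real" where "V k = potential (apdb P inp k)"

lemma V_lower_bound:
  "y \<in> domh \<Longrightarrow> \<gamma> k * DX P x (xs k) + (1 - (ca + cb)) * DY P y (ys k) \<le> V k x y"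
  using potential_lower_bound[OF admissible_apdb] by (simp add: V_def step_gamma_def iter_x_def iter_y_def)

lemma DX_nonneg: "x \<in> domf \<Longrightarrow> x' \<in> domf \<Longrightarrow> 0 \<le> DX P x x'"
  by (rule bregman_nonneg[OF dgf_X])

lemma DY_nonneg: "y \<in> domh \<Longrightarrow> y' \<in> domh \<Longrightarrow> 0 \<le> DY P y y'"
  by (rule bregman_nonneg[OF dgf_Y])

lemma V_nonneg: "x \<in> domf \<Longrightarrow> y \<in> domh \<Longrightarrow> 0 \<le> V k x y"
  using V_lower_bound[of y k x] coeff_sum_le coeffs gamma_pos[of k]
    mult_nonneg_nonneg[OF less_imp_le[OF gamma_pos[of k]] DX_nonneg[OF _ iter_dom(1)[of k], of x]]
    mult_nonneg_nonneg[of "1 - (ca + cb)", OF _ DY_nonneg[OF _ iter_dom(2)[of k], of y]]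
  by simp

lemma V_0: "V 0 x y = \<sigma> 0 * Delta P inp x y"
  using tau_pos[of 0] sigma_pos[of 0]
  by (simp add: V_def potential_def apdb_start_def Delta_def grady_jump_def jump_cost_def
      distrib_left) (simp add: step_sigma_def step_gamma_def apdb_start_def)

lemma iteration_inequality:
  assumes "x \<in> domf" "y \<in> domh"
  shows "\<sigma> k * rgap (xs (Suc k)) (ys (Suc k)) x y \<le> V k x y - V (Suc k) x y
     - delta inp * (\<gamma> k * DX P (xs (Suc k)) (xs k) + DY P (ys (Suc k)) (ys k))"
  using one_iteration[OF admissible_apdb[of k] tau_pos[of k, unfolded step_tau_def] accepted_tau_accepted[OF invariant_apdb] assms]
  unfolding V_def step_sigma_def step_gamma_def step_tau_def iter_x_def iter_y_def apdb.simps apdb_step_def Let_def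
    sigma_of_def by simp

lemma iteration_inequality_without_gain:
  assumes "x \<in> domf" "y \<in> domh"
  shows "\<sigma> k * rgap (xs (Suc k)) (ys (Suc k)) x y \<le> V k x y - V (Suc k) x y"
proof -
  have "0 \<le> delta inp * (\<gamma> k * DX P (xs (Suc k)) (xs k) + DY P (ys (Suc k)) (ys k))"
    using coeffs gamma_pos[of k] iter_dom by (simp add: DX_nonneg DY_nonneg)
  then show ?thesis using iteration_inequality[OF assms, of k] by linarith
qed

lemma weighted_gap_sum:
  assumes "x \<in> domf" "y \<in> domh"
  shows "(\<Sum>k<K. \<sigma> k * rgap (xs (Suc k)) (ys (Suc k)) x y) \<le> V 0 x y - V K x y"
proof (induction K)
  case (Suc K)
  then show ?case using iteration_inequality_without_gain[OF assms, of K] by simp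
qed simp

lemma weight_pos: "weight P inp k > 0"
  by (simp add: weight_def sigma_pos)

lemma T_pos: "K \<ge> 1 \<Longrightarrow> T K > 0"
  unfolding total_weight_def using weight_pos by (intro sum_pos) (auto simp: lessThan_empty_iff)

text \<open>Jensen's inequality for the gap, which is convex in its first two arguments.\<close>

lemma average_gap:
  assumes K: "K \<ge> 1" and x: "x \<in> domf" and y: "y \<in> domh"
  shows "avg_x P inp K \<in> domf" "avg_y P inp K \<in> domh"
    and "rgap (avg_x P inp K) (avg_y P inp K) x y \<le> 1 / T K * Delta P inp x y"
proof -
  define w where "w k = weight P inp k / T K" for k
  have w: "\<And>k. w k \<ge> 0" using weight_pos T_pos[OF K] by (simp add: w_def less_imp_le)
  have w1: "(\<Sum>k<K. w k) = 1" using T_pos[OF K] by (simp add: w_def sum_divide_distrib[symmetric] total_weight_def)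
  have ax: "avg_x P inp K = (\<Sum>k<K. w k *\<^sub>R xs (Suc k))"
    by (simp add: avg_x_def w_def scaleR_sum_right divide_inverse_commute)
  have ay: "avg_y P inp K = (\<Sum>k<K. w k *\<^sub>R ys (Suc k))"
    by (simp add: avg_y_def w_def scaleR_sum_right divide_inverse_commute)
  show "avg_x P inp K \<in> domf" unfolding ax
    by (intro convex_sum convex_domf w w1 iter_dom) auto
  show "avg_y P inp K \<in> domh" unfolding ay
    by (intro convex_sum convex_domh w w1 iter_dom) auto
  have ne: "{..<K} \<noteq> {}" using K by (auto simp: lessThan_empty_iff)
  have f: "fr (avg_x P inp K) \<le> (\<Sum>k<K. w k * fr (xs (Suc k)))" unfolding ax
    by (intro convex_on_sum[OF _ ne closed_convex_fun_convex_on[OF f_closed_convex]] w w1 iter_dom) auto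
  have h: "hr (avg_y P inp K) \<le> (\<Sum>k<K. w k * hr (ys (Suc k)))" unfolding ay
    by (intro convex_on_sum[OF _ ne closed_convex_fun_convex_on[OF h_closed_convex]] w w1 iter_dom) auto
  have \<Phi>x: "Phi P (avg_x P inp K) y \<le> (\<Sum>k<K. w k * Phi P (xs (Suc k)) y)" unfolding ax
    by (intro convex_on_sum[OF _ ne Phi_convex[OF y]] w w1) auto
  have "- Phi P x (avg_y P inp K) \<le> (\<Sum>k<K. w k * - Phi P x (ys (Suc k)))" unfolding ay
    by (intro convex_on_sum[OF _ ne Phi_concave[OF x, unfolded concave_on_def]] w w1) auto
  then have \<Phi>y: "(\<Sum>k<K. w k * Phi P x (ys (Suc k))) \<le> Phi P x (avg_y P inp K)"
    by (simp add: sum_negf)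
  have "(\<Sum>k<K. w k * rgap (xs (Suc k)) (ys (Suc k)) x y)
    = (\<Sum>k<K. w k * fr (xs (Suc k))) + (\<Sum>k<K. w k * Phi P (xs (Suc k)) y)
      + (\<Sum>k<K. w k * hr (ys (Suc k))) - (\<Sum>k<K. w k * Phi P x (ys (Suc k)))
      - (\<Sum>k<K. w k) * (hr y + fr x)"
    unfolding rgap_def sum_distrib_right sum.distrib[symmetric] sum_subtractf[symmetric]
    by (intro sum.cong) (auto simp: algebra_simps)
  then have "rgap (avg_x P inp K) (avg_y P inp K) x y \<le> (\<Sum>k<K. w k * rgap (xs (Suc k)) (ys (Suc k)) x y)"
    using f h \<Phi>x \<Phi>y w1 unfolding rgap_def by simp
  also have "\<dots> = (\<Sum>k<K. \<sigma> k * rgap (xs (Suc k)) (ys (Suc k)) x y) / (\<sigma> 0 * T K)"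
    by (simp add: w_def weight_def sum_divide_distrib)
  also have "\<dots> \<le> V 0 x y / (\<sigma> 0 * T K)"
    using weighted_gap_sum[OF x y, of K] V_nonneg[OF x y, of K] sigma_pos[of 0] T_pos[OF K]
    by (intro divide_right_mono) auto
  also have "\<dots> = 1 / T K * Delta P inp x y"
    using sigma_pos[of 0] by (simp add: V_0)
  finally show "rgap (avg_x P inp K) (avg_y P inp K) x y \<le> 1 / T K * Delta P inp x y" .
qed

lemma Lag_real: "x \<in> domf \<Longrightarrow> y \<in> domh \<Longrightarrow> Lag P x y = ereal (fr x + Phi P x y - hr y)"
  unfolding Lag_def using edom_real[OF f_closed_convex, of x] edom_real[OF h_closed_convex, of y]
  by (metis plus_ereal.simps(1) ereal_minus(1))

lemma gap_real:
  assumes "avg_x P inp K \<in> domf" "avg_y P inp K \<in> domh" "x \<in> domf" "y \<in> domh"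
  shows "gap P inp K x y = ereal (rgap (avg_x P inp K) (avg_y P inp K) x y)"
  using assms by (simp add: gap_def Lag_real rgap_def)

text \<open>Off the domains the gap is \<open>-\<infinity>\<close>; hence the rates hold there whatever the sign of \<open>\<Delta>\<close>.\<close>

lemma gap_outside:
  assumes a: "avg_x P inp K \<in> domf" "avg_y P inp K \<in> domh" and out: "x \<notin> domf \<or> y \<notin> domh"
  shows "gap P inp K x y = - \<infinity>"
proof -
  obtain a where a1: "fun_f P (avg_x P inp K) = ereal a" using edom_real[OF f_closed_convex a(1)] by blast
  obtain b where b1: "fun_h P (avg_y P inp K) = ereal b" using edom_real[OF h_closed_convex a(2)] by blast
  have hm: "fun_h P y \<noteq> - \<infinity>" "fun_f P x \<noteq> - \<infinity>"
    using h_closed_convex f_closed_convex by (auto simp: closed_convex_fun_def)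
  show ?thesis
    using out hm unfolding gap_def Lag_def a1 b1 edom_def
    by (cases "fun_f P x"; cases "fun_h P y") auto
qed

lemma gap_bound:
  assumes K: "K \<ge> 1"
  shows "gap P inp K x y \<le> ereal (1 / T K * Delta P inp x y)"
proof (cases "x \<in> domf \<and> y \<in> domh")
  case True
  then show ?thesis using average_gap[OF K, of x y] by (simp add: gap_real)
next
  case False
  then show ?thesis using gap_outside average_gap(1,2)[OF K start] by auto
qed

subsection \<open>Growth of the weights\<close>

definition c_lower :: real where "c_lower = min_trial * sqrt (gamma0 inp)"
definition c_upper :: real where "c_upper = tau_bar inp * sqrt (gamma0 inp)"

lemma c_lower_pos: "c_lower > 0" and c_upper_pos: "c_upper > 0"
  using min_trial_pos pos by (auto simp: c_lower_def c_upper_def)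

lemma tau_bounds: "c_lower \<le> \<tau> k * sqrt (\<gamma> k)" "\<tau> k * sqrt (\<gamma> k) \<le> c_upper"
proof -
  have sq: "(\<tau> k * sqrt (\<gamma> k))\<^sup>2 = (accepted_tau P inp (apdb P inp k))\<^sup>2 * gamma_cur (apdb P inp k)"
    using gamma_pos[of k] by (simp add: power_mult_distrib) (simp add: step_tau_def step_gamma_def)
  have "c_lower\<^sup>2 \<le> (\<tau> k * sqrt (\<gamma> k))\<^sup>2"
    unfolding sq using accepted_tau_lower[OF invariant_apdb[of k]] pos
    by (simp add: c_lower_def power_mult_distrib)
  then show "c_lower \<le> \<tau> k * sqrt (\<gamma> k)"
    by (rule power2_le_imp_le) (use tau_pos[of k] gamma_pos[of k] in simp)
  have "(\<tau> k * sqrt (\<gamma> k))\<^sup>2 \<le> c_upper\<^sup>2"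
    unfolding sq using accepted_tau_upper[OF invariant_apdb[of k]] pos
    by (simp add: c_upper_def power_mult_distrib)
  then show "\<tau> k * sqrt (\<gamma> k) \<le> c_upper"
    by (rule power2_le_imp_le) (use c_upper_pos in simp)
qed

lemma sigma_bounds: "c_lower * sqrt (\<gamma> k) \<le> \<sigma> k" "\<sigma> k \<le> c_upper * sqrt (\<gamma> k)"
proof -
  have "\<sigma> k = (\<tau> k * sqrt (\<gamma> k)) * sqrt (\<gamma> k)"
    using gamma_pos[of k] by (simp add: step_sigma_def mult.assoc)
  then show "c_lower * sqrt (\<gamma> k) \<le> \<sigma> k" "\<sigma> k \<le> c_upper * sqrt (\<gamma> k)"
    using mult_right_mono[OF tau_bounds(1)[of k], of "sqrt (\<gamma> k)"]
      mult_right_mono[OF tau_bounds(2)[of k], of "sqrt (\<gamma> k)"] gamma_pos[of k] by auto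
qed

lemma T_linear_growth:
  assumes "mu inp = 0"
  shows "\<exists>c>0. \<forall>K\<ge>1. c * real K \<le> T K"
proof -
  let ?c = "c_lower * sqrt (gamma0 inp) / \<sigma> 0"
  have "?c > 0" using c_lower_pos pos sigma_pos by simp
  moreover have "?c * real K \<le> T K" for K
  proof -
    have "(\<Sum>k<K. ?c) \<le> T K" unfolding total_weight_def weight_def
      using sigma_bounds(1) gamma_const[OF assms] sigma_pos[of 0]
      by (intro sum_mono divide_right_mono) (auto intro: less_imp_le)
    then show ?thesis by (simp add: mult.commute)
  qed
  ultimately show ?thesis by blast
qed

text \<open>From \<open>\<gamma>\<^sub>k\<^sub>+\<^sub>1 \<ge> \<gamma>\<^sub>k + \<mu> c \<surd>\<gamma>\<^sub>k\<close> the square root of \<open>\<gamma>\<^sub>k\<close> grows at least linearly.\<close>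

lemma sqrt_gamma_growth:
  assumes "mu inp > 0"
  shows "\<exists>e>0. \<forall>k. e * real (Suc k) \<le> sqrt (\<gamma> k)"
proof -
  \<comment> \<open>Then \<open>(\<surd>\<gamma> + e)\<^sup>2 \<le> \<gamma> + 3 e \<surd>\<gamma> \<le> \<gamma> + \<mu> c \<surd>\<gamma>\<close>, as \<open>e \<le> \<surd>\<gamma>\<close>.\<close>
  define e where "e = min (sqrt (gamma0 inp)) (mu inp * c_lower / 3)"
  have e: "e > 0" "e \<le> sqrt (gamma0 inp)" "3 * e \<le> mu inp * c_lower"
    using assms c_lower_pos pos by (auto simp: e_def)
  have "e * real (Suc k) \<le> sqrt (\<gamma> k)" for k
  proof (induction k)
    case 0
    have "e \<le> sqrt (\<gamma> 0)" using e(2) real_sqrt_le_mono[OF gamma_ge[of 0]] by linarith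
    then show ?case by simp
  next
    case (Suc k)
    let ?g = "sqrt (\<gamma> k)"
    have "e \<le> ?g" using e(2) real_sqrt_le_mono[OF gamma_ge[of k]] by linarith
    then have "e * e \<le> e * ?g" using e by (intro mult_left_mono) auto
    moreover have "3 * e * ?g \<le> mu inp * c_lower * ?g"
      using e gamma_pos[of k] by (intro mult_right_mono) auto
    moreover have "mu inp * (c_lower * ?g) \<le> mu inp * \<sigma> k"
      using sigma_bounds(1)[of k] assms by (intro mult_left_mono) auto
    moreover have "\<gamma> (Suc k) = ?g\<^sup>2 + mu inp * \<sigma> k"
      using gamma_pos[of k] by (simp add: gamma_Suc step_sigma_def algebra_simps)
    ultimately have "(?g + e)\<^sup>2 \<le> \<gamma> (Suc k)" by (simp add: power2_eq_square algebra_simps)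
    then have "?g + e \<le> sqrt (\<gamma> (Suc k))" by (rule real_le_rsqrt)
    then show ?case using Suc by (simp add: algebra_simps)
  qed
  then show ?thesis using e by blast
qed

lemma gamma_quadratic_growth:
  assumes "mu inp > 0"
  shows "\<exists>c>0. \<forall>k. c * (real k)\<^sup>2 \<le> \<gamma> k"
proof -
  obtain e where e: "e > 0" "\<And>k. e * real (Suc k) \<le> sqrt (\<gamma> k)" using sqrt_gamma_growth[OF assms] by blast
  have "e\<^sup>2 * (real k)\<^sup>2 \<le> \<gamma> k" for k
  proof -
    have "e * real k \<le> e * real (Suc k)" using e(1) by simp
    then have "e * real k \<le> sqrt (\<gamma> k)" using e(2)[of k] by linarith
    then have "(e * real k)\<^sup>2 \<le> (sqrt (\<gamma> k))\<^sup>2" using e(1) by (intro power_mono) auto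
    then show ?thesis using gamma_pos[of k] by (simp add: power_mult_distrib)
  qed
  then show ?thesis using e(1) by (intro exI[of _ "e\<^sup>2"]) auto
qed

lemma T_quadratic_growth:
  assumes "mu inp > 0"
  shows "\<exists>c>0. \<forall>K\<ge>1. c * (real K)\<^sup>2 \<le> T K"
proof -
  obtain e where e: "e > 0" "\<And>k. e * real (Suc k) \<le> sqrt (\<gamma> k)" using sqrt_gamma_growth[OF assms] by blast
  let ?c = "c_lower * e / \<sigma> 0"
  have c: "?c > 0" using c_lower_pos e sigma_pos by simp
  have w: "?c * real (Suc k) \<le> weight P inp k" for k
  proof -
    have "c_lower * (e * real (Suc k)) \<le> c_lower * sqrt (\<gamma> k)" using e(2) c_lower_pos by (intro mult_left_mono) auto
    also have "\<dots> \<le> \<sigma> k" by (rule sigma_bounds)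
    finally have "c_lower * (e * real (Suc k)) / \<sigma> 0 \<le> weight P inp k"
      unfolding weight_def using sigma_pos[of 0] by (intro divide_right_mono) auto
    then show ?thesis by (simp only: times_divide_eq_left mult.assoc)
  qed
  have "?c / 2 * (real K)\<^sup>2 \<le> T K" for K
  proof (induction K)
    case (Suc K)
    have "c / 2 * (real (Suc K))\<^sup>2 = c / 2 * (real K)\<^sup>2 + c * (real K + 1 / 2)" for c
      by (simp add: power2_eq_square algebra_simps add_divide_distrib)
    then have "?c / 2 * (real (Suc K))\<^sup>2 = ?c / 2 * (real K)\<^sup>2 + ?c * (real K + 1 / 2)" .
    also have "?c * (real K + 1 / 2) \<le> ?c * real (Suc K)" using c by (intro mult_left_mono) auto
    finally show ?case using Suc w[of K] unfolding total_weight_def by simp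
  qed (simp add: total_weight_def)
  then show ?thesis using c by (intro exI[of _ "?c / 2"]) auto
qed

lemma gap_rate:
  assumes c: "c > 0" "\<And>K. K \<ge> 1 \<Longrightarrow> c * r K \<le> T K" and r: "\<And>K. K \<ge> 1 \<Longrightarrow> r K > 0"
  shows "\<exists>C. \<forall>K\<ge>1. \<forall>x y. gap P inp K x y \<le> ereal (C * Delta P inp x y / r K)"
proof (intro exI[of _ "1 / c"] allI impI)
  fix K :: nat and x y assume K: "1 \<le> K"
  show "gap P inp K x y \<le> ereal (1 / c * Delta P inp x y / r K)"
  proof (cases "x \<in> domf \<and> y \<in> domh")
    case True
    then have "0 \<le> \<sigma> 0 * Delta P inp x y" using V_nonneg[of x y 0] by (simp add: V_0)
    then have D: "0 \<le> Delta P inp x y" using sigma_pos[of 0] by (simp add: zero_le_mult_iff)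
    have "1 / T K * Delta P inp x y \<le> 1 / (c * r K) * Delta P inp x y"
      using c r K T_pos[OF K] D by (intro mult_right_mono divide_left_mono) auto
    also have "\<dots> = 1 / c * Delta P inp x y / r K" by simp
    finally show ?thesis using gap_bound[OF K, of x y] by (meson ereal_less_eq(3) order_trans)
  next
    case False
    then show ?thesis using gap_outside average_gap(1,2)[OF K start] by auto
  qed
qed

end

section \<open>Saddle points and limits of the gap\<close>

lemma closed_convex_fun_eventually_ge:
  assumes F: "closed_convex_fun F" and u: "u \<longlonglongrightarrow> x" "\<And>n. u n \<in> edom F" and x: "x \<in> edom F" and e: "e > 0"
  shows "\<forall>\<^sub>F n in sequentially. real_of_ereal (F x) - e \<le> real_of_ereal (F (u n))"
proof (rule ccontr)
  assume "\<not> ?thesis"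
  then obtain r :: "nat \<Rightarrow> nat" where r: "strict_mono r"
    "\<And>n. \<not> real_of_ereal (F x) - e \<le> real_of_ereal (F (u (r n)))"
    using not_eventually_sequentiallyD[of "\<lambda>n. real_of_ereal (F x) - e \<le> real_of_ereal (F (u n))"] by auto
  have "F (u (r n)) \<le> ereal (real_of_ereal (F x) - e)" for n
  proof -
    have "real_of_ereal (F (u (r n))) \<le> real_of_ereal (F x) - e" using r(2)[of n] by linarith
    then show ?thesis using edom_real[OF F u(2)[of "r n"]] by (metis ereal_less_eq(3))
  qed
  from closed_convex_fun_lsc[OF F LIMSEQ_subseq_LIMSEQ[OF u(1) r(1), unfolded o_def] tendsto_const this]
  have "F x \<le> ereal (real_of_ereal (F x) - e)" .
  then have "real_of_ereal (F x) \<le> real_of_ereal (F x) - e"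
    using edom_real[OF F x] by (metis ereal_less_eq(3))
  then show False using e by simp
qed

lemma null_comparison:
  fixes f :: "nat \<Rightarrow> 'c::real_normed_vector"
  assumes "g \<longlonglongrightarrow> 0" "\<And>n. norm (f n) \<le> g n"
  shows "f \<longlonglongrightarrow> 0"
  using Lim_null_comparison[OF always_eventually assms(1), of f] assms(2) by blast

lemma null_sequence_mult_bounded:
  fixes f g :: "nat \<Rightarrow> real"
  assumes "f \<longlonglongrightarrow> 0" "\<And>n. \<bar>g n\<bar> \<le> B"
  shows "(\<lambda>n. f n * g n) \<longlonglongrightarrow> 0"
proof (rule null_comparison)
  show "(\<lambda>n. B * \<bar>f n\<bar>) \<longlonglongrightarrow> 0" using tendsto_mult[OF tendsto_const[of B] tendsto_rabs[OF assms(1)]] by simp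
  show "norm (f n * g n) \<le> B * \<bar>f n\<bar>" for n
    using mult_left_mono[OF assms(2)[of n] abs_ge_zero[of "f n"]] by (simp add: abs_mult mult.commute)
qed

context apdb_setting
begin

lemma rgap_antisym: "rgap a b x y = - rgap x y a b"
  by (simp add: rgap_def)

lemma Lag_outside_y: "x \<in> domf \<Longrightarrow> y \<notin> domh \<Longrightarrow> Lag P x y = - \<infinity>"
  unfolding Lag_def using edom_real[OF f_closed_convex, of x] h_closed_convex
  by (cases "fun_h P y"; cases "fun_f P x") (auto simp: edom_def closed_convex_fun_def)

lemma Lag_outside_x: "x \<notin> domf \<Longrightarrow> Lag P x y = \<infinity>"
  unfolding Lag_def using h_closed_convex
  by (cases "fun_h P y") (auto simp: edom_def closed_convex_fun_def)

lemma saddle_point_iff: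
  "saddle_point P a b \<longleftrightarrow> a \<in> domf \<and> b \<in> domh \<and> (\<forall>x\<in>domf. \<forall>y\<in>domh. rgap a b x y \<le> 0)"
proof
  assume s: "saddle_point P a b"
  then have 1: "Lag P a y \<le> Lag P a b" and 2: "Lag P a b \<le> Lag P x b" for x y
    by (auto simp: saddle_point_def)
  have a: "a \<in> domf"
  proof (rule ccontr)
    assume "a \<notin> domf"
    then have "Lag P (x_init inp) b = \<infinity>" using 2[of "x_init inp"] by (simp add: Lag_outside_x)
    then show False using Lag_real[OF start(1), of b] Lag_outside_y[OF start(1), of b] by (cases "b \<in> domh") auto
  qed
  have b: "b \<in> domh"
  proof (rule ccontr)
    assume "b \<notin> domh"
    then show False using 1[of "y_init inp"] by (simp add: Lag_outside_y a Lag_real start)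
  qed
  have "rgap a b x y \<le> 0" if "x \<in> domf" "y \<in> domh" for x y
    using order_trans[OF 1[of y] 2[of x]] that a b by (simp add: Lag_real rgap_def)
  with a b show "a \<in> domf \<and> b \<in> domh \<and> (\<forall>x\<in>domf. \<forall>y\<in>domh. rgap a b x y \<le> 0)" by blast
next
  assume h: "a \<in> domf \<and> b \<in> domh \<and> (\<forall>x\<in>domf. \<forall>y\<in>domh. rgap a b x y \<le> 0)"
  have "Lag P a y \<le> Lag P a b" for y
  proof (cases "y \<in> domh")
    case True
    then have "rgap a b a y \<le> 0" using h by blast
    then show ?thesis using h True by (simp add: Lag_real rgap_def)
  qed (use h in \<open>simp add: Lag_outside_y\<close>)
  moreover have "Lag P a b \<le> Lag P x b" for x
  proof (cases "x \<in> domf")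
    case True
    then have "rgap a b x b \<le> 0" using h by blast
    then show ?thesis using h True by (simp add: Lag_real rgap_def)
  qed (use h in \<open>simp add: Lag_outside_x\<close>)
  ultimately show "saddle_point P a b" by (simp add: saddle_point_def)
qed

lemma saddle_dom: "saddle_point P a b \<Longrightarrow> a \<in> domf" "saddle_point P a b \<Longrightarrow> b \<in> domh"
  by (auto simp: saddle_point_iff)

lemma saddle_rgap_nonneg:
  assumes "saddle_point P a b" "x \<in> domf" "y \<in> domh"
  shows "0 \<le> rgap x y a b"
  using assms rgap_antisym[of x y a b] by (auto simp: saddle_point_iff)

lemma Phi_tendsto:
  assumes "u \<longlonglongrightarrow> x" "v \<longlonglongrightarrow> y"
  shows "(\<lambda>n. Phi P (u n) (v n)) \<longlonglongrightarrow> Phi P x y"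
proof -
  have "isCont (\<lambda>(x, y). Phi P x y) (x, y)"
    using Phi_continuous by (simp add: continuous_on_eq_continuous_at)
  from isCont_tendsto_compose[OF this tendsto_Pair[OF assms]] show ?thesis by simp
qed

text \<open>A bounded gap bounds \<open>f(u\<^sub>n) + h(v\<^sub>n)\<close> from above. Each summand is bounded from below on a
  bounded sequence, so each is bounded from above, and closedness puts the limits into the domains.\<close>

lemma limit_in_dom:
  assumes u: "u \<longlonglongrightarrow> xl" "\<And>n. u n \<in> domf" and v: "v \<longlonglongrightarrow> yl" "\<And>n. v n \<in> domh"
    and M: "\<And>n. rgap (u n) (v n) a b \<le> M"
  shows "xl \<in> domf" "yl \<in> domh"
proof -
  have bounded: "\<exists>K. \<forall>n. norm (w n) \<le> K" if "w \<longlonglongrightarrow> l" for w :: "nat \<Rightarrow> 'c::real_normed_vector" and l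
    using convergent_imp_Bseq[OF convergentI[OF that]] unfolding Bseq_def by blast
  obtain Ku where Ku: "\<And>n. norm (u n) \<le> Ku" using bounded[OF u(1)] by blast
  obtain Kv where Kv: "\<And>n. norm (v n) \<le> Kv" using bounded[OF v(1)] by blast
  obtain mf where "\<And>x. norm x \<le> Ku \<Longrightarrow> ereal mf \<le> fun_f P x"
    using closed_convex_fun_bounded_below[OF finite_dim_X f_closed_convex, of Ku] by blast
  then have mf: "mf \<le> fr (u n)" for n
    using Ku edom_real[OF f_closed_convex u(2)[of n]] by (metis ereal_less_eq(3))
  obtain mh where "\<And>y. norm y \<le> Kv \<Longrightarrow> ereal mh \<le> fun_h P y"
    using closed_convex_fun_bounded_below[OF finite_dim_Y h_closed_convex, of Kv] by blast
  then have mh: "mh \<le> hr (v n)" for n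
    using Kv edom_real[OF h_closed_convex v(2)[of n]] by (metis ereal_less_eq(3))
  have "(\<lambda>n. Phi P a (v n) - Phi P (u n) b) \<longlonglongrightarrow> Phi P a yl - Phi P xl b"
    by (intro tendsto_intros Phi_tendsto u v)
  from bounded[OF this] obtain K\<Phi> where K\<Phi>: "\<And>n. norm (Phi P a (v n) - Phi P (u n) b) \<le> K\<Phi>" by blast
  have sum: "fr (u n) + hr (v n) \<le> M + K\<Phi> + hr b + fr a" for n
    using M[of n] K\<Phi>[of n] unfolding rgap_def real_norm_def abs_le_iff by linarith
  have "fun_f P (u n) \<le> ereal (M + K\<Phi> + hr b + fr a - mh)" for n
  proof -
    have "fr (u n) \<le> M + K\<Phi> + hr b + fr a - mh" using sum[of n] mh[of n] by linarith
    then show ?thesis using edom_real[OF f_closed_convex u(2)[of n]] by (metis ereal_less_eq(3))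
  qed
  from closed_convex_fun_lsc[OF f_closed_convex u(1) tendsto_const this] show "xl \<in> domf" by (rule edomI)
  have "fun_h P (v n) \<le> ereal (M + K\<Phi> + hr b + fr a - mf)" for n
  proof -
    have "hr (v n) \<le> M + K\<Phi> + hr b + fr a - mf" using sum[of n] mf[of n] by linarith
    then show ?thesis using edom_real[OF h_closed_convex v(2)[of n]] by (metis ereal_less_eq(3))
  qed
  from closed_convex_fun_lsc[OF h_closed_convex v(1) tendsto_const this] show "yl \<in> domh" by (rule edomI)
qed

text \<open>Lower semicontinuity of the gap in its first two arguments.\<close>

lemma rgap_limit_le:
  assumes u: "u \<longlonglongrightarrow> xl" "\<And>n. u n \<in> domf" "xl \<in> domf" and v: "v \<longlonglongrightarrow> yl" "\<And>n. v n \<in> domh" "yl \<in> domh"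
    and c: "c \<longlonglongrightarrow> c0" "\<And>n. rgap (u n) (v n) x y \<le> c n"
  shows "rgap xl yl x y \<le> c0"
proof (rule field_le_epsilon)
  fix e :: real assume e: "e > 0"
  let ?l = "\<lambda>n. (fr xl - e / 2 + Phi P (u n) y - hr y) - (fr x + Phi P x (v n) - (hr yl - e / 2))"
  have "?l \<longlonglongrightarrow> (fr xl - e / 2 + Phi P xl y - hr y) - (fr x + Phi P x yl - (hr yl - e / 2))"
    by (intro tendsto_intros Phi_tendsto u v)
  moreover have "\<forall>\<^sub>F n in sequentially. ?l n \<le> c n"
    using closed_convex_fun_eventually_ge[OF f_closed_convex u half_gt_zero[OF e]]
      closed_convex_fun_eventually_ge[OF h_closed_convex v half_gt_zero[OF e]]
  proof eventually_elim
    case (elim n)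
    then show ?case using c(2)[of n] unfolding rgap_def by linarith
  qed
  ultimately have "(fr xl - e / 2 + Phi P xl y - hr y) - (fr x + Phi P x yl - (hr yl - e / 2)) \<le> c0"
    using tendsto_le[OF sequentially_bot c(1)] by blast
  then show "rgap xl yl x y \<le> c0 + e" unfolding rgap_def by linarith
qed

section \<open>Convergence of the iterates\<close>

lemma V_Suc_le:
  assumes "saddle_point P a b"
  shows "V (Suc k) a b \<le> V k a b"
  using iteration_inequality_without_gain[OF saddle_dom[OF assms], of k]
    mult_nonneg_nonneg[OF less_imp_le[OF sigma_pos[of k]] saddle_rgap_nonneg[OF assms iter_dom]] by smt

lemma V_antimono: "saddle_point P a b \<Longrightarrow> decseq (\<lambda>k. V k a b)"
  by (intro decseq_SucI V_Suc_le)

lemma saddle_distance_bound: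
  assumes s: "saddle_point P a b"
  shows "\<gamma> K * DX P a (xs K) + (1 - (ca + cb)) * DY P b (ys K) \<le> \<sigma> 0 * Delta P inp a b"
  using V_lower_bound[OF saddle_dom(2)[OF s], of K a] decseqD[OF V_antimono[OF s], of 0 K] V_0[of a b]
  by simp

lemma gamma_mono: "\<gamma> k \<le> \<gamma> (Suc k)"
  using mult_left_mono[of 1 "1 + mu inp * \<tau> k" "\<gamma> k"] gamma_pos[of k] tau_pos[of k] mu_nonneg
  by (simp add: gamma_Suc)

text \<open>The scaled form of the distance bound: \<open>\<surd>\<gamma>\<^sub>K \<parallel>x - x\<^sub>K\<parallel>\<close> stays bounded, so \<open>x\<^sub>K \<rightarrow> x\<close> when \<open>\<gamma>\<^sub>K \<rightarrow> \<infinity>\<close>.\<close>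

lemma saddle_x_distance:
  assumes s: "saddle_point P a b"
  shows "sqrt (\<gamma> K) * norm (a - xs K) \<le> sqrt (2 * V 0 a b)"
proof (rule real_le_rsqrt)
  have "0 \<le> (1 - (ca + cb)) * DY P b (ys K)"
    using coeff_sum_le coeffs DY_nonneg[OF saddle_dom(2)[OF s] iter_dom(2)] by (intro mult_nonneg_nonneg) auto
  then have "\<gamma> K * DX P a (xs K) \<le> V 0 a b"
    using saddle_distance_bound[OF s, of K] V_0[of a b] by linarith
  moreover have "\<gamma> K * (1 / 2 * (norm (a - xs K))\<^sup>2) \<le> \<gamma> K * DX P a (xs K)"
    using gamma_pos[of K] bregman_lower_bound[OF dgf_X saddle_dom(1)[OF s] iter_dom(1)]
    by (intro mult_left_mono) auto
  moreover have "(sqrt (\<gamma> K) * norm (a - xs K))\<^sup>2 = 2 * (\<gamma> K * (1 / 2 * (norm (a - xs K))\<^sup>2))"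
    using gamma_pos[of K] by (simp add: power_mult_distrib)
  ultimately show "(sqrt (\<gamma> K) * norm (a - xs K))\<^sup>2 \<le> 2 * V 0 a b" by linarith
qed

lemma x_bounded:
  assumes s: "saddle_point P a b"
  shows "norm (xs K) \<le> norm a + sqrt (2 * V 0 a b) / sqrt (gamma0 inp)"
proof -
  have "sqrt (gamma0 inp) * norm (a - xs K) \<le> sqrt (\<gamma> K) * norm (a - xs K)"
    using gamma_ge[of K] by (intro mult_right_mono) auto
  then have "sqrt (gamma0 inp) * norm (a - xs K) \<le> sqrt (2 * V 0 a b)"
    using saddle_x_distance[OF s, of K] by linarith
  then have "norm (a - xs K) \<le> sqrt (2 * V 0 a b) / sqrt (gamma0 inp)"
    using pos by (simp add: pos_le_divide_eq mult.commute)
  then show ?thesis using norm_triangle_sub[of "xs K" a] by (simp add: norm_minus_commute)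
qed

definition jump :: "nat \<Rightarrow> 'b \<Rightarrow>\<^sub>L real" where "jump k = grady_jump (apdb P inp k)"
definition cost :: "nat \<Rightarrow> real" where "cost k = jump_cost (apdb P inp k)"
definition \<rho> :: "nat \<Rightarrow> real" where "\<rho> k = sigma_prev (apdb P inp k)"

lemma V_eq: "V k x y = \<gamma> k * DX P x (xs k) + DY P y (ys k) - \<rho> k * blinfun_apply (jump k) (y - ys k)
    + (\<rho> k)\<^sup>2 * cost k"
  by (simp add: V_def potential_def jump_def cost_def \<rho>_def step_gamma_def iter_x_def iter_y_def)

lemma rho_Suc: "\<rho> (Suc k) = \<sigma> k"
  by (simp add: \<rho>_def apdb_step_def Let_def step_sigma_def step_gamma_def step_tau_def sigma_of_def)

lemma rho_pos: "\<rho> k > 0"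
  using admissible_apdb[of k] by (simp add: \<rho>_def admissible_def)

lemma cost_nonneg: "cost k \<ge> 0"
  using coeffs by (simp add: cost_def jump_cost_def)

lemma jump_0: "jump 0 = 0"
  by (simp add: jump_def grady_jump_def apdb_start_def)

lemma prev_Suc: "x_prev (apdb P inp (Suc k)) = xs k" "y_prev (apdb P inp (Suc k)) = ys k"
  by (simp_all add: apdb_step_def Let_def iter_x_def iter_y_def)

lemma jump_Suc: "jump (Suc k) = grady P (xs (Suc k)) (ys (Suc k)) - grady P (xs k) (ys k)"
  unfolding jump_def grady_jump_def prev_Suc by (simp only: iter_x_def iter_y_def)

lemma cost_Suc: "cost (Suc k) = (norm (grady P (xs (Suc k)) (ys (Suc k)) - grady P (xs k) (ys (Suc k))))\<^sup>2 / (2 * ca)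
     + (norm (grady P (xs k) (ys (Suc k)) - grady P (xs k) (ys k)))\<^sup>2 / (2 * cb)"
  unfolding cost_def jump_cost_def prev_Suc by (simp only: iter_x_def iter_y_def)

lemma norm_jump_Suc: "norm (jump (Suc k)) \<le> Lyy * norm (ys (Suc k) - ys k) + Lyx * norm (xs (Suc k) - xs k)"
  unfolding jump_Suc by (intro grady_Lipschitz iter_dom)

lemma cost_Suc_le:
  "cost (Suc k) \<le> Lyx\<^sup>2 / (2 * ca) * (norm (xs (Suc k) - xs k))\<^sup>2 + Lyy\<^sup>2 / (2 * cb) * (norm (ys (Suc k) - ys k))\<^sup>2"
proof -
  have 1: "(norm (grady P (xs (Suc k)) (ys (Suc k)) - grady P (xs k) (ys (Suc k))))\<^sup>2
      \<le> (Lyx * norm (xs (Suc k) - xs k))\<^sup>2"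
    using grady_Lipschitz[OF iter_dom(1)[of "Suc k"] iter_dom(1)[of k] iter_dom(2)[of "Suc k"] iter_dom(2)[of "Suc k"]]
    by (intro power_mono) auto
  have 2: "(norm (grady P (xs k) (ys (Suc k)) - grady P (xs k) (ys k)))\<^sup>2
      \<le> (Lyy * norm (ys (Suc k) - ys k))\<^sup>2"
    using grady_Lipschitz[OF iter_dom(1)[of k] iter_dom(1)[of k] iter_dom(2)[of "Suc k"] iter_dom(2)[of k]]
    by (intro power_mono) auto
  have "cost (Suc k) \<le> (Lyx * norm (xs (Suc k) - xs k))\<^sup>2 / (2 * ca) + (Lyy * norm (ys (Suc k) - ys k))\<^sup>2 / (2 * cb)"
    unfolding cost_Suc using 1 2 coeffs by (intro add_mono divide_right_mono) auto
  then show ?thesis by (simp add: power_mult_distrib)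
qed

text \<open>If \<open>c\<^sub>\<alpha> = 1\<close>, the distance bound says nothing about the dual iterates. Here they are bounded because
  the momentum term of the potential is at most \<open>\<sigma>\<^sub>k\<^sub>-\<^sub>1 \<parallel>q\<^sub>k\<parallel> \<parallel>y - y\<^sub>k\<parallel>\<close>, hence linear in the distance, while
  \<open>D\<^sub>Y\<close> is quadratic. The factor \<open>\<sigma>\<^sub>k\<^sub>-\<^sub>1 \<parallel>q\<^sub>k\<parallel>\<close> is bounded: for \<open>L\<^sub>y\<^sub>y = 0\<close> the jump is controlled by the
  primal step, \<open>\<sigma>\<^sub>k\<close> is of the order of \<open>\<surd>\<gamma>\<^sub>k\<close>, and \<open>\<surd>\<gamma>\<^sub>k \<parallel>x - x\<^sub>k\<parallel>\<close> is bounded.\<close>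

lemma y_bounded_if_Lyy_zero:
  assumes s: "saddle_point P a b" and Lyy: "Lyy = 0"
  shows "\<exists>M. \<forall>K. norm (ys K) \<le> M"
proof -
  define R where "R = sqrt (2 * V 0 a b)"
  define S where "S = c_upper * (Lyx * (2 * R))"
  have V0: "V 0 a b \<ge> 0" by (rule V_nonneg[OF saddle_dom[OF s]])
  have R: "R \<ge> 0" using V0 by (simp add: R_def)
  have S0: "S \<ge> 0" using R c_upper_pos Lyx_pos by (simp add: S_def)
  have S: "\<rho> K * norm (jump K) \<le> S" for K
  proof (cases K)
    case 0
    then show ?thesis using S0 by (simp add: jump_0)
  next
    case (Suc k)
    have "sqrt (\<gamma> k) * norm (xs (Suc k) - xs k) \<le> sqrt (\<gamma> k) * (norm (a - xs (Suc k)) + norm (a - xs k))"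
      using norm_triangle_ineq4[of "a - xs k" "a - xs (Suc k)"] gamma_pos[of k]
      by (intro mult_left_mono) auto
    also have "\<dots> \<le> sqrt (\<gamma> (Suc k)) * norm (a - xs (Suc k)) + sqrt (\<gamma> k) * norm (a - xs k)"
      using gamma_mono[of k] by (simp add: distrib_left mult_right_mono)
    also have "\<dots> \<le> 2 * R" using saddle_x_distance[OF s, of "Suc k"] saddle_x_distance[OF s, of k]
      unfolding R_def by linarith
    finally have 1: "sqrt (\<gamma> k) * norm (xs (Suc k) - xs k) \<le> 2 * R" .
    have "\<rho> K * norm (jump K) \<le> (c_upper * sqrt (\<gamma> k)) * (Lyx * norm (xs (Suc k) - xs k))"
      unfolding Suc rho_Suc using norm_jump_Suc[of k] sigma_bounds(2)[of k] sigma_pos[of k] c_upper_pos gamma_pos[of k] Lyx_pos Lyy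
      by (intro mult_mono) auto
    also have "\<dots> = c_upper * (Lyx * (sqrt (\<gamma> k) * norm (xs (Suc k) - xs k)))" by simp
    also have "\<dots> \<le> S" unfolding S_def using 1 c_upper_pos Lyx_pos by (intro mult_left_mono) auto
    finally show ?thesis .
  qed
  have "norm (b - ys K) \<le> max 1 (2 * (S + V 0 a b))" for K
  proof (cases "norm (b - ys K) \<le> 1")
    case False
    let ?N = "norm (b - ys K)"
    have "0 \<le> \<gamma> K * DX P a (xs K)"
      using gamma_pos[of K] DX_nonneg[OF saddle_dom(1)[OF s] iter_dom(1)] by simp
    moreover have "0 \<le> (\<rho> K)\<^sup>2 * cost K" using cost_nonneg by simp
    moreover have "1 / 2 * ?N\<^sup>2 \<le> DY P b (ys K)"
      by (rule bregman_lower_bound[OF dgf_Y saddle_dom(2)[OF s] iter_dom(2)])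
    moreover have "\<rho> K * blinfun_apply (jump K) (b - ys K) \<le> S * ?N"
    proof -
      have "blinfun_apply (jump K) (b - ys K) \<le> norm (jump K) * ?N"
        using norm_blinfun[of "jump K" "b - ys K"] by (simp add: abs_le_iff)
      then have "\<rho> K * blinfun_apply (jump K) (b - ys K) \<le> \<rho> K * (norm (jump K) * ?N)"
        using rho_pos[of K] by (intro mult_left_mono) auto
      also have "\<dots> \<le> S * ?N" using S[of K] by (simp add: mult.assoc[symmetric] mult_right_mono)
      finally show ?thesis .
    qed
    moreover have "V K a b \<le> V 0 a b" using decseqD[OF V_antimono[OF s], of 0 K] by simp
    ultimately have "1 / 2 * ?N\<^sup>2 \<le> S * ?N + V 0 a b" unfolding V_eq[of K] by linarith
    also have "\<dots> \<le> S * ?N + V 0 a b * ?N" using mult_left_mono[of 1 ?N "V 0 a b"] False V0 by simp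
    finally have "?N * ?N \<le> 2 * (S + V 0 a b) * ?N" by (simp add: power2_eq_square algebra_simps)
    then have "?N \<le> 2 * (S + V 0 a b)" by (rule mult_right_le_imp_le) (use False in linarith)
    then show ?thesis by simp
  qed simp
  then have "norm (ys K) \<le> norm b + max 1 (2 * (S + V 0 a b))" for K
    using norm_triangle_sub[of "ys K" b] by (smt (verit) norm_minus_commute)
  then show ?thesis by blast
qed

lemma y_bounded_if_delta_pos:
  assumes s: "saddle_point P a b" and \<delta>: "delta inp > 0"
  shows "\<exists>M. \<forall>K. norm (ys K) \<le> M"
proof -
  let ?c = "1 - (ca + cb)"
  have c: "?c > 0" using coeff_sum_le \<delta> by simp
  have "norm (b - ys K) \<le> sqrt (2 * V 0 a b / ?c)" for K
  proof (rule real_le_rsqrt)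
    have "0 \<le> \<gamma> K * DX P a (xs K)"
      using gamma_pos[of K] DX_nonneg[OF saddle_dom(1)[OF s] iter_dom(1)] by simp
    then have "?c * DY P b (ys K) \<le> V 0 a b" using saddle_distance_bound[OF s, of K] V_0[of a b] by linarith
    then have "DY P b (ys K) \<le> V 0 a b / ?c" using c by (simp add: pos_le_divide_eq mult.commute)
    then have "1 / 2 * (norm (b - ys K))\<^sup>2 \<le> V 0 a b / ?c"
      using bregman_lower_bound[OF dgf_Y saddle_dom(2)[OF s] iter_dom(2)] order_trans by blast
    then show "(norm (b - ys K))\<^sup>2 \<le> 2 * V 0 a b / ?c" by (simp add: mult.commute)
  qed
  then have "norm (ys K) \<le> norm b + sqrt (2 * V 0 a b / ?c)" for K
    using norm_triangle_sub[of "ys K" b] by (smt (verit) norm_minus_commute)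
  then show ?thesis by blast
qed

text \<open>With \<open>\<delta> > 0\<close> each iteration gains a multiple of the squared steps, so these are summable.\<close>

lemma steps_vanish:
  assumes s: "saddle_point P a b" and \<delta>: "delta inp > 0"
  shows "(\<lambda>k. sqrt (\<gamma> k) * norm (xs (Suc k) - xs k)) \<longlonglongrightarrow> 0"
    and "(\<lambda>k. norm (xs (Suc k) - xs k)) \<longlonglongrightarrow> 0"
    and "(\<lambda>k. norm (ys (Suc k) - ys k)) \<longlonglongrightarrow> 0"
proof -
  define d where "d k = \<gamma> k * DX P (xs (Suc k)) (xs k) + DY P (ys (Suc k)) (ys k)" for k
  have dX: "0 \<le> \<gamma> k * DX P (xs (Suc k)) (xs k)" for k
    using gamma_pos[of k] DX_nonneg[OF iter_dom(1) iter_dom(1)] by simp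
  have dY: "0 \<le> DY P (ys (Suc k)) (ys k)" for k by (intro DY_nonneg iter_dom)
  have d0: "0 \<le> d k" for k using dX dY by (simp add: d_def)
  have gain: "delta inp * d k \<le> V k a b - V (Suc k) a b" for k
    using iteration_inequality[OF saddle_dom[OF s], of k]
      mult_nonneg_nonneg[OF less_imp_le[OF sigma_pos[of k]] saddle_rgap_nonneg[OF s iter_dom, of "Suc k" "Suc k"]]
    unfolding d_def by linarith
  have "(\<Sum>k<n. delta inp * d k) \<le> V 0 a b - V n a b" for n
  proof (induction n)
    case (Suc n)
    then show ?case using gain[of n] by simp
  qed simp
  then have "(\<Sum>k<n. delta inp * d k) \<le> V 0 a b" for n
    using V_nonneg[OF saddle_dom[OF s], of n] by (smt (verit))
  then have "summable (\<lambda>k. delta inp * d k)"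
    using d0 \<delta> by (intro summableI_nonneg_bounded) auto
  then have "d \<longlonglongrightarrow> 0" using summable_LIMSEQ_zero[of d] \<delta> by (simp add: summable_cmult_iff)
  then have lim: "(\<lambda>k. sqrt (2 * d k)) \<longlonglongrightarrow> 0"
    using tendsto_real_sqrt[OF tendsto_mult[OF tendsto_const[of 2]]] by fastforce
  have x: "sqrt (\<gamma> k) * norm (xs (Suc k) - xs k) \<le> sqrt (2 * d k)" for k
  proof (rule real_le_rsqrt)
    have "\<gamma> k * (1 / 2 * (norm (xs (Suc k) - xs k))\<^sup>2) \<le> \<gamma> k * DX P (xs (Suc k)) (xs k)"
      using gamma_pos[of k] bregman_lower_bound[OF dgf_X iter_dom(1) iter_dom(1)]
      by (intro mult_left_mono) auto
    from add_increasing2[OF dY[of k] this]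
    have "2 * (\<gamma> k * (1 / 2 * (norm (xs (Suc k) - xs k))\<^sup>2)) \<le> 2 * d k" by (simp add: d_def)
    then show "(sqrt (\<gamma> k) * norm (xs (Suc k) - xs k))\<^sup>2 \<le> 2 * d k"
      using gamma_pos[of k] by (simp add: power_mult_distrib)
  qed
  have y: "norm (ys (Suc k) - ys k) \<le> sqrt (2 * d k)" for k
  proof (rule real_le_rsqrt)
    have "1 / 2 * (norm (ys (Suc k) - ys k))\<^sup>2 \<le> DY P (ys (Suc k)) (ys k)"
      by (intro bregman_lower_bound[OF dgf_Y] iter_dom)
    then show "(norm (ys (Suc k) - ys k))\<^sup>2 \<le> 2 * d k" using dX[of k] by (simp add: d_def)
  qed
  show 1: "(\<lambda>k. sqrt (\<gamma> k) * norm (xs (Suc k) - xs k)) \<longlonglongrightarrow> 0"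
    by (rule null_comparison[OF lim]) (use x gamma_pos in \<open>simp add: abs_mult less_imp_le\<close>)
  show "(\<lambda>k. norm (ys (Suc k) - ys k)) \<longlonglongrightarrow> 0"
    by (rule null_comparison[OF lim]) (use y in simp)
  have lim': "(\<lambda>k. sqrt (\<gamma> k) * norm (xs (Suc k) - xs k) / sqrt (gamma0 inp)) \<longlonglongrightarrow> 0"
    using tendsto_divide[OF 1 tendsto_const[of "sqrt (gamma0 inp)"]] pos by simp
  have "norm (xs (Suc k) - xs k) \<le> sqrt (\<gamma> k) * norm (xs (Suc k) - xs k) / sqrt (gamma0 inp)" for k
    using pos gamma_ge[of k] mult_right_mono[of "sqrt (gamma0 inp)" "sqrt (\<gamma> k)" "norm (xs (Suc k) - xs k)"]
    by (simp add: pos_le_divide_eq mult.commute)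
  then show "(\<lambda>k. norm (xs (Suc k) - xs k)) \<longlonglongrightarrow> 0"
    by (intro null_comparison[OF lim']) simp
qed

text \<open>The cost involves \<open>\<surd>\<gamma>\<^sub>k \<parallel>y\<^sub>k\<^sub>+\<^sub>1 - y\<^sub>k\<parallel>\<^sup>2\<close> only with the factor \<open>L\<^sub>y\<^sub>y\<close>, which is zero unless \<open>\<gamma>\<close> is
  constant.\<close>

lemma momentum_vanishes:
  assumes s: "saddle_point P a b" and \<delta>: "delta inp > 0"
  shows "(\<lambda>k. norm (jump k)) \<longlonglongrightarrow> 0" and "(\<lambda>k. \<rho> k * cost k) \<longlonglongrightarrow> 0"
proof -
  note st = steps_vanish[OF s \<delta>]
  have "(\<lambda>k. Lyy * norm (ys (Suc k) - ys k) + Lyx * norm (xs (Suc k) - xs k)) \<longlonglongrightarrow> Lyy * 0 + Lyx * 0"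
    by (intro tendsto_intros st)
  then have jl: "(\<lambda>k. Lyy * norm (ys (Suc k) - ys k) + Lyx * norm (xs (Suc k) - xs k)) \<longlonglongrightarrow> 0" by simp
  have "(\<lambda>k. norm (jump (Suc k))) \<longlonglongrightarrow> 0"
    by (rule null_comparison[OF jl]) (use norm_jump_Suc in simp)
  then show "(\<lambda>k. norm (jump k)) \<longlonglongrightarrow> 0" by (rule LIMSEQ_imp_Suc)
  let ?A = "\<lambda>k. Lyx\<^sup>2 / (2 * ca) * (sqrt (\<gamma> k) * norm (xs (Suc k) - xs k) * norm (xs (Suc k) - xs k))"
  let ?B = "\<lambda>k. Lyy\<^sup>2 / (2 * cb) * (sqrt (gamma0 inp) * (norm (ys (Suc k) - ys k))\<^sup>2)"
  have "(\<lambda>k. c_upper * (?A k + ?B k)) \<longlonglongrightarrow> c_upper * (Lyx\<^sup>2 / (2 * ca) * (0 * 0) + Lyy\<^sup>2 / (2 * cb) * (sqrt (gamma0 inp) * 0\<^sup>2))"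
    by (intro tendsto_intros st)
  then have lim: "(\<lambda>k. c_upper * (?A k + ?B k)) \<longlonglongrightarrow> 0" by simp
  have "\<rho> (Suc k) * cost (Suc k) \<le> c_upper * (?A k + ?B k)" for k
  proof -
    have "\<rho> (Suc k) * cost (Suc k) \<le> (c_upper * sqrt (\<gamma> k)) * cost (Suc k)"
      unfolding rho_Suc by (intro mult_right_mono sigma_bounds cost_nonneg)
    also have "\<dots> \<le> (c_upper * sqrt (\<gamma> k)) * (Lyx\<^sup>2 / (2 * ca) * (norm (xs (Suc k) - xs k))\<^sup>2
        + Lyy\<^sup>2 / (2 * cb) * (norm (ys (Suc k) - ys k))\<^sup>2)"
      using c_upper_pos gamma_pos[of k] by (intro mult_left_mono cost_Suc_le) auto
    also have "\<dots> = c_upper * (?A k + Lyy\<^sup>2 / (2 * cb) * (sqrt (\<gamma> k) * (norm (ys (Suc k) - ys k))\<^sup>2))"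
      by (simp add: power2_eq_square[of "norm _"] distrib_left mult_ac)
    also have "\<dots> = c_upper * (?A k + ?B k)"
    proof (cases "Lyy = 0")
      case False
      then have "mu inp = 0" using mu_zero_if_Lyy_pos Lyy_nonneg by simp
      then show ?thesis by (simp add: gamma_const)
    qed simp
    finally show ?thesis .
  qed
  then have "(\<lambda>k. \<rho> (Suc k) * cost (Suc k)) \<longlonglongrightarrow> 0"
    by (intro null_comparison[OF lim]) (simp add: abs_mult cost_nonneg less_imp_le[OF rho_pos])
  then show "(\<lambda>k. \<rho> k * cost k) \<longlonglongrightarrow> 0" by (rule LIMSEQ_imp_Suc)
qed

lemma rho_ratio: "\<rho> k / \<sigma> k \<le> max (\<rho> 0 / \<sigma> 0) (c_upper / c_lower)"
proof (cases k)
  case (Suc n)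
  have g: "sqrt (\<gamma> n) > 0" using gamma_pos by simp
  have "\<rho> k / \<sigma> k \<le> (c_upper * sqrt (\<gamma> n)) / (c_lower * sqrt (\<gamma> (Suc n)))"
    unfolding Suc rho_Suc using sigma_bounds(2)[of n] sigma_bounds(1)[of "Suc n"] c_lower_pos c_upper_pos g gamma_pos sigma_pos[of n]
    by (intro frac_le) auto
  also have "\<dots> \<le> (c_upper * sqrt (\<gamma> n)) / (c_lower * sqrt (\<gamma> n))"
  proof (rule divide_left_mono)
    show "c_lower * sqrt (\<gamma> n) \<le> c_lower * sqrt (\<gamma> (Suc n))"
      using gamma_mono[of n] c_lower_pos by (intro mult_left_mono) auto
  qed (use g gamma_pos c_lower_pos c_upper_pos in \<open>auto intro!: mult_nonneg_nonneg less_imp_le\<close>)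
  also have "\<dots> = c_upper / c_lower" using g by simp
  finally show ?thesis by simp
qed simp

text \<open>For \<open>\<mu> > 0\<close> the factor \<open>1 / \<tau>\<^sub>k\<close> grows like \<open>\<surd>\<gamma>\<^sub>k\<close>; the vanishing of
  \<open>\<surd>\<gamma>\<^sub>k \<parallel>x\<^sub>k\<^sub>+\<^sub>1 - x\<^sub>k\<parallel>\<close> compensates it, since \<open>D\<^sub>X\<close> is then quadratic.\<close>

lemma primal_distance_difference:
  assumes s: "saddle_point P a b" and \<delta>: "delta inp > 0" and r: "strict_mono r"
    and u: "(\<lambda>n. xs (r n)) \<longlonglongrightarrow> xl" "(\<lambda>n. xs (Suc (r n))) \<longlonglongrightarrow> xl" "xl \<in> domf"
  shows "(\<lambda>n. (DX P x (xs (r n)) - DX P x (xs (Suc (r n)))) * (1 / \<tau> (r n))) \<longlonglongrightarrow> 0"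
proof (cases "mu inp = 0")
  case True
  have "(\<lambda>n. DX P x (xs (r n)) - DX P x (xs (Suc (r n)))) \<longlonglongrightarrow> DX P x xl - DX P x xl"
    by (intro tendsto_intros bregman_tendsto_second[OF dgf_X] u iter_dom)
  then have "(\<lambda>n. DX P x (xs (r n)) - DX P x (xs (Suc (r n)))) \<longlonglongrightarrow> 0" by simp
  moreover have "\<bar>1 / \<tau> k\<bar> \<le> sqrt (gamma0 inp) / c_lower" for k
    using tau_bounds(1)[of k] tau_pos[of k] c_lower_pos gamma_const[OF True, of k]
    by (simp add: field_simps)
  ultimately show ?thesis by (rule null_sequence_mult_bounded)
next
  case False
  then have \<mu>: "mu inp > 0" using mu_nonneg by simp
  let ?g = "\<lambda>n. 1 / (2 * c_lower) * ((sqrt (\<gamma> (r n)) * norm (xs (Suc (r n)) - xs (r n)))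
      * (norm (x - xs (r n)) + norm (x - xs (Suc (r n)))))"
  have "(\<lambda>n. sqrt (\<gamma> (r n)) * norm (xs (Suc (r n)) - xs (r n))) \<longlonglongrightarrow> 0"
    using LIMSEQ_subseq_LIMSEQ[OF steps_vanish(1)[OF s \<delta>] r] by (simp add: o_def)
  then have "?g \<longlonglongrightarrow> 1 / (2 * c_lower) * (0 * (norm (x - xl) + norm (x - xl)))"
    by (intro tendsto_intros u)
  then have lim: "?g \<longlonglongrightarrow> 0" by simp
  have "norm ((DX P x (xs k) - DX P x (xs (Suc k))) * (1 / \<tau> k))
      \<le> 1 / (2 * c_lower) * ((sqrt (\<gamma> k) * norm (xs (Suc k) - xs k)) * (norm (x - xs k) + norm (x - xs (Suc k))))" for k
  proof -
    let ?p = "norm (x - xs k)" and ?q = "norm (x - xs (Suc k))"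
    have "DX P x (xs k) - DX P x (xs (Suc k)) = 1 / 2 * ((?p - ?q) * (?p + ?q))"
      unfolding bregman_X[OF \<mu>] by (simp add: power2_eq_square algebra_simps)
    moreover have "\<bar>1 / 2 * ((?p - ?q) * (?p + ?q))\<bar> = 1 / 2 * (\<bar>?p - ?q\<bar> * (?p + ?q))"
      by (simp add: abs_mult)
    ultimately have "\<bar>DX P x (xs k) - DX P x (xs (Suc k))\<bar> = 1 / 2 * (\<bar>?p - ?q\<bar> * (?p + ?q))"
      by (simp only:)
    also have "\<dots> \<le> 1 / 2 * (norm (xs (Suc k) - xs k) * (?p + ?q))"
      using norm_triangle_ineq3[of "x - xs k" "x - xs (Suc k)"] by (intro mult_left_mono mult_right_mono) auto
    finally have 1: "\<bar>DX P x (xs k) - DX P x (xs (Suc k))\<bar> \<le> 1 / 2 * (norm (xs (Suc k) - xs k) * (?p + ?q))" .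
    have 2: "1 / \<tau> k \<le> sqrt (\<gamma> k) / c_lower"
      using tau_bounds(1)[of k] tau_pos[of k] c_lower_pos by (simp add: field_simps)
    have "norm ((DX P x (xs k) - DX P x (xs (Suc k))) * (1 / \<tau> k))
        = \<bar>DX P x (xs k) - DX P x (xs (Suc k))\<bar> * (1 / \<tau> k)"
      using tau_pos[of k] by (simp add: abs_mult)
    also have "\<dots> \<le> (1 / 2 * (norm (xs (Suc k) - xs k) * (?p + ?q))) * (sqrt (\<gamma> k) / c_lower)"
      using tau_pos[of k] by (intro mult_mono 1 2) auto
    finally show ?thesis by (simp add: mult_ac)
  qed
  then show ?thesis by (rule null_comparison[OF lim])
qed

text \<open>Divide the iteration inequality by \<open>\<sigma>\<^sub>k\<close>. The right-hand side is at most a sum of five terms that all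
  tend to zero along the subsequence; the monotonicity of \<open>\<gamma>\<close> and the cost of the new jump only help.\<close>

lemma limit_point_is_saddle:
  assumes s: "saddle_point P a b" and \<delta>: "delta inp > 0" and r: "strict_mono r"
    and u: "(\<lambda>n. xs (r n)) \<longlonglongrightarrow> xl" and v: "(\<lambda>n. ys (r n)) \<longlonglongrightarrow> yl"
  shows "saddle_point P xl yl"
proof -
  note st = steps_vanish[OF s \<delta>]
  have sub: "(\<lambda>n. f (r n)) \<longlonglongrightarrow> l" if "f \<longlonglongrightarrow> l" for f :: "nat \<Rightarrow> real" and l
    using LIMSEQ_subseq_LIMSEQ[OF that r] by (simp add: o_def)
  have "(\<lambda>n. (xs (Suc (r n)) - xs (r n)) + xs (r n)) \<longlonglongrightarrow> 0 + xl"
    by (intro tendsto_add u tendsto_norm_zero_cancel[OF sub[OF st(2)]])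
  then have u': "(\<lambda>n. xs (Suc (r n))) \<longlonglongrightarrow> xl" by simp
  have "(\<lambda>n. (ys (Suc (r n)) - ys (r n)) + ys (r n)) \<longlonglongrightarrow> 0 + yl"
    by (intro tendsto_add v tendsto_norm_zero_cancel[OF sub[OF st(3)]])
  then have v': "(\<lambda>n. ys (Suc (r n))) \<longlonglongrightarrow> yl" by simp
  have sig: "1 / \<sigma> k \<le> 1 / (c_lower * sqrt (gamma0 inp))" for k
  proof -
    have "c_lower * sqrt (gamma0 inp) \<le> c_lower * sqrt (\<gamma> k)" using c_lower_pos gamma_ge[of k] by (intro mult_left_mono) auto
    then have "c_lower * sqrt (gamma0 inp) \<le> \<sigma> k" using sigma_bounds(1)[of k] by linarith
    then show ?thesis using c_lower_pos pos by (intro divide_left_mono) (auto simp: sigma_pos)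
  qed
  have "rgap (xs (Suc k)) (ys (Suc k)) a b \<le> V 0 a b * (1 / (c_lower * sqrt (gamma0 inp)))" for k
  proof -
    have "\<sigma> k * rgap (xs (Suc k)) (ys (Suc k)) a b \<le> V 0 a b"
      using iteration_inequality_without_gain[OF saddle_dom[OF s], of k] V_nonneg[OF saddle_dom[OF s], of "Suc k"]
        decseqD[OF V_antimono[OF s], of 0 k] by simp
    then have "rgap (xs (Suc k)) (ys (Suc k)) a b \<le> V 0 a b * (1 / \<sigma> k)"
      using sigma_pos[of k] by (simp add: pos_le_divide_eq mult.commute)
    also have "\<dots> \<le> V 0 a b * (1 / (c_lower * sqrt (gamma0 inp)))"
      by (intro mult_left_mono sig V_nonneg saddle_dom[OF s])
    finally show ?thesis .
  qed
  from limit_in_dom[OF u' iter_dom(1) v' iter_dom(2) this] have l: "xl \<in> domf" "yl \<in> domh" .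
  have "rgap xl yl x y \<le> 0" if x: "x \<in> domf" and y: "y \<in> domh" for x y
  proof (rule rgap_limit_le[OF u' iter_dom(1) l(1) v' iter_dom(2) l(2)])
    define c where "c k = (DX P x (xs k) - DX P x (xs (Suc k))) * (1 / \<tau> k)
        + (DY P y (ys k) - DY P y (ys (Suc k))) * (1 / \<sigma> k)
        + norm (jump k) * norm (y - ys k) * (\<rho> k / \<sigma> k)
        + norm (jump (Suc k)) * norm (y - ys (Suc k))
        + \<rho> k * cost k * (\<rho> k / \<sigma> k)" for k
    have ratio: "\<bar>\<rho> k / \<sigma> k\<bar> \<le> max (\<rho> 0 / \<sigma> 0) (c_upper / c_lower)" for k
      using rho_ratio[of k] rho_pos[of k] sigma_pos[of k] by simp
    have "(\<lambda>n. DY P y (ys (r n)) - DY P y (ys (Suc (r n)))) \<longlonglongrightarrow> DY P y yl - DY P y yl"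
      by (intro tendsto_intros bregman_tendsto_second[OF dgf_Y] v v' l iter_dom)
    then have "(\<lambda>n. DY P y (ys (r n)) - DY P y (ys (Suc (r n)))) \<longlonglongrightarrow> 0" by simp
    then have c2: "(\<lambda>n. (DY P y (ys (r n)) - DY P y (ys (Suc (r n)))) * (1 / \<sigma> (r n))) \<longlonglongrightarrow> 0"
      by (rule null_sequence_mult_bounded) (use sig sigma_pos in \<open>simp add: less_imp_le\<close>)
    have "(\<lambda>n. norm (jump (r n)) * norm (y - ys (r n))) \<longlonglongrightarrow> 0 * norm (y - yl)"
      by (intro tendsto_intros v sub[OF momentum_vanishes(1)[OF s \<delta>]])
    then have "(\<lambda>n. norm (jump (r n)) * norm (y - ys (r n))) \<longlonglongrightarrow> 0" by simp
    then have c3: "(\<lambda>n. norm (jump (r n)) * norm (y - ys (r n)) * (\<rho> (r n) / \<sigma> (r n))) \<longlonglongrightarrow> 0"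
      by (rule null_sequence_mult_bounded[OF _ ratio])
    have "(\<lambda>n. norm (jump (Suc (r n))) * norm (y - ys (Suc (r n)))) \<longlonglongrightarrow> 0 * norm (y - yl)"
      by (intro tendsto_intros v' sub[OF LIMSEQ_Suc[OF momentum_vanishes(1)[OF s \<delta>]]])
    then have c4: "(\<lambda>n. norm (jump (Suc (r n))) * norm (y - ys (Suc (r n)))) \<longlonglongrightarrow> 0" by simp
    have c5: "(\<lambda>n. \<rho> (r n) * cost (r n) * (\<rho> (r n) / \<sigma> (r n))) \<longlonglongrightarrow> 0"
      by (rule null_sequence_mult_bounded[OF sub[OF momentum_vanishes(2)[OF s \<delta>]] ratio])
    have "(\<lambda>n. c (r n)) \<longlonglongrightarrow> 0 + 0 + 0 + 0 + 0"
      unfolding c_def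
      by (intro tendsto_add primal_distance_difference[OF s \<delta> r u u' l(1)] c2 c3 c4 c5)
    then show "(\<lambda>n. c (r n)) \<longlonglongrightarrow> 0" by simp
    show "rgap (xs (Suc (r n))) (ys (Suc (r n))) x y \<le> c (r n)" for n
    proof -
      define k where "k = r n"
      have j: "- blinfun_apply (jump k) (y - ys k) \<le> norm (jump k) * norm (y - ys k)"
        using norm_blinfun[of "jump k" "y - ys k"] by (simp add: abs_le_iff)
      have j': "blinfun_apply (jump (Suc k)) (y - ys (Suc k)) \<le> norm (jump (Suc k)) * norm (y - ys (Suc k))"
        using norm_blinfun[of "jump (Suc k)" "y - ys (Suc k)"] by (simp add: abs_le_iff)
      have 1: "\<rho> k * - blinfun_apply (jump k) (y - ys k) \<le> \<rho> k * (norm (jump k) * norm (y - ys k))"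
        using j rho_pos[of k] by (intro mult_left_mono) auto
      have 2: "\<sigma> k * blinfun_apply (jump (Suc k)) (y - ys (Suc k))
          \<le> \<sigma> k * (norm (jump (Suc k)) * norm (y - ys (Suc k)))"
        using j' sigma_pos[of k] by (intro mult_left_mono) auto
      have 3: "\<gamma> k * DX P x (xs (Suc k)) \<le> \<gamma> (Suc k) * DX P x (xs (Suc k))"
        using gamma_mono[of k] DX_nonneg[OF x iter_dom(1)] by (intro mult_right_mono) auto
      have 4: "0 \<le> (\<sigma> k)\<^sup>2 * cost (Suc k)" using cost_nonneg by simp
      have "\<sigma> k * rgap (xs (Suc k)) (ys (Suc k)) x y \<le> V k x y - V (Suc k) x y"
        by (rule iteration_inequality_without_gain[OF x y])
      also have "\<dots> \<le> (\<gamma> k * DX P x (xs k) - \<gamma> k * DX P x (xs (Suc k))) + (DY P y (ys k) - DY P y (ys (Suc k)))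
          + \<rho> k * (norm (jump k) * norm (y - ys k)) + \<sigma> k * (norm (jump (Suc k)) * norm (y - ys (Suc k)))
          + (\<rho> k)\<^sup>2 * cost k"
        using 1 2 3 4 unfolding V_eq rho_Suc by linarith
      also have "\<dots> = \<sigma> k * c k"
      proof -
        have e1: "\<sigma> k * (d * (1 / \<tau> k)) = \<gamma> k * d" for d using tau_pos[of k] by (simp add: step_sigma_def)
        have e2: "\<sigma> k * (d * (1 / \<sigma> k)) = d" for d using sigma_pos[of k] by simp
        have e3: "\<sigma> k * (d * (\<rho> k / \<sigma> k)) = \<rho> k * d" for d using sigma_pos[of k] by simp
        show ?thesis unfolding c_def distrib_left e1 e2 e3
          by (simp add: right_diff_distrib power2_eq_square mult.assoc)
      qed
      finally show ?thesis using sigma_pos[of k] unfolding k_def by simp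
    qed
  qed
  with l show ?thesis by (simp add: saddle_point_iff)
qed

text \<open>The potential at the limit point is monotone, so its convergence to zero along one subsequence
  extends to the whole sequence; there it dominates the squared distances.\<close>

lemma iterates_converge:
  assumes s: "saddle_point P a b" and \<delta>: "delta inp > 0" and \<mu>: "mu inp = 0"
  shows "\<exists>xl yl. saddle_point P xl yl \<and> (\<lambda>k. (xs k, ys k)) \<longlonglongrightarrow> (xl, yl)"
proof -
  obtain xl r1 where r1: "strict_mono r1" "(xs \<circ> r1) \<longlonglongrightarrow> xl"
    using finite_dimensional_convergent_subseq[OF finite_dim_X x_bounded[OF s]] .
  obtain M where M: "\<And>K. norm (ys K) \<le> M" using y_bounded_if_delta_pos[OF s \<delta>] by blast
  have "norm ((ys \<circ> r1) n) \<le> M" for n using M by simp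
  from finite_dimensional_convergent_subseq[OF finite_dim_Y this]
  obtain yl r2 where r2: "strict_mono r2" "((ys \<circ> r1) \<circ> r2) \<longlonglongrightarrow> yl" .
  define r where "r = r1 \<circ> r2"
  have r: "strict_mono r" using r1 r2 by (simp add: r_def strict_mono_o)
  have u: "(\<lambda>n. xs (r n)) \<longlonglongrightarrow> xl" using LIMSEQ_subseq_LIMSEQ[OF r1(2) r2(1)] by (simp add: r_def o_def)
  have v: "(\<lambda>n. ys (r n)) \<longlonglongrightarrow> yl" using r2(2) by (simp add: r_def o_def)
  have sl: "saddle_point P xl yl" by (rule limit_point_is_saddle[OF s \<delta> r u v])
  note l = saddle_dom[OF sl]
  have sub: "(\<lambda>n. f (r n)) \<longlonglongrightarrow> l" if "f \<longlonglongrightarrow> l" for f :: "nat \<Rightarrow> real" and l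
    using LIMSEQ_subseq_LIMSEQ[OF that r] by (simp add: o_def)
  define B where "B = max (\<rho> 0) (c_upper * sqrt (gamma0 inp))"
  have B: "\<bar>\<rho> k\<bar> \<le> B" for k
  proof (cases k)
    case (Suc n)
    then show ?thesis
      using sigma_bounds(2)[of n] gamma_const[OF \<mu>, of n] sigma_pos[of n] by (simp add: rho_Suc B_def)
  qed (use rho_pos[of 0] in \<open>simp add: B_def\<close>)
  have Vr: "(\<lambda>n. V (r n) xl yl) \<longlonglongrightarrow> 0"
  proof -
    have dx: "(\<lambda>n. gamma0 inp * DX P xl (xs (r n)) + DY P yl (ys (r n))) \<longlonglongrightarrow> gamma0 inp * DX P xl xl + DY P yl yl"
      by (intro tendsto_intros bregman_tendsto_second[OF dgf_X] bregman_tendsto_second[OF dgf_Y] u v l iter_dom)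
    have j: "(\<lambda>n. blinfun_apply (jump (r n)) (yl - ys (r n))) \<longlonglongrightarrow> 0"
    proof (rule null_comparison)
      show "(\<lambda>n. norm (jump (r n)) * norm (yl - ys (r n))) \<longlonglongrightarrow> 0"
        using tendsto_mult[OF sub[OF momentum_vanishes(1)[OF s \<delta>]] tendsto_norm[OF tendsto_diff[OF tendsto_const[of yl] v]]]
        by simp
    qed (rule norm_blinfun)
    have "(\<lambda>n. gamma0 inp * DX P xl (xs (r n)) + DY P yl (ys (r n))
        - blinfun_apply (jump (r n)) (yl - ys (r n)) * \<rho> (r n) + \<rho> (r n) * cost (r n) * \<rho> (r n))
        \<longlonglongrightarrow> (gamma0 inp * DX P xl xl + DY P yl yl) - 0 + 0"
      by (intro tendsto_add tendsto_diff dx null_sequence_mult_bounded[OF j B]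
          null_sequence_mult_bounded[OF sub[OF momentum_vanishes(2)[OF s \<delta>]] B])
    then show ?thesis unfolding V_eq gamma_const[OF \<mu>] by (simp add: power2_eq_square mult_ac)
  qed
  have V0: "(\<lambda>k. V k xl yl) \<longlonglongrightarrow> 0"
  proof (rule LIMSEQ_I)
    fix e :: real assume "e > 0"
    from LIMSEQ_D[OF Vr this] obtain n where n: "norm (V (r n) xl yl - 0) < e" by blast
    show "\<exists>k0. \<forall>k\<ge>k0. norm (V k xl yl - 0) < e"
    proof (intro exI[of _ "r n"] allI impI)
      fix k assume "r n \<le> k"
      then show "norm (V k xl yl - 0) < e"
        using decseqD[OF V_antimono[OF sl], of "r n" k] V_nonneg[OF l, of k] n by simp
    qed
  qed
  let ?c = "1 - (ca + cb)"
  have c: "?c > 0" using coeff_sum_le \<delta> by simp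
  have dxn: "gamma0 inp * (1 / 2 * (norm (xs k - xl))\<^sup>2) + ?c * (1 / 2 * (norm (ys k - yl))\<^sup>2) \<le> V k xl yl" for k
  proof -
    have "gamma0 inp * (1 / 2 * (norm (xl - xs k))\<^sup>2) \<le> gamma0 inp * DX P xl (xs k)"
      using pos by (intro mult_left_mono bregman_lower_bound[OF dgf_X] l iter_dom) auto
    moreover have "?c * (1 / 2 * (norm (yl - ys k))\<^sup>2) \<le> ?c * DY P yl (ys k)"
      using c by (intro mult_left_mono bregman_lower_bound[OF dgf_Y] l iter_dom) auto
    ultimately show ?thesis using V_lower_bound[OF l(2), of k xl] gamma_const[OF \<mu>, of k]
      by (simp add: norm_minus_commute)
  qed
  have x: "norm (xs k - xl) \<le> sqrt (2 / gamma0 inp * V k xl yl)" for k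
  proof (rule real_le_rsqrt)
    have "0 \<le> ?c * (1 / 2 * (norm (ys k - yl))\<^sup>2)" using c by simp
    then have "gamma0 inp * (1 / 2 * (norm (xs k - xl))\<^sup>2) \<le> V k xl yl" using dxn[of k] by linarith
    then show "(norm (xs k - xl))\<^sup>2 \<le> 2 / gamma0 inp * V k xl yl" using pos by (simp add: field_simps)
  qed
  have y: "norm (ys k - yl) \<le> sqrt (2 / ?c * V k xl yl)" for k
  proof (rule real_le_rsqrt)
    have "0 \<le> gamma0 inp * (1 / 2 * (norm (xs k - xl))\<^sup>2)" using pos by simp
    then have "?c * (1 / 2 * (norm (ys k - yl))\<^sup>2) \<le> V k xl yl" using dxn[of k] by linarith
    then show "(norm (ys k - yl))\<^sup>2 \<le> 2 / ?c * V k xl yl"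
      using c by (simp only: times_divide_eq_left pos_le_divide_eq) (simp add: mult.commute)
  qed
  have lim: "(\<lambda>k. sqrt (C * V k xl yl)) \<longlonglongrightarrow> 0" for C
    using tendsto_real_sqrt[OF tendsto_mult[OF tendsto_const[of C] V0]] by simp
  have "xs \<longlonglongrightarrow> xl"
    by (rule LIM_zero_cancel, rule null_comparison[OF lim x])
  moreover have "ys \<longlonglongrightarrow> yl"
    by (rule LIM_zero_cancel, rule null_comparison[OF lim y])
  ultimately have "(\<lambda>k. (xs k, ys k)) \<longlonglongrightarrow> (xl, yl)" by (rule tendsto_Pair)
  with sl show ?thesis by blast
qed

lemma primal_iterates_converge:
  assumes s: "saddle_point P a b" and \<mu>: "mu inp > 0"
  shows "xs \<longlonglongrightarrow> a"
proof -
  obtain e where e: "e > 0" "\<And>k. e * real (Suc k) \<le> sqrt (\<gamma> k)" using sqrt_gamma_growth[OF \<mu>] by blast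
  let ?R = "sqrt (2 * V 0 a b)"
  have "norm (xs k - a) \<le> ?R / e * inverse (real (Suc k))" for k
  proof -
    have "e * real (Suc k) * norm (a - xs k) \<le> sqrt (\<gamma> k) * norm (a - xs k)"
      using e(2) by (intro mult_right_mono) auto
    also have "\<dots> \<le> ?R" by (rule saddle_x_distance[OF s])
    finally have "norm (a - xs k) \<le> ?R / (e * real (Suc k))"
      using e(1) by (simp only: pos_le_divide_eq mult_pos_pos of_nat_0_less_iff zero_less_Suc mult.commute)
    then show ?thesis by (simp add: norm_minus_commute divide_inverse mult.assoc)
  qed
  moreover have "(\<lambda>k. ?R / e * inverse (real (Suc k))) \<longlonglongrightarrow> 0"
    using tendsto_mult[OF tendsto_const[of "?R / e"] LIMSEQ_inverse_real_of_nat] by simp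
  ultimately have "(\<lambda>k. xs k - a) \<longlonglongrightarrow> 0" by (rule null_comparison[rotated])
  then show ?thesis by (rule LIM_zero_cancel)
qed

end

theorem theorem2p7:
  fixes P :: "('a::real_normed_vector, 'b::real_normed_vector) spp"
    and inp :: "('a, 'b) apdb_input"
    and Lxx Lyx Lyy \<Psi> :: real
  assumes standing: "standing_assumptions P (mu inp) Lxx Lyx Lyy"
    and start: "x_init inp \<in> edom (fun_f P)" "y_init inp \<in> edom (fun_h P)"
    and pos: "tau_bar inp > 0" "gamma0 inp > 0"
    and eta: "eta inp \<in> {0<..<1}"
    and coeffs: "delta inp \<in> {0..<1}" "c_alpha inp > 0" "c_beta inp \<ge> 0"
    and params: "params_I inp Lyy \<or> params_II inp Lyy"
    and Psi: "\<Psi> = (if Lyy = 0 then Psi1 inp Lyx Lxx else min (Psi1 inp Lyx Lxx) (Psi2 inp Lyy))"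
  shows
    "(\<Psi> > 0 \<and>
      (\<forall>k. let s = apdb P inp k; \<tau> = trial_step inp s; n = shrinks P inp s in
         (\<exists>j. accepts P inp s (\<tau> j)) \<and>
         (\<forall>j\<le>n. (\<exists>!y. is_arg_min (y_objective P s (\<tau> j)) (\<lambda>_. True) y) \<and>
                 (\<exists>!x. is_arg_min (x_objective P s (\<tau> j)) (\<lambda>_. True) x)) \<and>
         real n \<le> max 0 (1 + log (1 / eta inp) (tau_bar inp / \<Psi>)) \<and>
         1 + n \<le> 1 + nat \<lceil>log (1 / eta inp) (tau_bar inp / \<Psi>)\<rceil>) \<and>
      (\<forall>K\<ge>1. \<forall>x y. gap P inp K x y \<le> ereal (1 / total_weight P inp K * Delta P inp x y)))
     \<and>
     (params_I inp Lyy \<longrightarrow>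
        total_weight P inp \<in> \<Omega>(\<lambda>K. real K) \<and>
        (\<exists>C. \<forall>K\<ge>1. \<forall>x y. gap P inp K x y \<le> ereal (C * Delta P inp x y / real K)) \<and>
        ((\<exists>x y. saddle_point P x y) \<and> delta inp > 0 \<longrightarrow>
           (\<exists>xs ys. saddle_point P xs ys \<and>
              (\<lambda>k. (iter_x P inp k, iter_y P inp k)) \<longlonglongrightarrow> (xs, ys) \<and>
              (\<forall>K. gamma0 inp * DX P xs (iter_x P inp K)
                     + (1 - (c_alpha inp + c_beta inp)) * DY P ys (iter_y P inp K)
                   \<le> step_sigma P inp 0 * Delta P inp xs ys))))
     \<and>
     (params_II inp Lyy \<longrightarrow>
        total_weight P inp \<in> \<Omega>(\<lambda>K. (real K)\<^sup>2) \<and>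
        (\<exists>C. \<forall>K\<ge>1. \<forall>x y. gap P inp K x y \<le> ereal (C * Delta P inp x y / (real K)\<^sup>2)) \<and>
        ((\<exists>x y. saddle_point P x y) \<longrightarrow>
           (\<exists>xs. (\<forall>x y. saddle_point P x y \<longrightarrow> x = xs) \<and>
              iter_x P inp \<longlonglongrightarrow> xs \<and>
              (\<exists>ys. is_limit_point (iter_y P inp) ys) \<and>
              (delta inp > 0 \<longrightarrow>
                 step_gamma P inp \<in> \<Omega>(\<lambda>K. (real K)\<^sup>2) \<and>
                 (\<forall>xl yl. is_limit_point (\<lambda>k. (iter_x P inp k, iter_y P inp k)) (xl, yl) \<longrightarrow>
                    saddle_point P xl yl \<and>
                    (\<exists>C. \<forall>K\<ge>1. 0 \<le> gap P inp K xl yl \<and>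
                                 gap P inp K xl yl \<le> ereal (C / (real K)\<^sup>2)) \<and>
                    (\<forall>K. step_gamma P inp K * DX P xl (iter_x P inp K)
                           + (1 - c_alpha inp) * DY P yl (iter_y P inp K)
                         \<le> step_sigma P inp 0 * Delta P inp xl yl))))))"
proof -
  interpret standing_assumptions P "mu inp" Lxx Lyx Lyy by (rule standing)
  interpret apdb_setting P inp Lxx Lyx Lyy
    using start pos eta coeffs params by unfold_locales
  have \<Psi>: "\<Psi> = threshold" unfolding Psi threshold_def ..
  show ?thesis
  proof (intro conjI impI)
    show "\<Psi> > 0" unfolding \<Psi> by (rule threshold_pos)
    show "\<forall>k. let s = apdb P inp k; \<tau> = trial_step inp s; n = shrinks P inp s in
         (\<exists>j. accepts P inp s (\<tau> j)) \<and>
         (\<forall>j\<le>n. (\<exists>!y. is_arg_min (y_objective P s (\<tau> j)) (\<lambda>_. True) y) \<and>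
                 (\<exists>!x. is_arg_min (x_objective P s (\<tau> j)) (\<lambda>_. True) x)) \<and>
         real n \<le> max 0 (1 + log (1 / eta inp) (tau_bar inp / \<Psi>)) \<and>
         1 + n \<le> 1 + nat \<lceil>log (1 / eta inp) (tau_bar inp / \<Psi>)\<rceil>"
      unfolding \<Psi> by (intro allI backtracking_well_defined)
    show "\<forall>K\<ge>1. \<forall>x y. gap P inp K x y \<le> ereal (1 / total_weight P inp K * Delta P inp x y)"
      using gap_bound by blast
  next
    assume "params_I inp Lyy"
    then have \<mu>: "mu inp = 0" by (simp add: params_I_def)
    obtain c where c: "c > 0" "\<And>K. K \<ge> 1 \<Longrightarrow> c * real K \<le> T K" using T_linear_growth[OF \<mu>] by blast
    show "total_weight P inp \<in> \<Omega>(\<lambda>K. real K)"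
      by (rule bigomega_of_lower_bound[OF c]) simp_all
    show "\<exists>C. \<forall>K\<ge>1. \<forall>x y. gap P inp K x y \<le> ereal (C * Delta P inp x y / real K)"
      by (rule gap_rate[OF c]) simp_all
    assume "(\<exists>x y. saddle_point P x y) \<and> delta inp > 0"
    then obtain xl yl where l: "saddle_point P xl yl" "(\<lambda>k. (xs k, ys k)) \<longlonglongrightarrow> (xl, yl)"
      using iterates_converge \<mu> by blast
    show "\<exists>xs ys. saddle_point P xs ys \<and>
              (\<lambda>k. (iter_x P inp k, iter_y P inp k)) \<longlonglongrightarrow> (xs, ys) \<and>
              (\<forall>K. gamma0 inp * DX P xs (iter_x P inp K)
                     + (1 - (c_alpha inp + c_beta inp)) * DY P ys (iter_y P inp K)
                   \<le> step_sigma P inp 0 * Delta P inp xs ys)"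
      using l saddle_distance_bound[OF l(1)] unfolding gamma_const[OF \<mu>] by blast
  next
    assume II: "params_II inp Lyy"
    then have \<mu>: "mu inp > 0" and Lyy: "Lyy = 0" and cb: "c_beta inp = 0" by (auto simp: params_II_def)
    obtain c where c: "c > 0" "\<And>K. K \<ge> 1 \<Longrightarrow> c * (real K)\<^sup>2 \<le> T K" using T_quadratic_growth[OF \<mu>] by blast
    show "total_weight P inp \<in> \<Omega>(\<lambda>K. (real K)\<^sup>2)"
      by (rule bigomega_of_lower_bound[OF c]) simp_all
    show rate: "\<exists>C. \<forall>K\<ge>1. \<forall>x y. gap P inp K x y \<le> ereal (C * Delta P inp x y / (real K)\<^sup>2)"
      by (rule gap_rate[OF c]) simp_all
    assume "\<exists>x y. saddle_point P x y"
    then obtain a b where s: "saddle_point P a b" by blast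
    have lim: "xs \<longlonglongrightarrow> x" if "saddle_point P x y" for x y
      by (rule primal_iterates_converge[OF that \<mu>])
    have uniq: "\<forall>x y. saddle_point P x y \<longrightarrow> x = a"
      using LIMSEQ_unique[OF lim lim[OF s]] by blast
    obtain M where M: "\<And>K. norm (ys K) \<le> M" using y_bounded_if_Lyy_zero[OF s Lyy] by blast
    obtain yl r where "strict_mono r" "(ys \<circ> r) \<longlonglongrightarrow> yl"
      using finite_dimensional_convergent_subseq[OF finite_dim_Y M] .
    then have yl: "\<exists>ys. is_limit_point (iter_y P inp) ys" unfolding is_limit_point_def by blast
    have growth: "step_gamma P inp \<in> \<Omega>(\<lambda>K. (real K)\<^sup>2)"
    proof -
      obtain c where c: "c > 0" "\<And>k. c * (real k)\<^sup>2 \<le> \<gamma> k" using gamma_quadratic_growth[OF \<mu>] by blast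
      show ?thesis by (rule bigomega_of_lower_bound[OF c(1)]) (use c(2) in simp_all)
    qed
    have limit: "saddle_point P xl yl \<and>
        (\<exists>C. \<forall>K\<ge>1. 0 \<le> gap P inp K xl yl \<and> gap P inp K xl yl \<le> ereal (C / (real K)\<^sup>2)) \<and>
        (\<forall>K. step_gamma P inp K * DX P xl (iter_x P inp K)
            + (1 - c_alpha inp) * DY P yl (iter_y P inp K) \<le> step_sigma P inp 0 * Delta P inp xl yl)"
      if \<delta>: "delta inp > 0" and lp: "is_limit_point (\<lambda>k. (iter_x P inp k, iter_y P inp k)) (xl, yl)" for xl yl
    proof (intro conjI)
      obtain r where r: "strict_mono r" "((\<lambda>k. (xs k, ys k)) \<circ> r) \<longlonglongrightarrow> (xl, yl)"
        using lp unfolding is_limit_point_def by blast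
      have "(\<lambda>n. xs (r n)) \<longlonglongrightarrow> xl" "(\<lambda>n. ys (r n)) \<longlonglongrightarrow> yl"
        using tendsto_fst[OF r(2)] tendsto_snd[OF r(2)] by (simp_all add: o_def)
      then show sl: "saddle_point P xl yl" by (rule limit_point_is_saddle[OF s \<delta> r(1)])
      show "\<forall>K. step_gamma P inp K * DX P xl (iter_x P inp K)
            + (1 - c_alpha inp) * DY P yl (iter_y P inp K) \<le> step_sigma P inp 0 * Delta P inp xl yl"
        using saddle_distance_bound[OF sl] cb by simp
      obtain C where "\<forall>K\<ge>1. \<forall>x y. gap P inp K x y \<le> ereal (C * Delta P inp x y / (real K)\<^sup>2)"
        using rate by blast
      then have "\<forall>K\<ge>1. gap P inp K xl yl \<le> ereal ((C * Delta P inp xl yl) / (real K)\<^sup>2)" by blast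
      moreover have "0 \<le> gap P inp K xl yl" if K: "K \<ge> 1" for K
        using saddle_rgap_nonneg[OF sl average_gap(1,2)[OF K start]] average_gap(1,2)[OF K start] saddle_dom[OF sl]
        by (simp add: gap_real)
      ultimately show "\<exists>C. \<forall>K\<ge>1. 0 \<le> gap P inp K xl yl \<and> gap P inp K xl yl \<le> ereal (C / (real K)\<^sup>2)" by blast
    qed
    show "\<exists>xs. (\<forall>x y. saddle_point P x y \<longrightarrow> x = xs) \<and>
              iter_x P inp \<longlonglongrightarrow> xs \<and>
              (\<exists>ys. is_limit_point (iter_y P inp) ys) \<and>
              (delta inp > 0 \<longrightarrow>
                 step_gamma P inp \<in> \<Omega>(\<lambda>K. (real K)\<^sup>2) \<and>
                 (\<forall>xl yl. is_limit_point (\<lambda>k. (iter_x P inp k, iter_y P inp k)) (xl, yl) \<longrightarrow>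
                    saddle_point P xl yl \<and>
                    (\<exists>C. \<forall>K\<ge>1. 0 \<le> gap P inp K xl yl \<and>
                                 gap P inp K xl yl \<le> ereal (C / (real K)\<^sup>2)) \<and>
                    (\<forall>K. step_gamma P inp K * DX P xl (iter_x P inp K)
                           + (1 - c_alpha inp) * DY P yl (iter_y P inp K)
                         \<le> step_sigma P inp 0 * Delta P inp xl yl)))"
    proof (rule exI[of _ a], intro conjI impI)
      show "xs \<longlonglongrightarrow> a" by (rule lim[OF s])
      show "step_gamma P inp \<in> \<Omega>(\<lambda>K. (real K)\<^sup>2)" by (rule growth)
    qed (rule uniq, rule yl, intro allI impI, rule limit)
  qed
qed

end
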